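(* Let $W_i=(M_{it},D_{it},A_{it},X_{it},U_{it})_{t=1,\dots,T}$ be i.i.d. with law $P$, with associated ground truth outcomes $M_{it}^*$. Let $G_{i2}$ be the indicator that unit $i$ is first treated at time $2$, $C_i$ the indicator that unit $i$ is never treated, and \[ \theta=E\bigl[M_{i2}^{*\,g=2}-M_{i2}^{*\,g=0}\mid G_{i2}=1\bigr], \] where the difference-in-differences identifying conditions listed in the context hold, so that, with $M_i^*=M_{i2}^*-M_{i1}^*$, $\theta=E[M_i^*\mid G_{i2}=1]-E[M_i^*\mid C_i=1]$. Put $M_i=M_{i2}-M_{i1}$, $A_i=A_{i1}A_{i2}$, $X_i=(X_{i1},X_{i2})$, $U_i=(U_{i1},U_{i2})$, $\tilde X_i=(X_i,U_i)$, $\mu_G(\tilde x)=E[M_i\mid G_{i2}=1,A_i=1,\tilde X_i=\tilde x]$, $\mu_C(\tilde x)=E[M_i\mid C_i=1,A_i=1,\tilde X_i=\tilde x]$, $\theta_G=E[\mu_G(\tilde X_i)\mid G_{i2}=1]$, $\theta_C=E[\mu_C(\tilde X_i)\mid C_i=1]$, so that $\theta=\theta_G-\theta_C$. The marginal probabilities $P(G_{i2}=1)$ and $P(C_i=1)$ are assumed to be effectively known. Let $\mathcal I,\mathcal I'$ be the disjoint index sets of a random sample split, $\hat\mu_G,\hat\mu_C$ estimators of $\mu_G,\mu_C$ that are functions of $\{W_{i'}\}_{i'\in\mathcal I'}$ only, and $\hat\theta=\hat\theta_G-\hat\theta_C$ with \[ \hat\theta_G=\frac1{|\mathcal I|}\sum_{i\in\mathcal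 I}\frac{G_{i2}}{P(G_{i2}=1)}\Bigl[\hat\mu_G(\tilde X_i)+\frac{A_i}{\pi(X_i)}(M_i-\hat\mu_G(\tilde X_i))\Bigr], \] \[ \hat\theta_C=\frac1{|\mathcal I|}\sum_{i\in\mathcal I}\frac{C_i}{P(C_i=1)}\Bigl[\hat\mu_C(\tilde X_i)+\frac{A_i}{\pi(X_i)}(M_i-\hat\mu_C(\tilde X_i))\Bigr]. \] Assume: (0) $(C_i,G_{i2})$ is conditionally independent of $A_i$ given $(X_i,U_i,M_i^* )$; (1) $M_{it}=A_{it}M_{it}^*$ with $A_{it}\in\{0,1\}$; (2) $(U_i,M_i^* )$ is conditionally independent of $A_i$ given $X_i$; (3) $\pi(x)=P(A_i=1\mid X_i=x)$ is fixed, known, and $\pi(x)\in[\eta,1]$ for all $x$, for some $0<\eta<1$; (4) for $q\in\{G,C\}$, $E\bigl[\int(\hat\mu_q(\tilde x)-\mu_q(\tilde x))^2\,dP_{\tilde X}(\tilde x)\bigr]=o(1)$ as $|\mathcal I'|\to\infty$. Then, as $|\mathcal I|,|\mathcal I'|\to\infty$, \[ \sqrt{|\mathcal I|}\,(\hat\theta-\theta)\xrightarrow{d}N\bigl(0,\mathrm{Var}(\varphi(W_i))\bigr), \] where $\varphi(W_i)=\varphi_G(W_i)-\varphi_C(W_i)$ is the efficient influence function for $\theta$, with \[ \varphi_G(W_i)=\frac{G_{i2}}{P(G_{i2}=1)}\Bigl[\mu_G(\tilde X_i)+\frac{A_i}{\pi(X_i)}(M_i-\mu_G(\tilde X_i))\Bigr]-\theta_G,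 \] \[ \varphi_C(W_i)=\frac{C_i}{P(C_i=1)}\Bigl[\mu_C(\tilde X_i)+\frac{A_i}{\pi(X_i)}(M_i-\mu_C(\tilde X_i))\Bigr]-\theta_C . \]
   Context: $M_{it}\in\mathbb R$ is the outcome observed at time $t$, $D_{it}\in\{0,1\}$ treatment indicators, $A_{it}$ annotation indicators, $X_{it}\in\mathbb R^k$ observed covariates, $U_{it}\in\mathbb R^\ell$ unstructured data. $P_{\tilde X}$ is the law of $\tilde X_i$. Because of the random split, the samples indexed by $\mathcal I$ and $\mathcal I'$ may be regarded as independent i.i.d. samples from $P$. Identifying conditions (staggered difference-in-differences, unconditional version, for cohort $g=2$ and time $t=2$): no unit is treated at $t=1$ and treatment is irreversible; $M_{it}^{*\,g}$ is the potential ground truth outcome at $t$ if first treated at $g$, $M_{it}^{*\,g=0}$ the untreated one, and $M_{it}^*=M_{it}^{*\,g=0}+\sum_{g=2}^T(M_{it}^{*\,g}-M_{it}^{*\,g=0})G_{ig}$ with $G_{ig}$ the indicator of first treatment at $g$; no anticipation: $E[M_{i1}^{*\,g=2}\mid G_{i2}=1]=E[M_{i1}^{*\,g=0}\mid G_{i2}=1]$; parallel trends: $E[M_{i2}^{*\,g=0}-M_{i1}^{*\,g=0}\mid G_{i2}=1]=E[M_{i2}^{*\,g=0}-M_{i1}^{*\,g=0}\mid C_i=1]$. The efficient influence function of a pathwise differentiable functional in a statistical model is the unique element $\varphi$ of the tangent space of the model at $P$ such that the pathwise derivative of the functional along every score $h$ equals $E_P[\varphi h]$; its variance is the semiparametric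 variance lower bound for regular asymptotically linear estimators. The statistical model is the semiparametric model induced by assumption (3), in which $\pi$ is known; $\varphi_G$ and $\varphi_C$ are the efficient influence functions of the functionals $E_P[\mu_G(\tilde X_i)\mid G_{i2}=1]$ and $E_P[\mu_C(\tilde X_i)\mid C_i=1]$, the marginal probabilities of $\{G_{i2}=1\}$ and $\{C_i=1\}$ being treated as effectively known given the size of the full sample. *)

theory Defs
  imports "HOL-Probability.Probability"
begin

section \<open>Panel data\<close>

text \<open>
  The data of one unit map the periods \<open>t = 1, \<dots>, T\<close> to tuples
  \<open>(M\<^sub>t, D\<^sub>t, A\<^sub>t, X\<^sub>t, U\<^sub>t)\<close>; the indicators \<open>D\<^sub>t\<close>, \<open>A\<^sub>t\<close> are Booleans.
\<close>

type_synonym ('k, 'l) obs = "real \<times> bool \<times> bool \<times> (real ^ 'k) \<times> (real ^ 'l)"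
type_synonym ('k, 'l) panel = "nat \<Rightarrow> ('k, 'l) obs"
type_synonym ('k, 'l) features =
  "((real ^ 'k) \<times> (real ^ 'k)) \<times> ((real ^ 'l) \<times> (real ^ 'l))"

definition obs_space :: "('k::finite, 'l::finite) obs measure" where
  "obs_space = borel \<Otimes>\<^sub>M count_space UNIV \<Otimes>\<^sub>M count_space UNIV \<Otimes>\<^sub>M borel \<Otimes>\<^sub>M borel"

definition panel_space :: "nat \<Rightarrow> ('k::finite, 'l::finite) panel measure" where
  "panel_space T = (\<Pi>\<^sub>M t\<in>{1..T}. obs_space)"

definition outcome :: "('k::finite, 'l::finite) panel \<Rightarrow> nat \<Rightarrow> real" where
  "outcome w t = fst (w t)"

definition treated :: "('k::finite, 'l::finite) panel \<Rightarrow> nat \<Rightarrow> bool" where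
  "treated w t = fst (snd (w t))"

definition annotated :: "('k::finite, 'l::finite) panel \<Rightarrow> nat \<Rightarrow> bool" where
  "annotated w t = fst (snd (snd (w t)))"

definition covariate :: "('k::finite, 'l::finite) panel \<Rightarrow> nat \<Rightarrow> real ^ 'k" where
  "covariate w t = fst (snd (snd (snd (w t))))"

definition unstructured :: "('k::finite, 'l::finite) panel \<Rightarrow> nat \<Rightarrow> real ^ 'l" where
  "unstructured w t = snd (snd (snd (snd (w t))))"

definition first_treated :: "nat \<Rightarrow> ('k::finite, 'l::finite) panel \<Rightarrow> bool" where
  "first_treated g w \<longleftrightarrow> treated w g \<and> (\<forall>t\<in>{1..<g}. \<not> treated w t)"

definition never_treated :: "nat \<Rightarrow> ('k::finite, 'l::finite) panel \<Rightarrow> bool" where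
  "never_treated T w \<longleftrightarrow> (\<forall>t\<in>{1..T}. \<not> treated w t)"

definition outcome_change :: "('k::finite, 'l::finite) panel \<Rightarrow> real" where
  "outcome_change w = outcome w 2 - outcome w 1"

definition annotated_both :: "('k::finite, 'l::finite) panel \<Rightarrow> bool" where
  "annotated_both w \<longleftrightarrow> annotated w 1 \<and> annotated w 2"

definition covariates :: "('k::finite, 'l::finite) panel \<Rightarrow> (real ^ 'k) \<times> (real ^ 'k)" where
  "covariates w = (covariate w 1, covariate w 2)"

definition unstructureds :: "('k::finite, 'l::finite) panel \<Rightarrow> (real ^ 'l) \<times> (real ^ 'l)" where
  "unstructureds w = (unstructured w 1, unstructured w 2)"

definition features :: "('k::finite, 'l::finite) panel \<Rightarrow> ('k, 'l) features" where
  "features w = (covariates w, unstructureds w)"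

text \<open>
  \<open>y g t\<close> is the potential outcome at \<open>t\<close> of a unit first treated at \<open>g\<close>; \<open>g = 0\<close>
  stands for the untreated state.
\<close>

definition ground_truth ::
    "nat \<Rightarrow> ('k::finite, 'l::finite) panel \<Rightarrow> (nat \<Rightarrow> nat \<Rightarrow> real) \<Rightarrow> nat \<Rightarrow> real" where
  "ground_truth T w y t = y 0 t + (\<Sum>g=2..T. (y g t - y 0 t) * of_bool (first_treated g w))"

definition ground_truth_change ::
    "nat \<Rightarrow> ('k::finite, 'l::finite) panel \<Rightarrow> (nat \<Rightarrow> nat \<Rightarrow> real) \<Rightarrow> real" where
  "ground_truth_change T w y = ground_truth T w y 2 - ground_truth T w y 1"


section \<open>Conditioning\<close>

definition given :: "'a measure \<Rightarrow> ('a \<Rightarrow> bool) \<Rightarrow> 'a measure" where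
  "given N B = uniform_measure N {x \<in> space N. B x}"

definition cond_exp_given :: "'a measure \<Rightarrow> ('a \<Rightarrow> 'b) \<Rightarrow> 'b measure \<Rightarrow> ('a \<Rightarrow> real) \<Rightarrow> 'a \<Rightarrow> real" where
  "cond_exp_given N Z MZ = real_cond_exp N (vimage_algebra (space N) Z MZ)"

definition cond_indep ::
    "'a measure \<Rightarrow> ('a \<Rightarrow> 'b) \<Rightarrow> 'b measure \<Rightarrow> ('a \<Rightarrow> 'c) \<Rightarrow> 'c measure
      \<Rightarrow> ('a \<Rightarrow> 'd) \<Rightarrow> 'd measure \<Rightarrow> bool" where
  "cond_indep N X MX Y MY Z MZ \<longleftrightarrow>
    (\<forall>S\<in>sets MX. \<forall>R\<in>sets MY. AE x in N.
      cond_exp_given N Z MZ (\<lambda>x. indicator S (X x) * indicator R (Y x)) x =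
      cond_exp_given N Z MZ (\<lambda>x. indicator S (X x)) x *
      cond_exp_given N Z MZ (\<lambda>x. indicator R (Y x)) x)"

text \<open>\<open>m\<close> is a version of \<open>v \<mapsto> E\<^sub>N[Y | B, V = v]\<close>.\<close>

definition is_regression ::
    "'a measure \<Rightarrow> ('a \<Rightarrow> bool) \<Rightarrow> ('a \<Rightarrow> 'v::topological_space) \<Rightarrow> ('a \<Rightarrow> real) \<Rightarrow> ('v \<Rightarrow> real) \<Rightarrow> bool" where
  "is_regression N B V Y m \<longleftrightarrow>
    m \<in> borel_measurable borel \<and>
    (AE x in given N B. m (V x) = cond_exp_given (given N B) V borel Y x)"

definition is_propensity ::
    "('k::finite, 'l::finite) panel measure \<Rightarrow> ((real ^ 'k) \<times> (real ^ 'k) \<Rightarrow> real) \<Rightarrow> bool" where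
  "is_propensity Q \<pi> \<longleftrightarrow>
    \<pi> \<in> borel_measurable borel \<and>
    (AE w in Q. \<pi> (covariates w) =
      cond_exp_given Q covariates borel (\<lambda>w. of_bool (annotated_both w)) w)"

text \<open>The degenerate law \<open>N(m, 0)\<close> is the point mass at \<open>m\<close>.\<close>

definition normal_law :: "real \<Rightarrow> real \<Rightarrow> real measure" where
  "normal_law m v =
    (if v = 0 then return borel m else density lborel (\<lambda>x. ennreal (normal_density m (sqrt v) x)))"


section \<open>Efficient influence functions\<close>

definition square_integrable :: "'a measure \<Rightarrow> ('a \<Rightarrow> real) \<Rightarrow> bool" where
  "square_integrable P h \<longleftrightarrow> h \<in> borel_measurable P \<and> integrable P (\<lambda>w. (h w)\<^sup>2)"

text \<open>
  One-dimensional submodels \<open>(Q t)\<close> through \<open>P\<close> at \<open>t = 0\<close> that are differentiable in quadratic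
  mean with score \<open>h\<close>. The likelihood ratios are required to be bounded away from \<open>0\<close> and
  infinity: along arbitrary differentiable submodels the mean of an unbounded outcome need not
  exist, let alone be differentiable. Scores may still be unbounded.
\<close>

definition regular_submodel ::
    "'a measure set \<Rightarrow> 'a measure \<Rightarrow> (real \<Rightarrow> 'a measure) \<Rightarrow> ('a \<Rightarrow> real) \<Rightarrow> bool" where
  "regular_submodel \<M> P Q h \<longleftrightarrow>
    square_integrable P h \<and>
    (\<exists>\<epsilon>>0. \<exists>K>0. \<exists>f.
      (\<forall>t\<in>{0<..<\<epsilon>}. Q t \<in> \<M> \<and> f t \<in> borel_measurable P \<and>
        (\<forall>w\<in>space P. 1 / K \<le> f t w \<and> f t w \<le> K) \<and>
        Q t = density P (\<lambda>w. ennreal (f t w))) \<and>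
      ((\<lambda>t. \<integral>w. ((sqrt (f t w) - 1) / t - h w / 2)\<^sup>2 \<partial>P) \<longlongrightarrow> 0) (at_right 0))"

definition scores :: "'a measure set \<Rightarrow> 'a measure \<Rightarrow> ('a \<Rightarrow> real) set" where
  "scores \<M> P = {h. \<exists>Q. regular_submodel \<M> P Q h}"

text \<open>The closed linear span of the scores in \<open>L\<^sup>2(P)\<close>.\<close>

definition tangent_space :: "'a measure set \<Rightarrow> 'a measure \<Rightarrow> ('a \<Rightarrow> real) set" where
  "tangent_space \<M> P =
    {\<phi>. square_integrable P \<phi> \<and>
      (\<forall>\<epsilon>>0. \<exists>(n::nat) c g. (\<forall>j<n. g j \<in> scores \<M> P) \<and>
        (\<integral>w. (\<phi> w - (\<Sum>j<n. c j * g j w))\<^sup>2 \<partial>P) < \<epsilon>)}"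

text \<open>Such a \<open>\<phi>\<close> is unique up to \<open>P\<close>-null sets.\<close>

definition efficient_influence_function ::
    "'a measure set \<Rightarrow> 'a measure \<Rightarrow> ('a measure \<Rightarrow> real) \<Rightarrow> ('a \<Rightarrow> real) \<Rightarrow> bool" where
  "efficient_influence_function \<M> P \<Psi> \<phi> \<longleftrightarrow>
    P \<in> \<M> \<and> \<phi> \<in> tangent_space \<M> P \<and>
    (\<forall>Q h. regular_submodel \<M> P Q h \<longrightarrow>
      ((\<lambda>t. (\<Psi> (Q t) - \<Psi> P) / t) \<longlongrightarrow> (\<integral>w. \<phi> w * h w \<partial>P)) (at_right 0))"


section \<open>Model, functional and estimating function\<close>

definition known_propensity_model ::
    "nat \<Rightarrow> ((real ^ 'k) \<times> (real ^ 'k) \<Rightarrow> real) \<Rightarrow> ('k::finite, 'l::finite) panel measure set" where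
  "known_propensity_model T \<pi> =
    {Q. prob_space Q \<and> sets Q = sets (panel_space T) \<and> is_propensity Q \<pi>}"

text \<open>
  For a cohort \<open>q\<close>, \<open>E\<^sub>Q[\<mu>\<^sub>q\<^sub>,\<^sub>Q(features) | q]\<close> with the known marginal probability \<open>p\<close> of \<open>q\<close> in
  the denominator. The number \<open>p\<close> does not vary with \<open>Q\<close>, and the model does not restrict the
  probability of \<open>q\<close> under \<open>Q\<close>. Along regular submodels the value does not depend on the version
  of the regression function that is chosen.
\<close>

definition cohort_functional ::
    "(('k::finite, 'l::finite) panel \<Rightarrow> bool) \<Rightarrow> real \<Rightarrow> ('k, 'l) panel measure \<Rightarrow> real" where
  "cohort_functional q p Q =
    (\<integral>w. of_bool (q w) *
       (SOME m. is_regression Q (\<lambda>w. q w \<and> annotated_both w) features outcome_change m) (features w) \<partial>Q)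
    / p"

definition aipw ::
    "(('k::finite, 'l::finite) panel \<Rightarrow> bool) \<Rightarrow> real \<Rightarrow> ((real ^ 'k) \<times> (real ^ 'k) \<Rightarrow> real)
      \<Rightarrow> (('k, 'l) features \<Rightarrow> real) \<Rightarrow> ('k, 'l) panel \<Rightarrow> real" where
  "aipw q p \<pi> m w =
    of_bool (q w) / p *
      (m (features w) +
       of_bool (annotated_both w) / \<pi> (covariates w) * (outcome_change w - m (features w)))"

end

theory Submission
  imports Defs
begin

text \<open>
  Assumptions (0) and (2) chain to independence of \<open>A\<close> from the cohorts, \<open>U\<close> and \<open>M\<^sup>*\<close> given \<open>X\<close>.
  Hence reweighting by \<open>A / \<pi>(X)\<close> preserves integrals over a cohort, which identifies \<open>\<theta>\<close>, and an
  error in \<open>\<mu>\<close> enters the estimating function only through \<open>q (1 - A / \<pi>(X)) (\<mu>hat - \<mu>)\<close>, which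
  is centred given the training sample. Its normalised sum over \<open>I\<close> therefore has second moment at most
  a constant times the mean squared error of \<open>\<mu>hat\<close>, and the limit law is that of the sum of the
  \<open>\<phi>(W\<^sub>i)\<close>.

  Along a submodel the same centring makes the perturbation of the regression function a second-order
  term, so the pathwise derivative is \<open>E[\<phi> h]\<close>. Membership of \<open>\<phi>\<close> in the tangent space follows by
  approximating it in \<open>L\<^sup>2\<close> by bounded \<open>h\<close> with \<open>E[h] = 0\<close> and \<open>E[h (A - \<pi>(X)) | X] = 0\<close>; these are
  scores of the linear paths \<open>(1 + t h) P\<close>.
\<close>

section \<open>Square integrability and conditioning\<close>

text \<open>The model fixes only E[A | X]. Balance within a cohort rests on (0) and (2) and may fail
  along a submodel. It is therefore used under \<open>P\<close> alone, and regressions under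
  \<open>Q t\<close> are carried back to \<open>P\<close>; this is possible because bounded
  likelihood ratios give \<open>P\<close> and \<open>Q t\<close> the same square integrable
  functions. Independence and propensity statements are kept as moment identities against
  indicators. These are linear in the measure, so they pass through image measures, extend from
  rectangles to Borel sets, and turn membership of (1 + t h) P in the model into a linear constraint
  on h. A regression is determined only on annotated units, whereas the estimand averages it over
  the whole cohort. The bound \<pi> \<ge> \<eta> closes this gap: it controls the regression on the
  cohort and makes the functional independent of the version chosen. For a particular training
  sample the estimated regression may fail to be square integrable, so second moments under sample
  splitting are nonnegative integrals, possibly infinite.\<close>

lemma power2_add_le: "(x + y)\<^sup>2 \<le> 2 * x\<^sup>2 + 2 * y\<^sup>2" for x y :: real
  using zero_le_power2[of "x - y"] by (simp add: power2_eq_square algebra_simps)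

lemma power2_diff_le: "(x - y)\<^sup>2 \<le> 2 * x\<^sup>2 + 2 * y\<^sup>2" for x y :: real
  using power2_add_le[of x "- y"] by simp

lemma square_integrableD [measurable_dest]: "square_integrable P f \<Longrightarrow> f \<in> borel_measurable P"
  by (simp add: square_integrable_def)

lemma square_integrable_power2: "square_integrable P f \<Longrightarrow> integrable P (\<lambda>x. (f x)\<^sup>2)"
  by (simp add: square_integrable_def)

lemma square_integrableI:
  assumes "f \<in> borel_measurable P" "integrable P g" "\<And>x. x \<in> space P \<Longrightarrow> (f x)\<^sup>2 \<le> g x"
  shows "square_integrable P f"
  unfolding square_integrable_def
proof
  show "integrable P (\<lambda>x. (f x)\<^sup>2)"
    by (rule Bochner_Integration.integrable_bound[OF assms(2)]) (use assms in \<open>auto intro!: AE_I2 intro: order_trans[OF _ abs_ge_self]\<close>)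
qed fact

lemma square_integrable_mult:
  assumes "square_integrable P f" "square_integrable P g"
  shows "integrable P (\<lambda>x. f x * g x)"
proof (rule Bochner_Integration.integrable_bound)
  show "integrable P (\<lambda>x. (f x)\<^sup>2 + (g x)\<^sup>2)"
    using assms by (simp add: square_integrable_def)
  show "(\<lambda>x. f x * g x) \<in> borel_measurable P"
    using assms by measurable
  have "\<bar>a * b\<bar> \<le> a\<^sup>2 + b\<^sup>2" for a b :: real
  proof -
    have "2 * (\<bar>a\<bar> * \<bar>b\<bar>) \<le> a\<^sup>2 + b\<^sup>2"
      using sum_squares_bound[of "\<bar>a\<bar>" "\<bar>b\<bar>"] by simp
    moreover have "0 \<le> \<bar>a\<bar> * \<bar>b\<bar>" by simp
    ultimately show ?thesis unfolding abs_mult by linarith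
  qed
  then show "AE x in P. norm (f x * g x) \<le> norm ((f x)\<^sup>2 + (g x)\<^sup>2)"
    by auto
qed

lemma square_integrable_add:
  assumes "square_integrable P f" "square_integrable P g"
  shows "square_integrable P (\<lambda>x. f x + g x)"
proof (rule square_integrableI)
  show "integrable P (\<lambda>x. 2 * (f x)\<^sup>2 + 2 * (g x)\<^sup>2)"
    using assms by (simp add: square_integrable_def)
  show "(f x + g x)\<^sup>2 \<le> 2 * (f x)\<^sup>2 + 2 * (g x)\<^sup>2" for x
    by (rule power2_add_le)
qed (use assms in measurable)

lemma square_integrable_bounded_mult:
  assumes "f \<in> borel_measurable P" "\<And>x. x \<in> space P \<Longrightarrow> \<bar>f x\<bar> \<le> c" "square_integrable P g"
  shows "square_integrable P (\<lambda>x. f x * g x)"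
proof (rule square_integrableI)
  show "integrable P (\<lambda>x. c\<^sup>2 * (g x)\<^sup>2)"
    using assms by (simp add: square_integrable_def)
  show "(f x * g x)\<^sup>2 \<le> c\<^sup>2 * (g x)\<^sup>2" if "x \<in> space P" for x
    unfolding power_mult_distrib using assms(2)[OF that]
    by (intro mult_right_mono) (auto simp: abs_le_square_iff[symmetric])
qed (use assms in measurable)

lemma square_integrable_cmult:
  "square_integrable P f \<Longrightarrow> square_integrable P (\<lambda>x. c * f x)"
  by (rule square_integrable_bounded_mult[where c="\<bar>c\<bar>"]) auto

lemma square_integrable_diff:
  assumes "square_integrable P f" "square_integrable P g"
  shows "square_integrable P (\<lambda>x. f x - g x)"
  using square_integrable_add[OF assms(1) square_integrable_cmult[OF assms(2), of "-1"]] by simp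

lemma (in finite_measure) square_integrable_bounded:
  assumes "f \<in> borel_measurable M" "\<And>x. x \<in> space M \<Longrightarrow> \<bar>f x\<bar> \<le> c"
  shows "square_integrable M f"
proof (rule square_integrableI[where g="\<lambda>_. c\<^sup>2"])
  show "(f x)\<^sup>2 \<le> c\<^sup>2" if "x \<in> space M" for x
    using assms(2)[OF that] by (simp add: abs_le_square_iff[symmetric])
qed (use assms in auto)

lemma (in finite_measure) square_integrable_imp_integrable':
  "square_integrable M f \<Longrightarrow> integrable M f"
  unfolding square_integrable_def by (elim conjE) (rule square_integrable_imp_integrable)

text \<open>Reduced to the inequality for nonnegative integrals. Absolute values are taken
  beforehand because \<open>ennreal\<close> sends negative numbers to 0.\<close>

lemma Cauchy_Schwarz_integral:
  assumes "square_integrable P f" "square_integrable P g"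
  shows "(\<integral>x. f x * g x \<partial>P)\<^sup>2 \<le> (\<integral>x. (f x)\<^sup>2 \<partial>P) * (\<integral>x. (g x)\<^sup>2 \<partial>P)"
proof -
  note [measurable] = assms
  have sq: "(\<integral>\<^sup>+x. ennreal \<bar>h x\<bar> ^ 2 \<partial>P) = ennreal (\<integral>x. (h x)\<^sup>2 \<partial>P)"
    if "square_integrable P h" for h
    using that by (subst nn_integral_eq_integral[symmetric])
      (auto simp: square_integrable_def ennreal_power power2_abs)
  have int: "integrable P (\<lambda>x. \<bar>f x\<bar> * \<bar>g x\<bar>)"
    using integrable_abs[OF square_integrable_mult[OF assms]] by (simp add: abs_mult)
  have "\<bar>\<integral>x. f x * g x \<partial>P\<bar> \<le> (\<integral>x. \<bar>f x\<bar> * \<bar>g x\<bar> \<partial>P)"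
    using integral_abs_bound[of P "\<lambda>x. f x * g x"] by (simp add: abs_mult)
  then have "(\<integral>x. f x * g x \<partial>P)\<^sup>2 \<le> (\<integral>x. \<bar>f x\<bar> * \<bar>g x\<bar> \<partial>P)\<^sup>2"
    by (subst abs_le_square_iff[symmetric]) auto
  moreover have "ennreal ((\<integral>x. \<bar>f x\<bar> * \<bar>g x\<bar> \<partial>P)\<^sup>2) \<le> ennreal ((\<integral>x. (f x)\<^sup>2 \<partial>P) * (\<integral>x. (g x)\<^sup>2 \<partial>P))"
  proof -
    have "ennreal ((\<integral>x. \<bar>f x\<bar> * \<bar>g x\<bar> \<partial>P)\<^sup>2) = (\<integral>\<^sup>+x. ennreal \<bar>f x\<bar> * ennreal \<bar>g x\<bar> \<partial>P)\<^sup>2"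
      using int by (simp add: ennreal_power[symmetric] nn_integral_eq_integral[symmetric] ennreal_mult)
    also have "\<dots> \<le> (\<integral>\<^sup>+x. ennreal \<bar>f x\<bar> ^ 2 \<partial>P) * (\<integral>\<^sup>+x. ennreal \<bar>g x\<bar> ^ 2 \<partial>P)"
      by (rule Cauchy_Schwarz_nn_integral) auto
    also have "\<dots> = ennreal ((\<integral>x. (f x)\<^sup>2 \<partial>P) * (\<integral>x. (g x)\<^sup>2 \<partial>P))"
      by (simp add: sq assms ennreal_mult)
    finally show ?thesis .
  qed
  ultimately show ?thesis
    by (subst (asm) ennreal_le_iff) auto
qed

section \<open>Truncation\<close>

definition clip :: "real \<Rightarrow> real \<Rightarrow> real" where
  "clip c x = max (- c) (min c x)"

lemma clip_measurable [measurable]: "clip c \<in> borel_measurable borel"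
  unfolding clip_def[abs_def] by measurable

lemma abs_clip_le: "0 \<le> c \<Longrightarrow> \<bar>clip c x\<bar> \<le> c"
  by (auto simp: clip_def)

lemma clip_square_le: "0 \<le> c \<Longrightarrow> (clip c x)\<^sup>2 \<le> c\<^sup>2"
  using abs_clip_le[of c x] by (simp add: abs_le_square_iff[symmetric])

lemma abs_diff_clip_le: "0 \<le> c \<Longrightarrow> \<bar>x - clip c x\<bar> \<le> \<bar>x\<bar>"
  by (auto simp: clip_def)

lemma clip_eq: "\<bar>x\<bar> \<le> c \<Longrightarrow> clip c x = x"
  by (auto simp: clip_def)

text \<open>For c \<ge> 0 clipping fixes 0, so an indicator may be moved inside. Truncation then
  applies to functions that are square integrable only after restriction to a cohort.\<close>

lemma mult_clip: "0 \<le> c \<Longrightarrow> of_bool b * (x - clip c x) = of_bool b * x - clip c (of_bool b * x)"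
  by (cases b) (auto simp: clip_def)

text \<open>At each point the difference vanishes once n exceeds |g x|, and its square is dominated
  by g^2.\<close>

lemma clip_tendsto_square_integrable:
  assumes g: "square_integrable P g"
  shows "(\<lambda>n. \<integral>x. (g x - clip (real n) (g x))\<^sup>2 \<partial>P) \<longlonglongrightarrow> 0"
proof -
  note [measurable] = g
  have "(\<lambda>n. \<integral>x. (g x - clip (real n) (g x))\<^sup>2 \<partial>P) \<longlonglongrightarrow> (\<integral>x. 0 \<partial>P)"
  proof (rule integral_dominated_convergence[where w="\<lambda>x. (g x)\<^sup>2"])
    have "(\<lambda>n. (g x - clip (real n) (g x))\<^sup>2) \<longlonglongrightarrow> 0" for x
    proof (rule tendsto_eventually)
      obtain N where "\<bar>g x\<bar> \<le> real N"
        using real_arch_simple by blast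
      then show "\<forall>\<^sub>F n in sequentially. (g x - clip (real n) (g x))\<^sup>2 = 0"
        by (auto simp: eventually_sequentially clip_eq intro!: exI[of _ N])
    qed
    then show "AE x in P. (\<lambda>n. (g x - clip (real n) (g x))\<^sup>2) \<longlonglongrightarrow> 0" by auto
    show "AE x in P. norm ((g x - clip (real n) (g x))\<^sup>2) \<le> (g x)\<^sup>2" for n
      by (auto simp: abs_le_square_iff[symmetric] intro!: AE_I2 abs_diff_clip_le)
    show "integrable P (\<lambda>x. (g x)\<^sup>2)"
      by (rule square_integrable_power2[OF g])
  qed (use g in measurable)
  then show ?thesis by simp
qed

text \<open>The Doob-Dynkin factorisation: each sublevel set of f at a rational level is a preimage
  under V, and f is the infimum of the rational levels above it.\<close>

lemma measurable_vimage_algebra_factor: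
  fixes f :: "'a \<Rightarrow> real"
  assumes f: "f \<in> borel_measurable (vimage_algebra \<Omega> V N)" and V: "V \<in> \<Omega> \<rightarrow> space N"
  shows "\<exists>m\<in>borel_measurable N. \<forall>x\<in>\<Omega>. f x = m (V x)"
proof -
  have "\<exists>D\<in>sets N. {x \<in> \<Omega>. f x < real_of_rat c} = V -` D \<inter> \<Omega>" for c
  proof -
    have "{x \<in> space (vimage_algebra \<Omega> V N). f x < real_of_rat c} \<in> sets (vimage_algebra \<Omega> V N)"
      using f by measurable
    then show ?thesis
      using V by (auto simp: sets_vimage_algebra2)
  qed
  then obtain D where D: "\<And>c. D c \<in> sets N" "\<And>c. {x \<in> \<Omega>. f x < real_of_rat c} = V -` D c \<inter> \<Omega>"
    by metis
  \<comment> \<open>The infimum lives in \<open>ereal\<close> because off the range of V it may be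
    infinite; \<open>real_of_ereal\<close> assigns 0 there, which does not affect the claim.\<close>
  define m where "m v = real_of_ereal (INF c. if v \<in> D c then ereal (real_of_rat c) else \<infinity>)" for v
  note [measurable] = D(1)
  have "m \<in> borel_measurable N"
    unfolding m_def by measurable
  moreover have "f x = m (V x)" if "x \<in> \<Omega>" for x
  proof -
    have in_D: "V x \<in> D c \<longleftrightarrow> f x < real_of_rat c" for c
      using D(2)[of c] that by auto
    have "(INF c. if V x \<in> D c then ereal (real_of_rat c) else \<infinity>) = ereal (f x)"
    proof (rule INF_eqI)
      fix y assume y: "\<And>c. c \<in> UNIV \<Longrightarrow> y \<le> (if V x \<in> D c then ereal (real_of_rat c) else \<infinity>)"
      show "y \<le> ereal (f x)"
      proof (rule ccontr)
        assume "\<not> y \<le> ereal (f x)"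
        then obtain z where z: "ereal (f x) < ereal z" "ereal z < y"
          using ereal_dense2[of "ereal (f x)" y] by (auto simp: not_le)
        then obtain c where "f x < real_of_rat c" "real_of_rat c < z"
          using of_rat_dense[of "f x" z] by auto
        with y[of c] in_D[of c] have "y \<le> ereal (real_of_rat c)"
          by simp
        also have "\<dots> < ereal z"
          using \<open>real_of_rat c < z\<close> by simp
        finally show False
          using z by simp
      qed
    qed (auto simp: in_D)
    then show ?thesis by (simp add: m_def)
  qed
  ultimately show ?thesis by blast
qed

section \<open>Image measures and conditioning on an event\<close>

context prob_space
begin

text \<open>Turns equality of integrals against indicators into equality of two image measures, and
  so into equality of integrals of all Borel functions of Z.\<close>

lemma emeasure_distr_density:
  assumes [measurable]: "Z \<in> measurable M N" "f \<in> borel_measurable M" "D \<in> sets N"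
    and f: "\<And>x. 0 \<le> f x" "\<And>x. f x \<le> 1"
  shows "emeasure (distr (density M (\<lambda>x. ennreal (f x))) N Z) D = ennreal (\<integral>x. f x * indicator D (Z x) \<partial>M)"
proof -
  have "integrable M (\<lambda>x. f x * indicator D (Z x))"
    using f by (intro integrable_const_bound[where B=1]) (auto split: split_indicator)
  then have "ennreal (\<integral>x. f x * indicator D (Z x) \<partial>M) = (\<integral>\<^sup>+x. ennreal (f x * indicator D (Z x)) \<partial>M)"
    using f by (intro nn_integral_eq_integral[symmetric]) auto
  also have "\<dots> = (\<integral>\<^sup>+x. ennreal (f x) * indicator (Z -` D \<inter> space M) x \<partial>M)"
    by (rule nn_integral_cong) (auto split: split_indicator)
  also have "\<dots> = emeasure (distr (density M (\<lambda>x. ennreal (f x))) N Z) D"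
    by (simp add: emeasure_distr emeasure_density)
  finally show ?thesis by simp
qed

lemma finite_measure_subalgebra_vimage:
  fixes Z :: "'a \<Rightarrow> 'z::topological_space"
  assumes "Z \<in> borel_measurable M"
  shows "finite_measure_subalgebra M (vimage_algebra (space M) Z borel)"
  by unfold_locales (use assms in \<open>auto simp: subalgebra_def sets_vimage_algebra2 measurable_def\<close>)

lemma
  assumes B [measurable]: "Measurable.pred M B" and pos: "\<P>(x in M. B x) > 0"
  shows prob_space_given: "prob_space (given M B)"
    and AE_given: "(AE x in given M B. R x) \<longleftrightarrow> (AE x in M. B x \<longrightarrow> R x)"
    and integrable_given: "f \<in> borel_measurable M \<Longrightarrow>
      integrable (given M B) f \<longleftrightarrow> integrable M (\<lambda>x. of_bool (B x) * f x :: real)"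
    and integral_given: "f \<in> borel_measurable M \<Longrightarrow>
      integral\<^sup>L (given M B) f = (\<integral>x. of_bool (B x) * f x \<partial>M) / \<P>(x in M. B x)"
proof -
  let ?B = "{x \<in> space M. B x}"
  have B0: "emeasure M ?B \<noteq> 0" "emeasure M ?B < \<infinity>"
    using pos by (auto simp: emeasure_eq_measure)
  show "prob_space (given M B)"
    unfolding given_def using B0 by (intro prob_space_uniform_measure) auto
  show "(AE x in given M B. R x) \<longleftrightarrow> (AE x in M. B x \<longrightarrow> R x)"
    unfolding given_def AE_uniform_measure[OF B0]
    by (rule AE_cong) auto
  have eq: "given M B = density M (\<lambda>x. ennreal (of_bool (B x) / \<P>(x in M. B x)))"
    unfolding given_def uniform_measure_def
    by (rule density_cong)
       (use pos in \<open>auto intro!: AE_I2 simp: emeasure_eq_measure divide_ennreal ennreal_1[symmetric]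
            split: split_indicator simp del: ennreal_1\<close>)
  have *: "integrable M (\<lambda>x. of_bool (B x) / \<P>(x in M. B x) * f x) \<longleftrightarrow>
      integrable M (\<lambda>x. of_bool (B x) * f x :: real)" for f
  proof -
    have "(\<lambda>x. of_bool (B x) / \<P>(x in M. B x) * f x) =
        (\<lambda>x. (1 / \<P>(x in M. B x)) * (of_bool (B x) * f x))"
      by auto
    then show ?thesis
      using pos by (simp only: integrable_mult_left_iff) simp
  qed
  show "integrable (given M B) f \<longleftrightarrow> integrable M (\<lambda>x. of_bool (B x) * f x :: real)"
    if "f \<in> borel_measurable M"
  proof -
    have "integrable (given M B) f \<longleftrightarrow> integrable M (\<lambda>x. (of_bool (B x) / \<P>(x in M. B x)) *\<^sub>R f x)"
      unfolding eq using that by (intro integrable_density) auto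
    then show ?thesis
      unfolding real_scaleR_def * .
  qed
  show "integral\<^sup>L (given M B) f = (\<integral>x. of_bool (B x) * f x \<partial>M) / \<P>(x in M. B x)"
    if "f \<in> borel_measurable M"
    unfolding eq using that by (subst integral_density) auto
qed

end

section \<open>Regressions in a cohort\<close>

context prob_space
begin

text \<open>\<open>real_cond_exp\<close> is a total function, measurable for the sigma-algebra
  generated by V, so it factors through V. This gives content to the choice in
  \<open>cohort_functional\<close> under every probability measure.\<close>

lemma regression_exists:
  fixes V :: "'a \<Rightarrow> 'v::topological_space"
  shows "\<exists>m. is_regression M B V Y m"
proof -
  have "\<exists>m\<in>borel_measurable borel. \<forall>x\<in>space M.
      real_cond_exp (given M B) (vimage_algebra (space M) V borel) Y x = m (V x)"
    by (rule measurable_vimage_algebra_factor) auto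
  then obtain m where m: "m \<in> borel_measurable borel"
    "\<And>x. x \<in> space M \<Longrightarrow> real_cond_exp (given M B) (vimage_algebra (space M) V borel) Y x = m (V x)"
    by auto
  have space: "space (given M B) = space M"
    by (simp add: given_def)
  have "is_regression M B V Y m"
    unfolding is_regression_def cond_exp_given_def using m by (auto simp: space)
  then show ?thesis by blast
qed

context
  fixes B :: "'a \<Rightarrow> bool" and V :: "'a \<Rightarrow> 'v::topological_space" and Y :: "'a \<Rightarrow> real"
  assumes B [measurable]: "Measurable.pred M B" and V [measurable]: "V \<in> borel_measurable M"
    and Y [measurable]: "Y \<in> borel_measurable M" and pos: "\<P>(x in M. B x) > 0"
    and Y2: "integrable M (\<lambda>x. of_bool (B x) * (Y x)\<^sup>2)"
begin

private abbreviation "R \<equiv> given M B"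
private abbreviation "F \<equiv> vimage_algebra (space M) V borel"

private lemma sets_R [measurable_cong]: "sets R = sets M" and space_R: "space R = space M"
  by (simp_all add: given_def)

private lemma subalgebra_R: "finite_measure_subalgebra R F"
proof -
  interpret R: prob_space R by (rule prob_space_given) (use pos in auto)
  have "V \<in> borel_measurable R" by measurable
  from R.finite_measure_subalgebra_vimage[OF this] show ?thesis
    by (simp add: space_R)
qed

private lemma integrable_Y: "integrable R Y" "integrable R (\<lambda>x. (Y x)\<^sup>2)"
proof -
  interpret R: prob_space R by (rule prob_space_given) (use pos in auto)
  show *: "integrable R (\<lambda>x. (Y x)\<^sup>2)"
    using Y2 by (subst integrable_given[OF B pos]) auto
  show "integrable R Y"
    by (rule R.square_integrable_imp_integrable[OF _ *]) measurable
qed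

text \<open>Jensen's inequality for conditional expectations gives the square integrability, the
  defining property of conditional expectation the orthogonality. Both are proved under
  \<open>given M B\<close> and moved to \<open>M\<close>, where the factor
  \<open>of_bool (B x)\<close> stands for the conditioning.\<close>

lemma
  assumes m: "is_regression M B V Y m"
  shows square_integrable_regression: "square_integrable M (\<lambda>x. of_bool (B x) * m (V x))"
    and regression_orthogonal: "g \<in> borel_measurable borel \<Longrightarrow>
      square_integrable M (\<lambda>x. of_bool (B x) * g (V x)) \<Longrightarrow>
      (\<integral>x. of_bool (B x) * ((Y x - m (V x)) * g (V x)) \<partial>M) = 0"
proof -
  interpret R: finite_measure_subalgebra R F by (rule subalgebra_R)
  have m_meas [measurable]: "m \<in> borel_measurable borel"
    and m_eq: "AE x in R. m (V x) = real_cond_exp R F Y x"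
    using m by (auto simp: is_regression_def cond_exp_given_def space_R)
  have "integrable R (\<lambda>x. (real_cond_exp R F Y x)\<^sup>2)"
    using integrable_Y by (intro R.integrable_convex_cond_exp[where I=UNIV]) (auto intro: convex_on_realI convex_power2)
  then have int: "integrable R (\<lambda>x. (m (V x))\<^sup>2)"
    by (rule integrable_cong_AE_imp) (use m_eq in auto)
  then have "integrable M (\<lambda>x. of_bool (B x) * (m (V x))\<^sup>2)"
    by (subst (asm) integrable_given[OF B pos]) auto
  then show sq: "square_integrable M (\<lambda>x. of_bool (B x) * m (V x))"
    by (simp add: square_integrable_def power_mult_distrib of_bool_def if_distrib[where f="\<lambda>x. x\<^sup>2"] cong: if_cong)
  show "(\<integral>x. of_bool (B x) * ((Y x - m (V x)) * g (V x)) \<partial>M) = 0"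
    if [measurable]: "g \<in> borel_measurable borel" and g: "square_integrable M (\<lambda>x. of_bool (B x) * g (V x))"
  proof -
    have sqB: "(of_bool b * c)\<^sup>2 = of_bool b * c\<^sup>2" for b and c :: real
      by simp
    have gR: "square_integrable R (\<lambda>x. g (V x))"
      using g by (auto simp: square_integrable_def integrable_given[OF B pos] sqB)
    have YR: "square_integrable R Y" and mR: "square_integrable R (\<lambda>x. m (V x))"
      using integrable_Y int by (auto simp: square_integrable_def)
    have gF: "(\<lambda>x. g (V x)) \<in> borel_measurable F"
      by (rule measurable_compose[OF measurable_vimage_algebra1]) auto
    have "(\<integral>x. g (V x) * m (V x) \<partial>R) = (\<integral>x. g (V x) * real_cond_exp R F Y x \<partial>R)"
      by (rule integral_cong_AE) (use m_eq in auto)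
    also have "\<dots> = (\<integral>x. g (V x) * Y x \<partial>R)"
      by (rule R.real_cond_exp_intg(2)) (use gF square_integrable_mult[OF gR YR] in auto)
    finally have "(\<integral>x. (Y x - m (V x)) * g (V x) \<partial>R) = 0"
      using square_integrable_mult[OF gR YR] square_integrable_mult[OF gR mR]
      by (simp add: algebra_simps)
    then show ?thesis
      using pos by (subst (asm) integral_given[OF B pos]) auto
  qed
qed

text \<open>The conditional expectation lies in [-c, c] almost everywhere, so clipping changes
  \<open>m\<close> only on a null event and yields a version that is bounded everywhere.\<close>

lemma regression_clip:
  assumes m: "is_regression M B V Y m" and le: "\<And>x. x \<in> space M \<Longrightarrow> \<bar>Y x\<bar> \<le> c"
  shows "is_regression M B V Y (\<lambda>v. clip c (m v))"
proof -
  interpret R: finite_measure_subalgebra R F by (rule subalgebra_R)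
  have "AE x in R. real_cond_exp R F Y x \<le> c"
    by (rule R.real_cond_exp_le_c[OF integrable_Y(1)]) (use le in \<open>auto simp: space_R abs_le_iff\<close>)
  moreover have "AE x in R. real_cond_exp R F Y x \<ge> - c"
    by (rule R.real_cond_exp_ge_c[OF integrable_Y(1)]) (use le in \<open>auto simp: space_R abs_le_iff minus_le_iff\<close>)
  ultimately show ?thesis
    using m by (auto simp: is_regression_def cond_exp_given_def space_R clip_def)
qed

end

end

text \<open>
  The assumption \<open>balanced\<close> is the integrated form of \<open>P(a | q, V) = r V\<close>. It is the only
  consequence of the conditional independence assumptions that the analysis under \<open>P\<close> needs.
\<close>

locale cohort = prob_space P for P :: "'a measure" +
  fixes q a :: "'a \<Rightarrow> bool" and V :: "'a \<Rightarrow> 'v::topological_space" and Y :: "'a \<Rightarrow> real"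
    and r :: "'v \<Rightarrow> real" and \<eta> :: real
  assumes q_measurable [measurable]: "Measurable.pred P q"
    and a_measurable [measurable]: "Measurable.pred P a"
    and V_measurable [measurable]: "V \<in> borel_measurable P"
    and Y_measurable [measurable]: "Y \<in> borel_measurable P"
    and r_measurable [measurable]: "r \<in> borel_measurable borel"
    and \<eta>: "0 < \<eta>" and r: "\<And>v. \<eta> \<le> r v" "\<And>v. r v \<le> 1"
    and q_pos: "\<P>(x in P. q x) > 0"
    and Y2: "integrable P (\<lambda>x. of_bool (q x \<and> a x) * (Y x)\<^sup>2)"
    and balanced: "\<And>D. D \<in> sets borel \<Longrightarrow>
      (\<integral>x. of_bool (q x \<and> a x) * indicator D (V x) \<partial>P) = (\<integral>x. of_bool (q x) * r (V x) * indicator D (V x) \<partial>P)"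
begin

lemma r_pos: "0 < r v" "r v \<noteq> 0" "\<bar>r v\<bar> \<le> 1" "0 \<le> r v"
  using r[of v] \<eta> by auto

lemma inverse_r: "\<bar>1 / r v\<bar> \<le> 1 / \<eta>" "1 / r v \<le> 1 / \<eta>"
  using r[of v] \<eta> by (auto simp: divide_simps)

lemma \<eta>_le_1: "\<eta> \<le> 1"
  using r[of undefined] by simp

text \<open>\<open>balanced\<close> says that two image measures agree on Borel sets; as an equality
  of measures it can be integrated.\<close>

lemma balanced_distr:
  "distr (density P (\<lambda>x. ennreal (of_bool (q x \<and> a x)))) borel V =
   distr (density P (\<lambda>x. ennreal (of_bool (q x) * r (V x)))) borel V"
proof (rule measure_eqI)
  fix D assume "D \<in> sets (distr (density P (\<lambda>x. ennreal (of_bool (q x \<and> a x)))) borel V)"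
  then have [measurable]: "D \<in> sets borel" by simp
  show "emeasure (distr (density P (\<lambda>x. ennreal (of_bool (q x \<and> a x)))) borel V) D =
    emeasure (distr (density P (\<lambda>x. ennreal (of_bool (q x) * r (V x)))) borel V) D"
    using balanced[of D] r r_pos by (subst (1 2) emeasure_distr_density) auto
qed simp

lemma balanced_nn_integral:
  assumes [measurable]: "g \<in> borel_measurable borel"
  shows "(\<integral>\<^sup>+x. ennreal (of_bool (q x \<and> a x)) * g (V x) \<partial>P) =
    (\<integral>\<^sup>+x. ennreal (of_bool (q x) * r (V x)) * g (V x) \<partial>P)"
  using arg_cong[OF balanced_distr, of "\<lambda>N. integral\<^sup>N N g"]
  by (simp add: nn_integral_distr nn_integral_density)

text \<open>Since the measures coincide, this also covers nonintegrable \<open>g\<close>, where both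
  sides are 0 by convention.\<close>

lemma balanced_integral:
  fixes g :: "'v \<Rightarrow> real"
  assumes [measurable]: "g \<in> borel_measurable borel"
  shows "(\<integral>x. of_bool (q x \<and> a x) * g (V x) \<partial>P) = (\<integral>x. of_bool (q x) * (r (V x) * g (V x)) \<partial>P)"
  using arg_cong[OF balanced_distr, of "\<lambda>N. integral\<^sup>L N g"] r_pos
  by (simp add: integral_distr integral_density mult.assoc)

text \<open>Overlap: P(q, a) = E[q r(V)] \<ge> \<eta> P(q).\<close>

lemma qa_pos: "\<P>(x in P. q x \<and> a x) > 0"
proof -
  have "\<P>(x in P. q x \<and> a x) = (\<integral>x. of_bool (q x \<and> a x) \<partial>P)"
    by (subst Bochner_Integration.integral_cong[OF refl, where g="indicator {x\<in>space P. q x \<and> a x}"])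
       (auto split: split_indicator)
  also have "\<dots> = (\<integral>x. of_bool (q x) * r (V x) \<partial>P)"
    using balanced_integral[of "\<lambda>_. 1"] by simp
  also have "\<dots> \<ge> (\<integral>x. \<eta> * indicator {x\<in>space P. q x} x \<partial>P)"
    using r r_pos by (intro integral_mono integrable_const_bound[where B=1]) (auto split: split_indicator simp: \<eta>_le_1 \<eta> less_imp_le)
  finally show ?thesis
    using mult_pos_pos[OF \<eta> q_pos] by (simp add: emeasure_eq_measure)
qed

text \<open>Control on annotated units extends to the cohort: q \<le> q r / \<eta>, and E[q r g^2] =
  E[q a g^2] by balance. Nonnegative integrals are used because integrability is part of the
  conclusion.\<close>

lemma square_integrable_cohort:
  assumes [measurable]: "g \<in> borel_measurable borel"
    and g: "square_integrable P (\<lambda>x. of_bool (q x \<and> a x) * g (V x))"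
  shows "square_integrable P (\<lambda>x. of_bool (q x) * g (V x))"
    and "(\<integral>x. (of_bool (q x) * g (V x))\<^sup>2 \<partial>P) \<le> (\<integral>x. (of_bool (q x \<and> a x) * g (V x))\<^sup>2 \<partial>P) / \<eta>"
proof -
  let ?b = "\<integral>x. (of_bool (q x \<and> a x) * g (V x))\<^sup>2 \<partial>P"
  have "(\<integral>\<^sup>+x. ennreal ((of_bool (q x) * g (V x))\<^sup>2) \<partial>P)
      \<le> (\<integral>\<^sup>+x. ennreal (1 / \<eta>) * (ennreal (of_bool (q x) * r (V x)) * ennreal ((g (V x))\<^sup>2)) \<partial>P)"
  proof (rule nn_integral_mono)
    fix x
    have "(of_bool (q x) * g (V x))\<^sup>2 \<le> 1 / \<eta> * (of_bool (q x) * r (V x) * (g (V x))\<^sup>2)"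
      using mult_right_mono[OF r(1)[of "V x"], of "(g (V x))\<^sup>2"] \<eta> by (auto simp: field_simps)
    then show "ennreal ((of_bool (q x) * g (V x))\<^sup>2)
        \<le> ennreal (1 / \<eta>) * (ennreal (of_bool (q x) * r (V x)) * ennreal ((g (V x))\<^sup>2))"
      using \<eta> r_pos by (auto simp: ennreal_mult'[symmetric] simp del: of_bool_eq)
  qed
  also have "\<dots> = ennreal (1 / \<eta>) * (\<integral>\<^sup>+x. ennreal (of_bool (q x) * r (V x)) * ennreal ((g (V x))\<^sup>2) \<partial>P)"
    by (rule nn_integral_cmult) measurable
  also have "(\<integral>\<^sup>+x. ennreal (of_bool (q x) * r (V x)) * ennreal ((g (V x))\<^sup>2) \<partial>P) =
      (\<integral>\<^sup>+x. ennreal (of_bool (q x \<and> a x)) * ennreal ((g (V x))\<^sup>2) \<partial>P)"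
    by (rule balanced_nn_integral[symmetric]) measurable
  also have "\<dots> = (\<integral>\<^sup>+x. ennreal ((of_bool (q x \<and> a x) * g (V x))\<^sup>2) \<partial>P)"
    by (rule nn_integral_cong) auto
  also have "\<dots> = ennreal ?b"
    using g by (intro nn_integral_eq_integral) (auto simp: square_integrable_def)
  finally have le: "(\<integral>\<^sup>+x. ennreal ((of_bool (q x) * g (V x))\<^sup>2) \<partial>P) \<le> ennreal (?b / \<eta>)"
    using \<eta> by (simp add: ennreal_mult'[symmetric])
  then have int: "integrable P (\<lambda>x. (of_bool (q x) * g (V x))\<^sup>2)"
    by (intro integrableI_bounded) (auto intro: le_less_trans)
  then show "square_integrable P (\<lambda>x. of_bool (q x) * g (V x))"
    by (simp add: square_integrable_def)
  show "(\<integral>x. (of_bool (q x) * g (V x))\<^sup>2 \<partial>P) \<le> ?b / \<eta>"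
    using le int \<eta> by (subst (asm) nn_integral_eq_integral) (auto simp: ennreal_le_iff)
qed

lemma balanced_bound: "\<bar>1 - of_bool (a x) / r (V x)\<bar> \<le> 1 / \<eta>"
proof -
  have "1 \<le> 1 / r (V x)" "1 \<le> 1 / \<eta>"
    using r_pos[of "V x"] r(2)[of "V x"] \<eta> \<eta>_le_1 by simp_all
  with inverse_r(2)[of "V x"] show ?thesis
    by (cases "a x") simp_all
qed

text \<open>Balance applied to g / r gives E[q a g / r] = E[q g], so an arbitrary error g of the
  regression, weighted by 1 - a / r, has mean 0. The factor \<eta>^2 is the square of the bound on
  this weight.\<close>

lemma balanced_remainder:
  assumes [measurable]: "g \<in> borel_measurable borel"
    and g: "square_integrable P (\<lambda>x. of_bool (q x) * g (V x))"
  shows "(\<integral>x. of_bool (q x) * ((1 - of_bool (a x) / r (V x)) * g (V x)) \<partial>P) = 0"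
    and "square_integrable P (\<lambda>x. of_bool (q x) * ((1 - of_bool (a x) / r (V x)) * g (V x)))"
    and "(\<integral>x. (of_bool (q x) * ((1 - of_bool (a x) / r (V x)) * g (V x)))\<^sup>2 \<partial>P) \<le>
      (\<integral>x. (of_bool (q x) * g (V x))\<^sup>2 \<partial>P) / \<eta>\<^sup>2"
proof -
  note bound = balanced_bound
  have eq: "(\<lambda>x. of_bool (q x) * ((1 - of_bool (a x) / r (V x)) * g (V x))) =
      (\<lambda>x. (1 - of_bool (a x) / r (V x)) * (of_bool (q x) * g (V x)))"
    by auto
  show sq: "square_integrable P (\<lambda>x. of_bool (q x) * ((1 - of_bool (a x) / r (V x)) * g (V x)))"
    unfolding eq by (rule square_integrable_bounded_mult[OF _ bound g]) measurable
  have "(of_bool (q x) * ((1 - of_bool (a x) / r (V x)) * g (V x)))\<^sup>2 \<le> (of_bool (q x) * g (V x))\<^sup>2 / \<eta>\<^sup>2" for x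
    using mult_right_mono[OF power_mono[OF bound[of x], of 2], of "(of_bool (q x) * g (V x))\<^sup>2"]
    by (auto simp: power_mult_distrib power_divide)
  then have "(\<integral>x. (of_bool (q x) * ((1 - of_bool (a x) / r (V x)) * g (V x)))\<^sup>2 \<partial>P) \<le>
      (\<integral>x. (of_bool (q x) * g (V x))\<^sup>2 / \<eta>\<^sup>2 \<partial>P)"
    using sq g by (intro integral_mono) (auto simp: square_integrable_def)
  then show "(\<integral>x. (of_bool (q x) * ((1 - of_bool (a x) / r (V x)) * g (V x)))\<^sup>2 \<partial>P) \<le>
      (\<integral>x. (of_bool (q x) * g (V x))\<^sup>2 \<partial>P) / \<eta>\<^sup>2"
    by simp
  have i1: "integrable P (\<lambda>x. of_bool (q x) * g (V x))"
    by (rule square_integrable_imp_integrable'[OF g])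
  have i2: "integrable P (\<lambda>x. of_bool (q x \<and> a x) * (g (V x) / r (V x)))"
  proof (rule Bochner_Integration.integrable_bound)
    show "integrable P (\<lambda>x. 1 / \<eta> * (of_bool (q x) * g (V x)))"
      using i1 by simp
    have "\<bar>of_bool (q x \<and> a x) * (g (V x) / r (V x))\<bar> \<le> \<bar>1 / \<eta> * (of_bool (q x) * g (V x))\<bar>" for x
      using mult_right_mono[OF inverse_r(1)[of "V x"], of "\<bar>g (V x)\<bar>"] \<eta> by (auto simp: abs_mult)
    then show "AE x in P. norm (of_bool (q x \<and> a x) * (g (V x) / r (V x))) \<le> norm (1 / \<eta> * (of_bool (q x) * g (V x)))"
      by (auto simp del: of_bool_conj)
  qed measurable
  have "(\<integral>x. of_bool (q x) * ((1 - of_bool (a x) / r (V x)) * g (V x)) \<partial>P) =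
      (\<integral>x. of_bool (q x) * g (V x) - of_bool (q x \<and> a x) * (g (V x) / r (V x)) \<partial>P)"
    by (rule Bochner_Integration.integral_cong) (auto simp: algebra_simps)
  also have "\<dots> = (\<integral>x. of_bool (q x) * g (V x) \<partial>P) - (\<integral>x. of_bool (q x \<and> a x) * (g (V x) / r (V x)) \<partial>P)"
    by (rule Bochner_Integration.integral_diff[OF i1 i2])
  also have "(\<integral>x. of_bool (q x \<and> a x) * (g (V x) / r (V x)) \<partial>P) = (\<integral>x. of_bool (q x) * g (V x) \<partial>P)"
    using balanced_integral[of "\<lambda>v. g v / r v"] r_pos by simp
  finally show "(\<integral>x. of_bool (q x) * ((1 - of_bool (a x) / r (V x)) * g (V x)) \<partial>P) = 0"
    by simp
qed

end

section \<open>Densities differentiable in quadratic mean\<close>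

context prob_space
begin

lemma tendsto_integral_bounded_mult:
  fixes b :: "'t \<Rightarrow> 'a \<Rightarrow> real"
  assumes g: "integrable M g"
    and b: "\<forall>\<^sub>F t in F. b t \<in> borel_measurable M \<and> (\<forall>x\<in>space M. \<bar>b t x\<bar> \<le> c)"
    and lim: "((\<lambda>t. \<integral>x. (b t x)\<^sup>2 \<partial>M) \<longlongrightarrow> 0) F" and c: "0 \<le> c"
  shows "((\<lambda>t. \<integral>x. b t x * g x \<partial>M) \<longlongrightarrow> 0) F"
proof (rule tendstoI)
  fix e :: real assume e: "0 < e"
  note [measurable] = borel_measurable_integrable[OF g]
  define s where "s n x = \<bar>g x\<bar> * indicator {x\<in>space M. real n < \<bar>g x\<bar>} x" for n x
  have [measurable]: "s n \<in> borel_measurable M" for n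
    unfolding s_def by measurable
  have s_int: "integrable M (s n)" for n
    by (rule Bochner_Integration.integrable_bound[OF g]) (auto simp: s_def split: split_indicator)
  have "(\<lambda>n. integral\<^sup>L M (s n)) \<longlonglongrightarrow> integral\<^sup>L M (\<lambda>_. 0)"
  proof (rule integral_dominated_convergence[where w="\<lambda>x. \<bar>g x\<bar>"])
    have "(\<lambda>n. s n x) \<longlonglongrightarrow> 0" for x
    proof (rule tendsto_eventually)
      obtain N where "\<bar>g x\<bar> \<le> real N"
        using real_arch_simple by blast
      then show "\<forall>\<^sub>F n in sequentially. s n x = 0"
        by (auto simp: s_def eventually_sequentially split: split_indicator intro!: exI[of _ N])
    qed
    then show "AE x in M. (\<lambda>n. s n x) \<longlonglongrightarrow> 0" by auto
  qed (use g in \<open>auto simp: s_def split: split_indicator\<close>)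
  \<comment> \<open>c + 1 instead of c keeps the threshold meaningful when c = 0.\<close>
  then have "\<forall>\<^sub>F n in sequentially. integral\<^sup>L M (s n) < e / (4 * (c + 1))"
    using e c by (intro order_tendstoD(2)) auto
  then obtain n where n: "integral\<^sup>L M (s n) < e / (4 * (c + 1))"
    by (auto simp: eventually_sequentially)
  have sn0: "0 \<le> integral\<^sup>L M (s n)"
    by (rule integral_nonneg_AE) (auto simp: s_def)
  have "((\<lambda>t. (real n)\<^sup>2 / e * (\<integral>x. (b t x)\<^sup>2 \<partial>M)) \<longlongrightarrow> 0) F"
    by (rule tendsto_mult_right_zero[OF lim])
  then have "\<forall>\<^sub>F t in F. (real n)\<^sup>2 / e * (\<integral>x. (b t x)\<^sup>2 \<partial>M) < e / 4"
    using e by (intro order_tendstoD(2)) auto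
  with b show "\<forall>\<^sub>F t in F. dist (\<integral>x. b t x * g x \<partial>M) 0 < e"
  proof eventually_elim
    case (elim t)
    have [measurable]: "b t \<in> borel_measurable M" using elim by blast
    have bt: "square_integrable M (b t)"
      by (rule square_integrable_bounded[where c=c]) (use elim in auto)
    have le: "\<bar>b t x * g x\<bar> \<le> e / 4 + (real n)\<^sup>2 / e * (b t x)\<^sup>2 + c * s n x" if x: "x \<in> space M" for x
    proof (cases "real n < \<bar>g x\<bar>")
      case True
      then have "\<bar>b t x * g x\<bar> \<le> c * s n x"
        using elim x by (auto simp: s_def abs_mult mult_right_mono)
      moreover have "0 \<le> e / 4" "0 \<le> (real n)\<^sup>2 / e * (b t x)\<^sup>2"
        using e by auto
      ultimately show ?thesis by linarith
    next
      case False
      have "\<bar>b t x * g x\<bar> \<le> \<bar>b t x\<bar> * real n"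
        unfolding abs_mult using False by (intro mult_left_mono) auto
      \<comment> \<open>Young's inequality, from expanding (e / 2 - n |b|)^2 \<ge> 0.\<close>
      also have "\<dots> \<le> e / 4 + (real n)\<^sup>2 / e * (b t x)\<^sup>2"
      proof -
        have "0 \<le> (e / 2 - real n * \<bar>b t x\<bar>)\<^sup>2" by simp
        then have "e * (\<bar>b t x\<bar> * real n) \<le> e * (e / 4) + (real n)\<^sup>2 * (b t x)\<^sup>2"
          by (simp add: power2_eq_square algebra_simps)
        then have "(\<bar>b t x\<bar> * real n) \<le> (e * (e / 4) + (real n)\<^sup>2 * (b t x)\<^sup>2) / e"
          using e by (simp add: pos_le_divide_eq mult.commute)
        also have "\<dots> = e / 4 + (real n)\<^sup>2 / e * (b t x)\<^sup>2"
          using e by (simp add: add_divide_distrib)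
        finally show ?thesis .
      qed
      finally show ?thesis
        using False by (simp add: s_def)
    qed
    have "\<bar>\<integral>x. b t x * g x \<partial>M\<bar> \<le> (\<integral>x. \<bar>b t x * g x\<bar> \<partial>M)"
      by (rule integral_abs_bound)
    also have "\<dots> \<le> (\<integral>x. e / 4 + (real n)\<^sup>2 / e * (b t x)\<^sup>2 + c * s n x \<partial>M)"
      using le order_trans[OF abs_ge_zero le] bt s_int
      by (intro integral_mono_AE') (auto simp: square_integrable_def)
    also have "\<dots> = e / 4 + (real n)\<^sup>2 / e * (\<integral>x. (b t x)\<^sup>2 \<partial>M) + c * integral\<^sup>L M (s n)"
      using bt s_int by (simp add: square_integrable_def prob_space)
    also have "\<dots> < e / 4 + e / 4 + e / 4"
    proof -
      have "c * integral\<^sup>L M (s n) \<le> (c + 1) * integral\<^sup>L M (s n)"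
        using sn0 by (simp add: algebra_simps)
      also have "\<dots> < e / 4"
        using n c by (simp add: field_simps)
      finally show ?thesis using elim by linarith
    qed
    also have "\<dots> \<le> e" using e by simp
    finally show ?case by simp
  qed
qed

context
  fixes f :: "real \<Rightarrow> 'a \<Rightarrow> real" and h :: "'a \<Rightarrow> real" and \<epsilon> K :: real
  assumes \<epsilon>: "0 < \<epsilon>" and K: "0 < K"
    and f: "\<And>t. t \<in> {0<..<\<epsilon>} \<Longrightarrow> f t \<in> borel_measurable M"
    and f_bounds: "\<And>t x. t \<in> {0<..<\<epsilon>} \<Longrightarrow> x \<in> space M \<Longrightarrow> 1 / K \<le> f t x \<and> f t x \<le> K"
    and h: "square_integrable M h"
    and dqm: "((\<lambda>t. \<integral>x. ((sqrt (f t x) - 1) / t - h x / 2)\<^sup>2 \<partial>M) \<longlongrightarrow> 0) (at_right 0)"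
begin

private lemma ev: "\<forall>\<^sub>F t in at_right 0. t \<in> {0<..<\<epsilon>}"
  using eventually_at_right_real[OF \<epsilon>] .

text \<open>The error in quadratic mean differentiability: sqrt (f t) = 1 + t (h / 2 + u t), and
  \<open>dqm\<close> says that u t tends to 0 in L^2.\<close>

private definition "u t x = (sqrt (f t x) - 1) / t - h x / 2"

private lemma f_pos: "t \<in> {0<..<\<epsilon>} \<Longrightarrow> x \<in> space M \<Longrightarrow> 0 < f t x"
  using f_bounds[of t x] K by (auto intro: less_le_trans[of _ "1 / K"])

private lemma sqrt_f: "t \<in> {0<..<\<epsilon>} \<Longrightarrow> x \<in> space M \<Longrightarrow> \<bar>sqrt (f t x) + 1\<bar> \<le> sqrt K + 1"
  using f_bounds[of t x] f_pos[of t x] by auto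

private lemma sqrt_f_diff:
  assumes t: "t \<in> {0<..<\<epsilon>}" and x: "x \<in> space M"
  shows "\<bar>sqrt (f t x) - 1\<bar> \<le> sqrt K + 1"
proof -
  have "0 \<le> sqrt (f t x)" "sqrt (f t x) \<le> sqrt K"
    using f_bounds[OF t x] f_pos[OF t x] by auto
  then show ?thesis by linarith
qed

private lemma u: "t \<in> {0<..<\<epsilon>} \<Longrightarrow> square_integrable M (u t)"
proof -
  assume t: "t \<in> {0<..<\<epsilon>}"
  note [measurable] = f[OF t]
  have "square_integrable M (\<lambda>x. (1 / t) * (sqrt (f t x) - 1))"
    by (intro square_integrable_cmult square_integrable_bounded[OF _ sqrt_f_diff[OF t]]) simp
  from square_integrable_diff[OF this square_integrable_cmult[OF h, of "1/2"]]
  show ?thesis by (simp add: u_def[abs_def] field_simps)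
qed

private lemma f_square: "t \<in> {0<..<\<epsilon>} \<Longrightarrow> square_integrable M (\<lambda>x. f t x - 1)"
proof -
  assume t: "t \<in> {0<..<\<epsilon>}"
  note [measurable] = f[OF t]
  show ?thesis
  proof (rule square_integrable_bounded)
    show "\<bar>f t x - 1\<bar> \<le> K + 1" if "x \<in> space M" for x
      using f_bounds[OF t that] f_pos[OF t that] by (auto simp: abs_le_iff)
  qed simp
qed

text \<open>Passes from the expansion of sqrt f to one of f through f - 1 = (sqrt f + 1) (sqrt f -
  1), whose first factor is bounded.\<close>

private lemma f_diff:
  assumes t: "t \<in> {0<..<\<epsilon>}" and x: "x \<in> space M"
  shows "(f t x - 1) / t = (sqrt (f t x) + 1) * (u t x + h x / 2)"
proof -
  have "f t x - 1 = (sqrt (f t x) + 1) * (sqrt (f t x) - 1)"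
    using f_pos[OF t x] by (simp add: algebra_simps)
  then show ?thesis by (simp add: u_def)
qed

lemma density_diff_quotient_bounded:
  "\<exists>C. \<forall>\<^sub>F t in at_right 0. (\<integral>x. ((f t x - 1) / t)\<^sup>2 \<partial>M) \<le> C"
proof -
  \<comment> \<open>The square of sqrt K + 1 bounds the factor sqrt f + 1; the other factor bounds
    the integral of 2 u^2 + h^2 as soon as that of u^2 is below 1.\<close>
  define C where "C = (sqrt K + 1)\<^sup>2 * (2 + (\<integral>x. (h x)\<^sup>2 \<partial>M))"
  have "\<forall>\<^sub>F t in at_right 0. (\<integral>x. (u t x)\<^sup>2 \<partial>M) < 1"
    using dqm unfolding u_def by (intro order_tendstoD(2)) auto
  with ev have "\<forall>\<^sub>F t in at_right 0. (\<integral>x. ((f t x - 1) / t)\<^sup>2 \<partial>M) \<le> C"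
  proof eventually_elim
    case (elim t)
    note t = elim(1)
    have "(\<integral>x. ((f t x - 1) / t)\<^sup>2 \<partial>M) \<le> (\<integral>x. (sqrt K + 1)\<^sup>2 * (2 * (u t x)\<^sup>2 + (h x)\<^sup>2) \<partial>M)"
    proof (rule integral_mono)
      fix x assume x: "x \<in> space M"
      have "(u t x + h x / 2)\<^sup>2 \<le> 2 * (u t x)\<^sup>2 + (h x)\<^sup>2"
      proof -
        have "(u t x + h x / 2)\<^sup>2 \<le> 2 * (u t x)\<^sup>2 + 2 * (h x / 2)\<^sup>2"
          by (rule power2_add_le)
        also have "\<dots> \<le> 2 * (u t x)\<^sup>2 + (h x)\<^sup>2"
          by (simp add: power_divide)
        finally show ?thesis .
      qed
      moreover have "(sqrt (f t x) + 1)\<^sup>2 \<le> (sqrt K + 1)\<^sup>2"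
        using power_mono[OF sqrt_f[OF t x], of 2] by simp
      ultimately show "((f t x - 1) / t)\<^sup>2 \<le> (sqrt K + 1)\<^sup>2 * (2 * (u t x)\<^sup>2 + (h x)\<^sup>2)"
        unfolding f_diff[OF t x] power_mult_distrib by (intro mult_mono) auto
    qed (use f_square[OF t] u[OF t] h in \<open>auto simp: square_integrable_def power_divide\<close>)
    also have "\<dots> = (sqrt K + 1)\<^sup>2 * (2 * (\<integral>x. (u t x)\<^sup>2 \<partial>M) + (\<integral>x. (h x)\<^sup>2 \<partial>M))"
      using u[OF t] h by (simp add: square_integrable_def)
    also have "\<dots> \<le> C"
      unfolding C_def using elim(2) by (intro mult_left_mono) auto
    finally show ?case .
  qed
  then show ?thesis ..
qed

lemma density_diff_tendsto_0:
  "((\<lambda>t. \<integral>x. (f t x - 1)\<^sup>2 \<partial>M) \<longlongrightarrow> 0) (at_right 0)"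
proof -
  obtain C where C: "\<forall>\<^sub>F t in at_right 0. (\<integral>x. ((f t x - 1) / t)\<^sup>2 \<partial>M) \<le> C"
    using density_diff_quotient_bounded by blast
  have "((\<lambda>t::real. C * t\<^sup>2) \<longlongrightarrow> 0) (at_right 0)"
    by (auto intro!: tendsto_eq_intros)
  then show ?thesis
  proof (rule Lim_null_comparison[rotated])
    show "\<forall>\<^sub>F t in at_right 0. norm (\<integral>x. (f t x - 1)\<^sup>2 \<partial>M) \<le> C * t\<^sup>2"
      using ev C
    proof eventually_elim
      case (elim t)
      then have "(\<integral>x. (f t x - 1)\<^sup>2 \<partial>M) = t\<^sup>2 * (\<integral>x. ((f t x - 1) / t)\<^sup>2 \<partial>M)"
        by (simp add: power_divide)
      also have "\<dots> \<le> t\<^sup>2 * C"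
        using elim by (intro mult_left_mono) auto
      finally show ?case
        by (simp add: mult.commute)
    qed
  qed
qed

text \<open>By \<open>f_diff\<close> the integrand is (sqrt f + 1) u \<psi> + (sqrt f - 1) h \<psi>
  / 2 + h \<psi>. The first term vanishes by Cauchy-Schwarz. In the second, h \<psi> is merely
  integrable, which calls for \<open>tendsto_integral_bounded_mult\<close>.\<close>

lemma density_derivative:
  assumes \<psi>: "square_integrable M \<psi>"
  shows "((\<lambda>t. (\<integral>x. (f t x - 1) * \<psi> x \<partial>M) / t) \<longlongrightarrow> (\<integral>x. h x * \<psi> x \<partial>M)) (at_right 0)"
proof -
  have h\<psi>: "integrable M (\<lambda>x. h x * \<psi> x)"
    by (rule square_integrable_mult[OF h \<psi>])
  have first: "((\<lambda>t. \<integral>x. (sqrt (f t x) + 1) * u t x * \<psi> x \<partial>M) \<longlongrightarrow> 0) (at_right 0)"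
  proof (rule Lim_null_comparison)
    show "((\<lambda>t. (sqrt K + 1) * sqrt ((\<integral>x. (u t x)\<^sup>2 \<partial>M) * (\<integral>x. (\<psi> x)\<^sup>2 \<partial>M))) \<longlongrightarrow> 0) (at_right 0)"
      using dqm unfolding u_def by (auto intro!: tendsto_eq_intros)
    show "\<forall>\<^sub>F t in at_right 0. norm (\<integral>x. (sqrt (f t x) + 1) * u t x * \<psi> x \<partial>M) \<le>
        (sqrt K + 1) * sqrt ((\<integral>x. (u t x)\<^sup>2 \<partial>M) * (\<integral>x. (\<psi> x)\<^sup>2 \<partial>M))"
      using ev
    proof eventually_elim
      case (elim t)
      note [measurable] = f[OF elim]
      have sq: "square_integrable M (\<lambda>x. (sqrt (f t x) + 1) * u t x)"
        by (rule square_integrable_bounded_mult[OF _ sqrt_f[OF elim] u[OF elim]]) auto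
      have "(\<integral>x. (sqrt (f t x) + 1) * u t x * \<psi> x \<partial>M)\<^sup>2 \<le>
          (\<integral>x. ((sqrt (f t x) + 1) * u t x)\<^sup>2 \<partial>M) * (\<integral>x. (\<psi> x)\<^sup>2 \<partial>M)"
        by (rule Cauchy_Schwarz_integral[OF sq \<psi>])
      also have "\<dots> \<le> (\<integral>x. (sqrt K + 1)\<^sup>2 * (u t x)\<^sup>2 \<partial>M) * (\<integral>x. (\<psi> x)\<^sup>2 \<partial>M)"
      proof (intro mult_right_mono integral_mono)
        fix x assume x: "x \<in> space M"
        show "((sqrt (f t x) + 1) * u t x)\<^sup>2 \<le> (sqrt K + 1)\<^sup>2 * (u t x)\<^sup>2"
          unfolding power_mult_distrib
          using power_mono[OF sqrt_f[OF elim x], of 2] by (intro mult_right_mono) simp_all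
      qed (use sq u[OF elim] in \<open>auto simp: square_integrable_def\<close>)
      finally have "(\<integral>x. (sqrt (f t x) + 1) * u t x * \<psi> x \<partial>M)\<^sup>2 \<le>
          (sqrt K + 1)\<^sup>2 * ((\<integral>x. (u t x)\<^sup>2 \<partial>M) * (\<integral>x. (\<psi> x)\<^sup>2 \<partial>M))"
        by simp
      from real_sqrt_le_mono[OF this] K show ?case
        by (simp add: real_sqrt_mult)
    qed
  qed
  have second: "((\<lambda>t. \<integral>x. (sqrt (f t x) - 1) * (h x * \<psi> x) \<partial>M) \<longlongrightarrow> 0) (at_right 0)"
  proof (rule tendsto_integral_bounded_mult[OF h\<psi>])
    show "\<forall>\<^sub>F t in at_right 0. (\<lambda>x. sqrt (f t x) - 1) \<in> borel_measurable M \<and>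
        (\<forall>x\<in>space M. \<bar>sqrt (f t x) - 1\<bar> \<le> sqrt K + 1)"
      using ev
    proof eventually_elim
      case (elim t)
      note [measurable] = f[OF elim]
      from sqrt_f_diff[OF elim] show ?case by simp
    qed
    show "((\<lambda>t. \<integral>x. (sqrt (f t x) - 1)\<^sup>2 \<partial>M) \<longlongrightarrow> 0) (at_right 0)"
    proof (rule Lim_null_comparison[OF _ density_diff_tendsto_0])
      show "\<forall>\<^sub>F t in at_right 0. norm (\<integral>x. (sqrt (f t x) - 1)\<^sup>2 \<partial>M) \<le> (\<integral>x. (f t x - 1)\<^sup>2 \<partial>M)"
        using ev
      proof eventually_elim
        case (elim t)
        have "(\<integral>x. (sqrt (f t x) - 1)\<^sup>2 \<partial>M) \<le> (\<integral>x. (f t x - 1)\<^sup>2 \<partial>M)"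
        proof (rule integral_mono_AE')
          have "(sqrt (f t x) - 1)\<^sup>2 \<le> (f t x - 1)\<^sup>2" if x: "x \<in> space M" for x
          proof -
            have "f t x - 1 = (sqrt (f t x) + 1) * (sqrt (f t x) - 1)"
              using f_pos[OF elim x] by (simp add: algebra_simps)
            moreover have "1 \<le> (sqrt (f t x) + 1)\<^sup>2"
              using f_pos[OF elim x] by (intro one_le_power) auto
            ultimately show ?thesis
              using mult_right_mono[of 1 "(sqrt (f t x) + 1)\<^sup>2" "(sqrt (f t x) - 1)\<^sup>2"]
              by (simp add: power_mult_distrib)
          qed
          then show "AE x in M. (sqrt (f t x) - 1)\<^sup>2 \<le> (f t x - 1)\<^sup>2" by auto
        qed (use f_square[OF elim] in \<open>auto simp: square_integrable_def\<close>)
        then show ?case by simp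
      qed
    qed
  qed (use K in auto)
  have "((\<lambda>t. (\<integral>x. (sqrt (f t x) + 1) * u t x * \<psi> x \<partial>M) +
      (\<integral>x. (sqrt (f t x) - 1) * (h x * \<psi> x) \<partial>M) / 2 + (\<integral>x. h x * \<psi> x \<partial>M)) \<longlongrightarrow>
      0 + 0 / 2 + (\<integral>x. h x * \<psi> x \<partial>M)) (at_right 0)"
    using first second by (intro tendsto_intros) auto
  moreover have "\<forall>\<^sub>F t in at_right 0. (\<integral>x. (sqrt (f t x) + 1) * u t x * \<psi> x \<partial>M) +
      (\<integral>x. (sqrt (f t x) - 1) * (h x * \<psi> x) \<partial>M) / 2 + (\<integral>x. h x * \<psi> x \<partial>M) =
      (\<integral>x. (f t x - 1) * \<psi> x \<partial>M) / t"
    using ev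
  proof eventually_elim
    case (elim t)
    note [measurable] = f[OF elim]
    have i1: "integrable M (\<lambda>x. (sqrt (f t x) + 1) * u t x * \<psi> x)"
      by (intro square_integrable_mult[OF _ \<psi>] square_integrable_bounded_mult[OF _ sqrt_f[OF elim] u[OF elim]]) auto
    have "square_integrable M (\<lambda>x. (sqrt (f t x) - 1) * h x)"
      by (rule square_integrable_bounded_mult[OF _ sqrt_f_diff[OF elim] h]) simp
    from square_integrable_mult[OF this \<psi>]
    have i2: "integrable M (\<lambda>x. (sqrt (f t x) - 1) * (h x * \<psi> x))"
      by (simp add: mult.assoc)
    have "(\<integral>x. (f t x - 1) * \<psi> x \<partial>M) / t = (\<integral>x. (f t x - 1) / t * \<psi> x \<partial>M)"
      by simp
    also have "\<dots> = (\<integral>x. (sqrt (f t x) + 1) * u t x * \<psi> x + (sqrt (f t x) - 1) * (h x * \<psi> x) / 2 + h x * \<psi> x \<partial>M)"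
      by (rule Bochner_Integration.integral_cong) (simp_all add: f_diff[OF elim] field_simps)
    also have "\<dots> = (\<integral>x. (sqrt (f t x) + 1) * u t x * \<psi> x \<partial>M) +
      (\<integral>x. (sqrt (f t x) - 1) * (h x * \<psi> x) \<partial>M) / 2 + (\<integral>x. h x * \<psi> x \<partial>M)"
      using i1 i2 h\<psi> by simp
    finally show ?case by simp
  qed
  ultimately show ?thesis
    by (subst (asm) tendsto_cong) auto
qed

end

text \<open>A density between two positive constants does not change which functions are integrable,
  so moment conditions move freely between the base measure and the tilted one.\<close>

lemma
  assumes f [measurable]: "f \<in> borel_measurable M" and K: "0 < K"
    and bounds: "\<And>x. x \<in> space M \<Longrightarrow> 1 / K \<le> f x \<and> f x \<le> K"
    and g [measurable]: "g \<in> borel_measurable M"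
  shows integrable_bounded_density: "integrable (density M (\<lambda>x. ennreal (f x))) g \<longleftrightarrow> integrable M g"
    and integral_bounded_density: "integral\<^sup>L (density M (\<lambda>x. ennreal (f x))) g = (\<integral>x. f x * g x \<partial>M)"
proof -
  have pos: "0 < f x" if "x \<in> space M" for x
    using bounds[OF that] K by (auto intro: less_le_trans[of _ "1 / K"])
  have AE_pos: "AE x in M. 0 \<le> f x"
    using pos by (auto intro!: AE_I2 less_imp_le)
  have "integrable M (\<lambda>x. f x * g x) \<longleftrightarrow> integrable M g"
  proof
    assume "integrable M g"
    then have "integrable M (\<lambda>x. K * g x)" by simp
    then show "integrable M (\<lambda>x. f x * g x)"
    proof (rule Bochner_Integration.integrable_bound)
      have "\<bar>f x * g x\<bar> \<le> \<bar>K * g x\<bar>" if "x \<in> space M" for x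
        using bounds[OF that] pos[OF that] by (auto simp: abs_mult intro!: mult_right_mono)
      then show "AE x in M. norm (f x * g x) \<le> norm (K * g x)" by auto
    qed simp
  next
    assume "integrable M (\<lambda>x. f x * g x)"
    then have "integrable M (\<lambda>x. K * (f x * g x))" by simp
    then show "integrable M g"
    proof (rule Bochner_Integration.integrable_bound)
      have "\<bar>g x\<bar> \<le> \<bar>K * (f x * g x)\<bar>" if x: "x \<in> space M" for x
      proof -
        have "1 \<le> K * f x"
          using bounds[OF x] K by (simp add: field_simps)
        from mult_right_mono[OF this, of "\<bar>g x\<bar>"] show ?thesis
          using K pos[OF x] by (simp add: abs_mult mult.assoc)
      qed
      then show "AE x in M. norm (g x) \<le> norm (K * (f x * g x))" by auto
    qed simp
  qed
  then show "integrable (density M (\<lambda>x. ennreal (f x))) g \<longleftrightarrow> integrable M g"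
    by (subst integrable_density) (use AE_pos in auto)
  show "integral\<^sup>L (density M (\<lambda>x. ennreal (f x))) g = (\<integral>x. f x * g x \<partial>M)"
    by (subst integral_density) (use AE_pos in auto)
qed

end

section \<open>Pathwise derivative\<close>

context cohort
begin

abbreviation "qa x \<equiv> q x \<and> a x"

text \<open>The tilted measure need not be balanced, so \<open>cohort\<close> is not instantiated
  for it. The regression facts are obtained under the tilt and transported to \<open>P\<close>, and
  only there does balance extend them from annotated units to the cohort.\<close>

lemma
  assumes f [measurable]: "f \<in> borel_measurable P" and K: "0 < K"
    and bounds: "\<And>x. x \<in> space P \<Longrightarrow> 1 / K \<le> f x \<and> f x \<le> K"
    and Q: "prob_space (density P (\<lambda>x. ennreal (f x)))"
    and m: "is_regression (density P (\<lambda>x. ennreal (f x))) (\<lambda>x. qa x) V Y m"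
  shows square_integrable_tilted_regression_qa: "square_integrable P (\<lambda>x. of_bool (qa x) * m (V x))"
    and square_integrable_tilted_regression: "square_integrable P (\<lambda>x. of_bool (q x) * m (V x))"
    and tilted_regression_orthogonal: "g \<in> borel_measurable borel \<Longrightarrow>
      square_integrable P (\<lambda>x. of_bool (qa x) * g (V x)) \<Longrightarrow>
      (\<integral>x. f x * (of_bool (qa x) * ((Y x - m (V x)) * g (V x))) \<partial>P) = 0"
proof -
  define Q where "Q = density P (\<lambda>x. ennreal (f x))"
  interpret Q: prob_space Q
    unfolding Q_def by (rule assms(4))
  have [measurable_cong]: "sets Q = sets P" by (simp add: Q_def)
  have int: "integrable Q g \<longleftrightarrow> integrable P g" "integral\<^sup>L Q g = (\<integral>x. f x * g x \<partial>P)"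
    if "g \<in> borel_measurable P" for g :: "'a \<Rightarrow> real"
    unfolding Q_def using integrable_bounded_density[OF f K bounds that]
      integral_bounded_density[OF f K bounds that] by auto
  have sq: "square_integrable Q g \<longleftrightarrow> square_integrable P g"
    if [measurable]: "g \<in> borel_measurable P" for g :: "'a \<Rightarrow> real"
    by (simp add: square_integrable_def int measurable_cong_sets[OF \<open>sets Q = sets P\<close> refl])
  have m_meas [measurable]: "m \<in> borel_measurable borel"
    using m by (simp add: is_regression_def)
  have meas: "Measurable.pred Q (\<lambda>x. qa x)" "V \<in> borel_measurable Q" "Y \<in> borel_measurable Q"
    by measurable
  \<comment> \<open>The lower bound 1 / K on the density gives Q(q, a) \<ge> P(q, a) / K.\<close>
  have pos: "\<P>(x in Q. qa x) > 0"
  proof -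
    have 1: "\<P>(x in N. qa x) = (\<integral>x. of_bool (qa x) \<partial>N)" if "prob_space N" "Measurable.pred N (\<lambda>x. qa x)" for N
    proof -
      interpret N: prob_space N by fact
      note [measurable] = that(2)
      show ?thesis
        by (subst Bochner_Integration.integral_cong[OF refl, where g="indicator {x\<in>space N. qa x}"])
           (auto split: split_indicator)
    qed
    have f_abs: "\<bar>f x\<bar> \<le> K" if "x \<in> space P" for x
    proof -
      have "0 \<le> f x" using bounds[OF that] K by (auto intro: order_trans[of 0 "1 / K"])
      then show ?thesis using bounds[OF that] by simp
    qed
    have "(1 / K) * \<P>(x in P. qa x) = (\<integral>x. (1 / K) * of_bool (qa x) \<partial>P)"
      using 1[OF prob_space_axioms] by simp
    also have "\<dots> \<le> (\<integral>x. f x * of_bool (qa x) \<partial>P)"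
    proof (rule integral_mono)
      show "integrable P (\<lambda>x. f x * of_bool (qa x))"
        by (rule integrable_const_bound[where B=K])
          (use bounds f_abs K in auto)
      show "integrable P (\<lambda>x. (1 / K) * of_bool (qa x))"
        by (rule integrable_const_bound[where B="1/K"]) (use K in auto)
    qed (use bounds in \<open>auto intro!: mult_right_mono\<close>)
    also have "\<dots> = \<P>(x in Q. qa x)"
      using 1[OF Q.prob_space_axioms meas(1)] by (simp add: int)
    finally show ?thesis
      using K qa_pos by (auto simp: divide_simps split: if_splits intro: less_le_trans[of 0 "\<P>(x in P. qa x) / K"])
  qed
  have Y2': "integrable Q (\<lambda>x. of_bool (qa x) * (Y x)\<^sup>2)"
    using Y2 by (subst int) auto
  note m' = m[folded Q_def]
  show 1: "square_integrable P (\<lambda>x. of_bool (qa x) * m (V x))"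
    using Q.square_integrable_regression[OF meas pos Y2' m'] by (subst (asm) sq) auto
  show "square_integrable P (\<lambda>x. of_bool (q x) * m (V x))"
    by (rule square_integrable_cohort(1)[OF m_meas 1])
  show "(\<integral>x. f x * (of_bool (qa x) * ((Y x - m (V x)) * g (V x))) \<partial>P) = 0"
    if g [measurable]: "g \<in> borel_measurable borel" and "square_integrable P (\<lambda>x. of_bool (qa x) * g (V x))"
  proof -
    have "(\<integral>x. of_bool (qa x) * ((Y x - m (V x)) * g (V x)) \<partial>Q) = 0"
      by (rule Q.regression_orthogonal[OF meas pos Y2' m' g]) (use that in \<open>auto simp: sq\<close>)
    then show ?thesis by (subst (asm) int) auto
  qed
qed

text \<open>\<open>P\<close> is its own tilt, with density 1 and K = 1.\<close>

lemma
  assumes m: "is_regression P (\<lambda>x. qa x) V Y m"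
  shows square_integrable_regression_qa: "square_integrable P (\<lambda>x. of_bool (qa x) * m (V x))"
    and square_integrable_regression_q: "square_integrable P (\<lambda>x. of_bool (q x) * m (V x))"
    and regression_orthogonal_qa: "g \<in> borel_measurable borel \<Longrightarrow>
      square_integrable P (\<lambda>x. of_bool (qa x) * g (V x)) \<Longrightarrow>
      (\<integral>x. of_bool (qa x) * ((Y x - m (V x)) * g (V x)) \<partial>P) = 0"
  using square_integrable_tilted_regression_qa[of "\<lambda>_. 1" 1 m] square_integrable_tilted_regression[of "\<lambda>_. 1" 1 m]
    tilted_regression_orthogonal[of "\<lambda>_. 1" 1 m g] m prob_space_axioms
  by (simp_all add: density_1)

text \<open>The estimating function without its constants: division by the cohort probability and
  centring are deferred, as both are harmless for derivatives and closures.\<close>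

definition "score_part m x = of_bool (q x) * (m (V x) + of_bool (a x) / r (V x) * (Y x - m (V x)))"

lemma square_integrable_qaY: "square_integrable P (\<lambda>x. of_bool (qa x) * Y x)"
  using Y2 by (auto simp: square_integrable_def power_mult_distrib of_bool_def if_distrib[where f="\<lambda>x. x\<^sup>2"] cong: if_cong)

lemma score_part_measurable [measurable]:
  assumes [measurable]: "m \<in> borel_measurable borel"
  shows "score_part m \<in> borel_measurable P"
  unfolding score_part_def[abs_def] by measurable

lemma square_integrable_residual:
  assumes [measurable]: "m \<in> borel_measurable borel"
    and m: "square_integrable P (\<lambda>x. of_bool (qa x) * m (V x))"
  shows "square_integrable P (\<lambda>x. of_bool (qa x) * (Y x - m (V x)))"
    "square_integrable P (\<lambda>x. of_bool (qa x) / r (V x) * (Y x - m (V x)))"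
proof -
  show 1: "square_integrable P (\<lambda>x. of_bool (qa x) * (Y x - m (V x)))"
    using square_integrable_diff[OF square_integrable_qaY m] by (simp add: algebra_simps)
  have "square_integrable P (\<lambda>x. 1 / r (V x) * (of_bool (qa x) * (Y x - m (V x))))"
    by (rule square_integrable_bounded_mult[OF _ inverse_r(1) 1]) auto
  then show "square_integrable P (\<lambda>x. of_bool (qa x) / r (V x) * (Y x - m (V x)))"
    by (rule back_subst[where P="square_integrable P"]) auto
qed

lemma square_integrable_score_part:
  assumes [measurable]: "m \<in> borel_measurable borel"
    and m: "square_integrable P (\<lambda>x. of_bool (qa x) * m (V x))"
  shows "square_integrable P (score_part m)"
proof -
  have "square_integrable P (\<lambda>x. of_bool (q x) * m (V x) + of_bool (qa x) / r (V x) * (Y x - m (V x)))"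
    by (intro square_integrable_add square_integrable_cohort(1)[OF _ m] square_integrable_residual[OF _ m]) auto
  then show ?thesis
    by (rule back_subst[where P="square_integrable P"]) (auto simp: score_part_def fun_eq_iff)
qed

lemma square_integrable_qa_div_r:
  "square_integrable P (\<lambda>x. of_bool (qa x) * (1 / r (V x)))"
  by (rule square_integrable_bounded[where c="1 / \<eta>"]) (use inverse_r \<eta> in auto)

text \<open>The augmentation term is the regression residual tested against 1 / r(V), a function of
  V, so it has mean 0.\<close>

lemma integral_score_part:
  assumes m: "is_regression P (\<lambda>x. qa x) V Y m"
  shows "(\<integral>x. score_part m x \<partial>P) = (\<integral>x. of_bool (q x) * m (V x) \<partial>P)"
proof -
  have [measurable]: "m \<in> borel_measurable borel"
    using m by (simp add: is_regression_def)
  note sq = square_integrable_regression_qa[OF m]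
  have "(\<integral>x. score_part m x \<partial>P) = (\<integral>x. of_bool (q x) * m (V x) + of_bool (qa x) * ((Y x - m (V x)) * (1 / r (V x))) \<partial>P)"
    by (rule Bochner_Integration.integral_cong) (auto simp: score_part_def)
  also have "\<dots> = (\<integral>x. of_bool (q x) * m (V x) \<partial>P) + (\<integral>x. of_bool (qa x) * ((Y x - m (V x)) * (1 / r (V x))) \<partial>P)"
  proof (rule Bochner_Integration.integral_add)
    show "integrable P (\<lambda>x. of_bool (q x) * m (V x))"
      by (intro square_integrable_imp_integrable' square_integrable_regression_q[OF m])
    have "integrable P (\<lambda>x. of_bool (qa x) / r (V x) * (Y x - m (V x)))"
      by (intro square_integrable_imp_integrable' square_integrable_residual(2)[OF _ sq]) simp
    then show "integrable P (\<lambda>x. of_bool (qa x) * ((Y x - m (V x)) * (1 / r (V x))))"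
      by (rule back_subst[where P="integrable P"]) auto
  qed
  also have "(\<integral>x. of_bool (qa x) * ((Y x - m (V x)) * (1 / r (V x))) \<partial>P) = 0"
    by (rule regression_orthogonal_qa[OF m]) (use square_integrable_qa_div_r in auto)
  finally show ?thesis by simp
qed

text \<open>Write d = m' - m and e = Y - m on annotated units of the cohort. Orthogonality under
  both measures turns E[f d^2] into E[(f - 1) e d]. With f \<ge> 1 / K and Cauchy-Schwarz this gives
  A^2 \<le> K^2 B A, and A cancels.\<close>

lemma tilted_regression_dist:
  assumes f [measurable]: "f \<in> borel_measurable P" and K: "0 < K"
    and bounds: "\<And>x. x \<in> space P \<Longrightarrow> 1 / K \<le> f x \<and> f x \<le> K"
    and Q: "prob_space (density P (\<lambda>x. ennreal (f x)))"
    and m: "is_regression P (\<lambda>x. qa x) V Y m"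
    and m': "is_regression (density P (\<lambda>x. ennreal (f x))) (\<lambda>x. qa x) V Y m'"
  shows "(\<integral>x. (of_bool (qa x) * (m' (V x) - m (V x)))\<^sup>2 \<partial>P) \<le>
    K\<^sup>2 * (\<integral>x. (f x - 1)\<^sup>2 * (of_bool (qa x) * (Y x - m (V x)))\<^sup>2 \<partial>P)"
proof -
  have [measurable]: "m \<in> borel_measurable borel" "m' \<in> borel_measurable borel"
    using m m' by (auto simp: is_regression_def)
  let ?d = "\<lambda>x. of_bool (qa x) * (m' (V x) - m (V x))"
  let ?e = "\<lambda>x. of_bool (qa x) * (Y x - m (V x))"
  define A where "A = (\<integral>x. (?d x)\<^sup>2 \<partial>P)"
  define B where "B = (\<integral>x. (f x - 1)\<^sup>2 * (?e x)\<^sup>2 \<partial>P)"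
  have f_le: "\<bar>f x\<bar> \<le> K" "\<bar>f x - 1\<bar> \<le> K + 1" if "x \<in> space P" for x
  proof -
    have "0 \<le> f x" using bounds[OF that] K by (auto intro: order_trans[of 0 "1 / K"])
    then show "\<bar>f x\<bar> \<le> K" "\<bar>f x - 1\<bar> \<le> K + 1" using bounds[OF that] by (auto simp: abs_le_iff)
  qed
  have d: "square_integrable P ?d"
    using square_integrable_diff[OF square_integrable_tilted_regression_qa[OF f K bounds Q m'] square_integrable_regression_qa[OF m]]
    by (simp add: algebra_simps)
  have e: "square_integrable P ?e"
    by (rule square_integrable_residual(1)[OF _ square_integrable_regression_qa[OF m]]) simp
  have fe: "square_integrable P (\<lambda>x. (f x - 1) * ?e x)"
    by (rule square_integrable_bounded_mult[OF _ f_le(2) e]) auto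
  have fd: "square_integrable P (\<lambda>x. f x * ?d x)"
    by (rule square_integrable_bounded_mult[OF _ f_le(1) d]) auto
  have fe': "square_integrable P (\<lambda>x. f x * ?e x)"
    by (rule square_integrable_bounded_mult[OF _ f_le(1) e]) auto
  have AB: "0 \<le> A" "0 \<le> B" by (simp_all add: A_def B_def)
  have "A \<le> K * (\<integral>x. f x * ?d x * ?d x \<partial>P)"
  proof -
    have "A \<le> (\<integral>x. K * (f x * ?d x * ?d x) \<partial>P)"
      unfolding A_def
    proof (rule integral_mono)
      fix x assume x: "x \<in> space P"
      have "1 \<le> K * f x"
        using bounds[OF x] K by (simp add: field_simps)
      from mult_right_mono[OF this, of "(?d x)\<^sup>2"]
      show "(?d x)\<^sup>2 \<le> K * (f x * ?d x * ?d x)" by (simp add: power2_eq_square mult.assoc)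
    qed (use d square_integrable_mult[OF fd d] in \<open>auto simp: square_integrable_def\<close>)
    then show ?thesis by simp
  qed
  \<comment> \<open>e - d = Y - m' is orthogonal to functions of V under the tilted measure, that
    is, with weight f.\<close>
  also have "(\<integral>x. f x * ?d x * ?d x \<partial>P) = (\<integral>x. f x * ?e x * ?d x \<partial>P)"
  proof -
    have "(\<integral>x. f x * ?e x * ?d x \<partial>P) - (\<integral>x. f x * ?d x * ?d x \<partial>P) =
        (\<integral>x. f x * ?e x * ?d x - f x * ?d x * ?d x \<partial>P)"
      by (rule Bochner_Integration.integral_diff[symmetric] square_integrable_mult fd fe' d)+
    also have "\<dots> = (\<integral>x. f x * (of_bool (qa x) * ((Y x - m' (V x)) * (m' (V x) - m (V x)))) \<partial>P)"
      by (rule Bochner_Integration.integral_cong) (auto simp: algebra_simps)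
    also have "\<dots> = 0"
      by (rule tilted_regression_orthogonal[OF f K bounds Q m', of "\<lambda>v. m' v - m v"]) (use d in auto)
    finally show ?thesis by simp
  qed
  \<comment> \<open>e is orthogonal to functions of V under \<open>P\<close>, so weight 1 may be
    subtracted from f; this produces the small factor f - 1.\<close>
  also have "\<dots> = (\<integral>x. (f x - 1) * ?e x * ?d x \<partial>P)"
  proof -
    have "(\<integral>x. f x * ?e x * ?d x \<partial>P) - (\<integral>x. (f x - 1) * ?e x * ?d x \<partial>P) =
        (\<integral>x. f x * ?e x * ?d x - (f x - 1) * ?e x * ?d x \<partial>P)"
      by (rule Bochner_Integration.integral_diff[symmetric] square_integrable_mult fe fe' d)+
    also have "\<dots> = (\<integral>x. of_bool (qa x) * ((Y x - m (V x)) * (m' (V x) - m (V x))) \<partial>P)"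
      by (rule Bochner_Integration.integral_cong) (auto simp: algebra_simps)
    also have "\<dots> = 0"
      by (rule regression_orthogonal_qa[OF m, of "\<lambda>v. m' v - m v"]) (use d in auto)
    finally show ?thesis by simp
  qed
  finally have "A\<^sup>2 \<le> (K * (\<integral>x. (f x - 1) * ?e x * ?d x \<partial>P))\<^sup>2"
    using AB by (intro power_mono)
  also have "\<dots> \<le> K\<^sup>2 * (B * A)"
    using Cauchy_Schwarz_integral[OF fe d] unfolding power_mult_distrib A_def B_def
    by (intro mult_left_mono) auto
  finally have "A * A \<le> (K\<^sup>2 * B) * A" by (simp add: power2_eq_square algebra_simps)
  then have "A \<le> K\<^sup>2 * B"
    using AB by (cases "A = 0") (auto simp: mult_le_cancel_right)
  then show ?thesis by (simp add: A_def B_def)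
qed

text \<open>
  Adding the vanishing augmentation term under \<open>Q t\<close> gives
  \<open>E\<^sub>Q[q m'] - E\<^sub>P[q m] = E\<^sub>P[(f - 1) \<psi>] + E\<^sub>P[(f - 1) q (1 - a / r) (m' - m)]\<close> with
  \<open>\<psi> = score_part m\<close>; by \<open>balanced\<close> the factor \<open>f\<close> in the last term may be replaced by \<open>f - 1\<close>,
  which makes it of second order.
\<close>

lemma pathwise_derivative:
  assumes \<epsilon>: "0 < \<epsilon>" and K: "0 < K"
    and f: "\<And>t. t \<in> {0<..<\<epsilon>} \<Longrightarrow> f t \<in> borel_measurable P"
    and bounds: "\<And>t x. t \<in> {0<..<\<epsilon>} \<Longrightarrow> x \<in> space P \<Longrightarrow> 1 / K \<le> f t x \<and> f t x \<le> K"
    and h: "square_integrable P h"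
    and dqm: "((\<lambda>t. \<integral>x. ((sqrt (f t x) - 1) / t - h x / 2)\<^sup>2 \<partial>P) \<longlongrightarrow> 0) (at_right 0)"
    and Q: "\<And>t. t \<in> {0<..<\<epsilon>} \<Longrightarrow> Q t = density P (\<lambda>x. ennreal (f t x))"
    and prob_Q: "\<And>t. t \<in> {0<..<\<epsilon>} \<Longrightarrow> prob_space (Q t)"
    and m: "is_regression P (\<lambda>x. qa x) V Y m"
    and m': "\<And>t. t \<in> {0<..<\<epsilon>} \<Longrightarrow> is_regression (Q t) (\<lambda>x. qa x) V Y (m' t)"
  shows "((\<lambda>t. ((\<integral>x. of_bool (q x) * m' t (V x) \<partial>Q t) - (\<integral>x. of_bool (q x) * m (V x) \<partial>P)) / t)
    \<longlongrightarrow> (\<integral>x. h x * score_part m x \<partial>P)) (at_right 0)"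
    and "(\<integral>x. h x \<partial>P) = 0"
proof -
  have [measurable]: "m \<in> borel_measurable borel"
    using m by (simp add: is_regression_def)
  have [measurable]: "m' t \<in> borel_measurable borel" if "t \<in> {0<..<\<epsilon>}" for t
    using m'[OF that] by (simp add: is_regression_def)
  have ev: "\<forall>\<^sub>F t in at_right 0. t \<in> {0<..<\<epsilon>}"
    using eventually_at_right_real[OF \<epsilon>] .
  note reg = \<epsilon> K f bounds h dqm
  have f_diff_le: "\<bar>f t x - 1\<bar> \<le> K + 1" if "t \<in> {0<..<\<epsilon>}" "x \<in> space P" for t x
  proof -
    have "0 \<le> f t x" using bounds[OF that] K by (auto intro: order_trans[of 0 "1 / K"])
    then show ?thesis using bounds[OF that] by (auto simp: abs_le_iff)
  qed
  have diff0: "((\<lambda>t. \<integral>x. (f t x - 1)\<^sup>2 \<partial>P) \<longlongrightarrow> 0) (at_right 0)"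
    by (rule density_diff_tendsto_0[OF reg])
  let ?e = "\<lambda>x. of_bool (qa x) * (Y x - m (V x))"
  have e: "square_integrable P ?e"
    by (rule square_integrable_residual(1)[OF _ square_integrable_regression_qa[OF m]]) simp
  \<comment> \<open>\<open>B t\<close> bounds, up to K^2, the squared distance of the perturbed
    regression from \<open>m\<close>. Its weight e^2 is only integrable, whereas (f - 1)^2 is
    bounded and tends to 0 in L^2.\<close>
  define B where "B t = (\<integral>x. (f t x - 1)\<^sup>2 * (?e x)\<^sup>2 \<partial>P)" for t
  have B: "(B \<longlongrightarrow> 0) (at_right 0)"
    unfolding B_def
  proof (rule tendsto_integral_bounded_mult)
    show "integrable P (\<lambda>x. (?e x)\<^sup>2)" using e by (rule square_integrable_power2)
    show "\<forall>\<^sub>F t in at_right 0. (\<lambda>x. (f t x - 1)\<^sup>2) \<in> borel_measurable P \<and> (\<forall>x\<in>space P. \<bar>(f t x - 1)\<^sup>2\<bar> \<le> (K + 1)\<^sup>2)"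
      using ev
    proof eventually_elim
      case (elim t)
      have "\<bar>(f t x - 1)\<^sup>2\<bar> \<le> (K + 1)\<^sup>2" if "x \<in> space P" for x
        using power_mono[OF f_diff_le[OF elim that], of 2] by simp
      then show ?case using f[OF elim] by simp
    qed
    show "((\<lambda>t. \<integral>x. ((f t x - 1)\<^sup>2)\<^sup>2 \<partial>P) \<longlongrightarrow> 0) (at_right 0)"
    proof (rule Lim_null_comparison)
      show "((\<lambda>t. (K + 1)\<^sup>2 * (\<integral>x. (f t x - 1)\<^sup>2 \<partial>P)) \<longlongrightarrow> 0) (at_right 0)"
        by (rule tendsto_mult_right_zero[OF diff0])
      show "\<forall>\<^sub>F t in at_right 0. norm (\<integral>x. ((f t x - 1)\<^sup>2)\<^sup>2 \<partial>P) \<le> (K + 1)\<^sup>2 * (\<integral>x. (f t x - 1)\<^sup>2 \<partial>P)"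
        using ev
      proof eventually_elim
        case (elim t)
        note [measurable] = f[OF elim]
        have "(\<integral>x. ((f t x - 1)\<^sup>2)\<^sup>2 \<partial>P) \<le> (\<integral>x. (K + 1)\<^sup>2 * (f t x - 1)\<^sup>2 \<partial>P)"
        proof (rule integral_mono_AE')
          have "((f t x - 1)\<^sup>2)\<^sup>2 \<le> (K + 1)\<^sup>2 * (f t x - 1)\<^sup>2" if "x \<in> space P" for x
            using mult_right_mono[OF power_mono[OF f_diff_le[OF elim that], of 2], of "(f t x - 1)\<^sup>2"]
            by (simp add: power2_eq_square)
          then show "AE x in P. ((f t x - 1)\<^sup>2)\<^sup>2 \<le> (K + 1)\<^sup>2 * (f t x - 1)\<^sup>2" by auto
        qed (use square_integrable_bounded[OF _ f_diff_le[OF elim]] in \<open>auto simp: square_integrable_def\<close>)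
        then show ?case by simp
      qed
    qed
  qed (use K in auto)

  define g where "g t v = m' t v - m v" for t v
  define R where "R t = (\<integral>x. (f t x - 1) * (of_bool (q x) * ((1 - of_bool (a x) / r (V x)) * g t (V x))) \<partial>P)" for t
  have decomposition: "(\<integral>x. of_bool (q x) * m' t (V x) \<partial>Q t) - (\<integral>x. of_bool (q x) * m (V x) \<partial>P) =
      (\<integral>x. (f t x - 1) * score_part m x \<partial>P) + R t"
    and R_le: "(R t)\<^sup>2 \<le> (\<integral>x. (f t x - 1)\<^sup>2 \<partial>P) * (K\<^sup>2 * B t / \<eta> / \<eta>\<^sup>2)"
    if t: "t \<in> {0<..<\<epsilon>}" for t
  proof -
    note [measurable] = f[OF t]
    note Qt = prob_Q[OF t, unfolded Q[OF t]]
    note m't = m'[OF t, unfolded Q[OF t]]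
    have [measurable]: "m' t \<in> borel_measurable borel" using m't by (simp add: is_regression_def)
    have [measurable]: "g t \<in> borel_measurable borel" unfolding g_def by measurable
    note tilt = f[OF t] K bounds[OF t] Qt
    have sq_qa: "square_integrable P (\<lambda>x. of_bool (qa x) * m' t (V x))"
      by (rule square_integrable_tilted_regression_qa[OF tilt m't])
    have sq_q: "square_integrable P (\<lambda>x. of_bool (q x) * m' t (V x))"
      by (rule square_integrable_tilted_regression[OF tilt m't])
    have g_q: "square_integrable P (\<lambda>x. of_bool (q x) * g t (V x))"
      using square_integrable_diff[OF sq_q square_integrable_regression_q[OF m]]
      by (simp add: g_def algebra_simps)
    have g_qa: "square_integrable P (\<lambda>x. of_bool (qa x) * g t (V x))"
      using square_integrable_diff[OF sq_qa square_integrable_regression_qa[OF m]]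
      by (simp add: g_def algebra_simps)
    note rem = balanced_remainder[OF _ g_q]
    let ?rem = "\<lambda>x. of_bool (q x) * ((1 - of_bool (a x) / r (V x)) * g t (V x))"
    have f1: "square_integrable P (\<lambda>x. f t x - 1)"
      by (rule square_integrable_bounded[OF _ f_diff_le[OF t]]) auto
    have f2: "square_integrable P (\<lambda>x. f t x)"
      using square_integrable_add[OF f1 square_integrable_bounded[of "\<lambda>_. 1" 1]] by simp
    have \<psi>: "square_integrable P (score_part m)"
      by (rule square_integrable_score_part[OF _ square_integrable_regression_qa[OF m]]) auto
    have "(R t)\<^sup>2 \<le> (\<integral>x. (f t x - 1)\<^sup>2 \<partial>P) * (\<integral>x. (?rem x)\<^sup>2 \<partial>P)"
      unfolding R_def by (rule Cauchy_Schwarz_integral[OF f1 rem(2)]) simp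
    also have "\<dots> \<le> (\<integral>x. (f t x - 1)\<^sup>2 \<partial>P) * ((\<integral>x. (of_bool (q x) * g t (V x))\<^sup>2 \<partial>P) / \<eta>\<^sup>2)"
      by (intro mult_left_mono rem(3)) auto
    \<comment> \<open>K^2 \<open>B t\<close> is the distance on annotated units, one division by
      \<eta> extends it to the cohort, and \<eta>^2 comes from the weight 1 - a / r.\<close>
    also have "\<dots> \<le> (\<integral>x. (f t x - 1)\<^sup>2 \<partial>P) * (K\<^sup>2 * B t / \<eta> / \<eta>\<^sup>2)"
    proof (intro mult_left_mono divide_right_mono)
      have "(\<integral>x. (of_bool (q x) * g t (V x))\<^sup>2 \<partial>P) \<le> (\<integral>x. (of_bool (qa x) * g t (V x))\<^sup>2 \<partial>P) / \<eta>"
        by (rule square_integrable_cohort(2)[OF _ g_qa]) simp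
      also have "\<dots> \<le> K\<^sup>2 * B t / \<eta>"
        using tilted_regression_dist[OF tilt m m't] \<eta> unfolding B_def g_def
        by (intro divide_right_mono) auto
      finally show "(\<integral>x. (of_bool (q x) * g t (V x))\<^sup>2 \<partial>P) \<le> K\<^sup>2 * B t / \<eta>" .
    qed auto
    finally show "(R t)\<^sup>2 \<le> (\<integral>x. (f t x - 1)\<^sup>2 \<partial>P) * (K\<^sup>2 * B t / \<eta> / \<eta>\<^sup>2)" .

    have "(\<integral>x. of_bool (q x) * m' t (V x) \<partial>Q t) = (\<integral>x. f t x * (of_bool (q x) * m' t (V x)) \<partial>P)"
      unfolding Q[OF t] by (rule integral_bounded_density[OF f[OF t] K bounds[OF t]]) auto
    also have "\<dots> = (\<integral>x. f t x * (of_bool (q x) * m' t (V x)) \<partial>P) +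
        (\<integral>x. f t x * (of_bool (qa x) * ((Y x - m' t (V x)) * (1 / r (V x)))) \<partial>P)"
      using tilted_regression_orthogonal[OF tilt m't _ square_integrable_qa_div_r] by simp
    also have "\<dots> = (\<integral>x. f t x * (of_bool (q x) * m' t (V x)) +
        f t x * (of_bool (qa x) * ((Y x - m' t (V x)) * (1 / r (V x)))) \<partial>P)"
    proof (rule Bochner_Integration.integral_add[symmetric])
      show "integrable P (\<lambda>x. f t x * (of_bool (q x) * m' t (V x)))"
        by (rule square_integrable_mult[OF f2 sq_q])
      have "integrable P (\<lambda>x. f t x * (of_bool (qa x) / r (V x) * (Y x - m' t (V x))))"
        by (rule square_integrable_mult[OF f2 square_integrable_residual(2)[OF _ sq_qa]]) simp
      then show "integrable P (\<lambda>x. f t x * (of_bool (qa x) * ((Y x - m' t (V x)) * (1 / r (V x)))))"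
        by (rule back_subst[where P="integrable P"]) auto
    qed
    \<comment> \<open>The augmented integrand at m' is the one at \<open>m\<close> plus the
      remainder q (1 - a / r) (m' - m); each of the two is then split by f = 1 + (f - 1).\<close>
    also have "\<dots> = (\<integral>x. score_part m x + (f t x - 1) * score_part m x + (?rem x + (f t x - 1) * ?rem x) \<partial>P)"
      using r_pos by (intro Bochner_Integration.integral_cong) (auto simp: score_part_def g_def field_simps)
    also have "\<dots> = (\<integral>x. score_part m x \<partial>P) + (\<integral>x. (f t x - 1) * score_part m x \<partial>P) + ((\<integral>x. ?rem x \<partial>P) + R t)"
      unfolding R_def
      using square_integrable_imp_integrable'[OF \<psi>] square_integrable_mult[OF f1 \<psi>]
        square_integrable_imp_integrable'[OF rem(2)] square_integrable_mult[OF f1 rem(2)]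
      by simp
    also have "(\<integral>x. ?rem x \<partial>P) = 0"
      by (rule rem(1)) simp
    also have "(\<integral>x. score_part m x \<partial>P) = (\<integral>x. of_bool (q x) * m (V x) \<partial>P)"
      by (rule integral_score_part[OF m])
    finally show "(\<integral>x. of_bool (q x) * m' t (V x) \<partial>Q t) - (\<integral>x. of_bool (q x) * m (V x) \<partial>P) =
        (\<integral>x. (f t x - 1) * score_part m x \<partial>P) + R t"
      by simp
  qed
  have \<psi>: "square_integrable P (score_part m)"
    by (rule square_integrable_score_part[OF _ square_integrable_regression_qa[OF m]]) auto
  \<comment> \<open>In the bound for R, dividing the first factor by t^2 leaves it bounded, while
    \<open>B t\<close> tends to 0.\<close>
  have "((\<lambda>t. R t / t) \<longlongrightarrow> 0) (at_right 0)"
  proof -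
    obtain C where C: "\<forall>\<^sub>F t in at_right 0. (\<integral>x. ((f t x - 1) / t)\<^sup>2 \<partial>P) \<le> C"
      using density_diff_quotient_bounded[OF reg] by blast
    have B0: "0 \<le> B t" for t by (simp add: B_def)
    show ?thesis
    proof (rule Lim_null_comparison)
      show "((\<lambda>t. sqrt (C * (K\<^sup>2 * B t / \<eta> / \<eta>\<^sup>2))) \<longlongrightarrow> 0) (at_right 0)"
        using B \<eta> by (auto intro!: tendsto_eq_intros)
      show "\<forall>\<^sub>F t in at_right 0. norm (R t / t) \<le> sqrt (C * (K\<^sup>2 * B t / \<eta> / \<eta>\<^sup>2))"
        using ev C
      proof eventually_elim
        case (elim t)
        then have "(R t / t)\<^sup>2 \<le> (\<integral>x. ((f t x - 1) / t)\<^sup>2 \<partial>P) * (K\<^sup>2 * B t / \<eta> / \<eta>\<^sup>2)"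
          using divide_right_mono[OF R_le[of t], of "t\<^sup>2"] by (simp add: power_divide ac_simps)
        also have "\<dots> \<le> C * (K\<^sup>2 * B t / \<eta> / \<eta>\<^sup>2)"
          using elim B0 \<eta> by (intro mult_right_mono) auto
        finally show ?case
          using real_le_rsqrt[of "norm (R t / t)"] by (simp add: power_divide)
      qed
    qed
  qed
  from tendsto_add[OF density_derivative[OF reg \<psi>] this]
  have "((\<lambda>t. (\<integral>x. (f t x - 1) * score_part m x \<partial>P) / t + R t / t) \<longlongrightarrow> (\<integral>x. h x * score_part m x \<partial>P)) (at_right 0)"
    by simp
  then show "((\<lambda>t. ((\<integral>x. of_bool (q x) * m' t (V x) \<partial>Q t) - (\<integral>x. of_bool (q x) * m (V x) \<partial>P)) / t)
    \<longlongrightarrow> (\<integral>x. h x * score_part m x \<partial>P)) (at_right 0)"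
  proof (rule Lim_transform_eventually)
    show "\<forall>\<^sub>F t in at_right 0. (\<integral>x. (f t x - 1) * score_part m x \<partial>P) / t + R t / t =
        ((\<integral>x. of_bool (q x) * m' t (V x) \<partial>Q t) - (\<integral>x. of_bool (q x) * m (V x) \<partial>P)) / t"
      using ev by eventually_elim (simp only: decomposition add_divide_distrib)
  qed
  \<comment> \<open>Differentiating the total mass, which is constantly 1, shows that the score is
    centred.\<close>
  have "((\<lambda>t. (\<integral>x. (f t x - 1) * 1 \<partial>P) / t) \<longlongrightarrow> (\<integral>x. h x * 1 \<partial>P)) (at_right 0)"
    by (rule density_derivative[OF reg square_integrable_bounded[of "\<lambda>_. 1" 1]]) auto
  moreover have "\<forall>\<^sub>F t in at_right 0. (\<integral>x. (f t x - 1) * 1 \<partial>P) / t = 0"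
    using ev
  proof eventually_elim
    case (elim t)
    interpret Q: prob_space "Q t" by (rule prob_Q[OF elim])
    have f1: "square_integrable P (\<lambda>x. f t x - 1)"
      by (rule square_integrable_bounded[OF _ f_diff_le[OF elim]]) (use f[OF elim] in auto)
    have "(\<integral>x. 1 \<partial>Q t) = (\<integral>x. f t x * 1 \<partial>P)"
      unfolding Q[OF elim] by (rule integral_bounded_density[OF f[OF elim] K bounds[OF elim]]) auto
    also have "\<dots> = (\<integral>x. (f t x - 1) + 1 \<partial>P)" by simp
    also have "\<dots> = (\<integral>x. f t x - 1 \<partial>P) + 1"
      using square_integrable_imp_integrable'[OF f1] by (subst Bochner_Integration.integral_add) (auto simp: prob_space)
    finally show ?case by (simp add: Q.prob_space)
  qed
  ultimately have "((\<lambda>t. 0) \<longlongrightarrow> (\<integral>x. h x \<partial>P)) (at_right (0::real))"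
    by (subst (asm) tendsto_cong) auto
  then show "(\<integral>x. h x \<partial>P) = 0"
    by (simp add: tendsto_const_iff)
qed

end

section \<open>Tangent space\<close>

text \<open>Combinations of length one suffice here: the approximating scores constructed below come
  from a set that is already closed under linear combinations.\<close>

lemma tangent_spaceI:
  assumes "square_integrable P \<phi>"
    and "\<And>e. 0 < e \<Longrightarrow> \<exists>h\<in>scores \<M> P. (\<integral>w. (\<phi> w - h w)\<^sup>2 \<partial>P) < e"
  shows "\<phi> \<in> tangent_space \<M> P"
  unfolding tangent_space_def
proof (intro CollectI conjI allI impI)
  fix e :: real assume "0 < e"
  then obtain h where "h \<in> scores \<M> P" "(\<integral>w. (\<phi> w - h w)\<^sup>2 \<partial>P) < e"
    using assms(2) by blast
  then show "\<exists>(n::nat) c g. (\<forall>j<n. g j \<in> scores \<M> P) \<and> (\<integral>w. (\<phi> w - (\<Sum>j<n. c j * g j w))\<^sup>2 \<partial>P) < e"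
    by (auto intro!: exI[of _ 1] exI[of _ "\<lambda>_. 1"] exI[of _ "\<lambda>_. h"])
qed fact

text \<open>With s = sqrt (1 + u) the error is exactly -(s - 1)^2 / 2, and |s - 1| \<le> |u| because
  u = (s + 1) (s - 1) with s + 1 \<ge> 1.\<close>

lemma sqrt_taylor_bound:
  assumes "\<bar>u\<bar> \<le> 1"
  shows "\<bar>sqrt (1 + u) - 1 - u / 2\<bar> \<le> u\<^sup>2 / 2"
proof -
  define s where "s = sqrt (1 + u)"
  have s: "0 \<le> s" "u = s\<^sup>2 - 1"
    using assms by (auto simp: s_def)
  have "s - 1 - u / 2 = - ((s - 1)\<^sup>2 / 2)"
    unfolding s(2) by (simp add: power2_eq_square field_simps)
  moreover have "(s - 1)\<^sup>2 \<le> u\<^sup>2"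
  proof -
    have "u\<^sup>2 = (s + 1)\<^sup>2 * (s - 1)\<^sup>2"
      unfolding s(2) by (simp add: power2_eq_square algebra_simps)
    moreover have "1 \<le> (s + 1)\<^sup>2" using s(1) by (intro one_le_power) auto
    ultimately show ?thesis
      using mult_right_mono[of 1 "(s + 1)\<^sup>2" "(s - 1)\<^sup>2"] by simp
  qed
  ultimately show ?thesis unfolding s_def[symmetric] by simp
qed

context prob_space
begin

text \<open>The linear path with density 1 + t h has score h: boundedness of h makes the Taylor
  error of the square root uniformly of order t. The model has to contain the path only where |t h|
  \<le> 1 / 2.\<close>

lemma bounded_score:
  assumes h [measurable]: "h \<in> borel_measurable M" and c: "\<And>x. x \<in> space M \<Longrightarrow> \<bar>h x\<bar> \<le> c"
    and model: "\<And>t. \<lbrakk>\<And>x. x \<in> space M \<Longrightarrow> \<bar>t * h x\<bar> \<le> 1 / 2\<rbrakk> \<Longrightarrow>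
      density M (\<lambda>x. ennreal (1 + t * h x)) \<in> \<M>"
  shows "h \<in> scores \<M> M"
proof -
  obtain x where "x \<in> space M" using not_empty by blast
  with c have c0: "0 \<le> c" by (meson abs_ge_zero order_trans)
  \<comment> \<open>Chosen so that |t h| \<le> 1 / 2 for t below \<epsilon>, which puts the density
    between 1 / 2 and 2, hence K = 2. The summand 1 covers c = 0.\<close>
  define \<epsilon> where "\<epsilon> = 1 / (2 * (c + 1))"
  have \<epsilon>: "0 < \<epsilon>" using c0 by (simp add: \<epsilon>_def)
  have th: "\<bar>t * h x\<bar> \<le> 1 / 2" if "t \<in> {0<..<\<epsilon>}" "x \<in> space M" for t x
  proof -
    have "\<bar>t * h x\<bar> \<le> \<epsilon> * (c + 1)"
      unfolding abs_mult using that c[OF that(2)] by (intro mult_mono) auto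
    also have "\<dots> = 1 / 2" using c0 by (simp add: \<epsilon>_def field_simps)
    finally show ?thesis .
  qed
  define f where "f t x = 1 + t * h x" for t x
  have sq: "square_integrable M h"
    by (rule square_integrable_bounded[OF h c])
  have "regular_submodel \<M> M (\<lambda>t. density M (\<lambda>x. ennreal (f t x))) h"
    unfolding regular_submodel_def
  proof (intro conjI, rule sq, rule exI[of _ \<epsilon>], rule conjI, rule \<epsilon>, rule exI[of _ 2],
      rule conjI, simp, rule exI[of _ f], intro conjI ballI)
    fix t assume t: "t \<in> {0<..<\<epsilon>}"
    show "density M (\<lambda>x. ennreal (f t x)) \<in> \<M>"
      unfolding f_def by (rule model) (rule th[OF t])
    show "f t \<in> borel_measurable M" unfolding f_def[abs_def] by measurable
    show "1 / 2 \<le> f t w" "f t w \<le> 2" if "w \<in> space M" for w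
      using th[OF t that] by (auto simp: f_def abs_le_iff)
  next
    show "((\<lambda>t. \<integral>x. ((sqrt (f t x) - 1) / t - h x / 2)\<^sup>2 \<partial>M) \<longlongrightarrow> 0) (at_right 0)"
    proof (rule Lim_null_comparison)
      show "((\<lambda>t. (t * c\<^sup>2 / 2)\<^sup>2) \<longlongrightarrow> 0) (at_right 0)"
        by (auto intro!: tendsto_eq_intros)
      show "\<forall>\<^sub>F t in at_right 0. norm (\<integral>x. ((sqrt (f t x) - 1) / t - h x / 2)\<^sup>2 \<partial>M) \<le> (t * c\<^sup>2 / 2)\<^sup>2"
        using eventually_at_right_real[OF \<epsilon>]
      proof eventually_elim
        case (elim t)
        then have t: "0 < t" by simp
        have bound: "((sqrt (f t x) - 1) / t - h x / 2)\<^sup>2 \<le> (t * c\<^sup>2 / 2)\<^sup>2" if x: "x \<in> space M" for x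
        proof -
          have "(sqrt (f t x) - 1) / t - h x / 2 = (sqrt (1 + t * h x) - 1 - t * h x / 2) / t"
            using t by (simp add: f_def diff_divide_distrib)
          then have "\<bar>(sqrt (f t x) - 1) / t - h x / 2\<bar> = \<bar>sqrt (1 + t * h x) - 1 - t * h x / 2\<bar> / t"
            using t by simp
          also have "\<dots> \<le> ((t * h x)\<^sup>2 / 2) / t"
            using t sqrt_taylor_bound[of "t * h x"] th[OF elim x] by (intro divide_right_mono) auto
          also have "\<dots> = t * (h x)\<^sup>2 / 2"
            using t by (simp add: power2_eq_square)
          also have "\<dots> \<le> t * c\<^sup>2 / 2"
            using t power_mono[OF c[OF x], of 2] by simp
          finally show ?thesis
            using t by (simp add: abs_le_square_iff[symmetric])
        qed
        have "(\<integral>x. ((sqrt (f t x) - 1) / t - h x / 2)\<^sup>2 \<partial>M) \<le> (\<integral>x. (t * c\<^sup>2 / 2)\<^sup>2 \<partial>M)"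
          by (rule integral_mono_AE') (use bound in auto)
        then show ?case by (simp add: prob_space)
      qed
    qed
  qed simp
  then show ?thesis unfolding scores_def by blast
qed

end

text \<open>That \<pi> is the propensity is not built in. The locale can thus be instantiated at a
  tilted measure, or with a finer conditioning variable, where this is the claim to be
  proved.\<close>

locale known_propensity = prob_space P for P :: "'a measure" +
  fixes X :: "'a \<Rightarrow> 'x::topological_space" and a :: "'a \<Rightarrow> bool" and \<pi> :: "'x \<Rightarrow> real"
  assumes X_meas [measurable]: "X \<in> borel_measurable P"
    and a_meas [measurable]: "Measurable.pred P a"
    and \<pi>_meas [measurable]: "\<pi> \<in> borel_measurable borel"
    and \<pi>_bounds: "\<And>x. 0 \<le> \<pi> x" "\<And>x. \<pi> x \<le> 1"
begin

abbreviation "residual w \<equiv> of_bool (a w) - \<pi> (X w)"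

lemma residual_le: "\<bar>residual w\<bar> \<le> 1"
  using \<pi>_bounds[of "X w"] by auto

text \<open>Replaces a statement about conditional expectations, which change with the measure, by
  moment conditions linear in the measure.\<close>

lemma AE_propensity_iff:
  "(AE w in P. \<pi> (X w) = cond_exp_given P X borel (\<lambda>w. of_bool (a w)) w) \<longleftrightarrow>
   (\<forall>B\<in>sets borel. (\<integral>w. indicator B (X w) * residual w \<partial>P) = 0)"
proof
  interpret S: finite_measure_subalgebra P "vimage_algebra (space P) X borel" by (rule finite_measure_subalgebra_vimage[OF X_meas])
  have int: "integrable P (\<lambda>w. of_bool (a w) :: real)" "integrable P (\<lambda>w. \<pi> (X w))"
    using \<pi>_bounds by (auto intro!: integrable_const_bound[where B=1])
  have intB: "integrable P (\<lambda>w. indicator B (X w) * of_bool (a w) :: real)"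
    "integrable P (\<lambda>w. indicator B (X w) * \<pi> (X w))" if [measurable]: "B \<in> sets borel" for B
    using \<pi>_bounds by (auto intro!: integrable_const_bound[where B=1] split: split_indicator)
  {
    assume ae: "AE w in P. \<pi> (X w) = cond_exp_given P X borel (\<lambda>w. of_bool (a w)) w"
    show "\<forall>B\<in>sets borel. (\<integral>w. indicator B (X w) * residual w \<partial>P) = 0"
    proof
      fix B :: "'x set" assume [measurable]: "B \<in> sets borel"
      have "(\<lambda>w. indicator B (X w)) \<in> borel_measurable (vimage_algebra (space P) X borel)"
        by (rule measurable_compose[OF measurable_vimage_algebra1]) auto
      then have "(\<integral>w. indicator B (X w) * real_cond_exp P (vimage_algebra (space P) X borel) (\<lambda>w. of_bool (a w)) w \<partial>P) =
          (\<integral>w. indicator B (X w) * of_bool (a w) \<partial>P)"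
        by (intro S.real_cond_exp_intg(2) intB) auto
      also have "(\<integral>w. indicator B (X w) * real_cond_exp P (vimage_algebra (space P) X borel) (\<lambda>w. of_bool (a w)) w \<partial>P) =
          (\<integral>w. indicator B (X w) * \<pi> (X w) \<partial>P)"
        using ae unfolding cond_exp_given_def by (intro integral_cong_AE) auto
      finally show "(\<integral>w. indicator B (X w) * residual w \<partial>P) = 0"
        using intB[of B] by (simp add: right_diff_distrib)
    qed
  next
    assume eq: "\<forall>B\<in>sets borel. (\<integral>w. indicator B (X w) * residual w \<partial>P) = 0"
    have "AE w in P. real_cond_exp P (vimage_algebra (space P) X borel) (\<lambda>w. of_bool (a w)) w = \<pi> (X w)"
    proof (rule S.real_cond_exp_charact)
      fix A assume "A \<in> sets (vimage_algebra (space P) X borel)"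
      then obtain B where [measurable]: "B \<in> sets borel" and A: "A = X -` B \<inter> space P"
        by (auto simp: sets_vimage_algebra2)
      have *: "(\<integral>x\<in>A. g x \<partial>P) = (\<integral>w. indicator B (X w) * g w \<partial>P)" for g :: "'a \<Rightarrow> real"
        unfolding set_lebesgue_integral_def A
        by (rule Bochner_Integration.integral_cong) (auto split: split_indicator)
      show "(\<integral>x\<in>A. of_bool (a x) \<partial>P) = (\<integral>x\<in>A. \<pi> (X x) \<partial>P)"
        unfolding * using eq[rule_format, of B] intB[of B] by (simp add: right_diff_distrib)
    next
      show "(\<lambda>w. \<pi> (X w)) \<in> borel_measurable (vimage_algebra (space P) X borel)"
        by (rule measurable_compose[OF measurable_vimage_algebra1]) auto
    qed (use int in auto)
    then show "AE w in P. \<pi> (X w) = cond_exp_given P X borel (\<lambda>w. of_bool (a w)) w"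
      unfolding cond_exp_given_def by auto
  }
qed

text \<open>The bounded elements of the tangent space, up to their mean.\<close>

definition "bounded_scores = {h \<in> borel_measurable P. (\<exists>c. \<forall>w\<in>space P. \<bar>h w\<bar> \<le> c) \<and>
    (\<forall>B\<in>sets borel. (\<integral>w. indicator B (X w) * residual w * h w \<partial>P) = 0)}"

lemma bounded_scores_integrable:
  assumes "h \<in> bounded_scores" and [measurable]: "B \<in> sets borel"
  shows "integrable P (\<lambda>w. indicator B (X w) * residual w * h w)"
proof -
  obtain c where [measurable]: "h \<in> borel_measurable P" and c: "\<And>w. w \<in> space P \<Longrightarrow> \<bar>h w\<bar> \<le> c"
    using assms by (auto simp: bounded_scores_def)
  have "\<bar>indicator B (X w) * residual w * h w\<bar> \<le> c" if "w \<in> space P" for w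
  proof -
    have "\<bar>indicator B (X w) * residual w * h w\<bar> \<le> 1 * c"
      unfolding abs_mult using c[OF that] residual_le[of w]
      by (intro mult_mono) (auto split: split_indicator)
    then show ?thesis by simp
  qed
  then show ?thesis
    by (intro integrable_const_bound[where B=c]) auto
qed

lemma bounded_scores_cmult:
  assumes "h \<in> bounded_scores"
  shows "(\<lambda>w. b * h w) \<in> bounded_scores"
proof -
  obtain c where [measurable]: "h \<in> borel_measurable P" and c: "\<And>w. w \<in> space P \<Longrightarrow> \<bar>h w\<bar> \<le> c"
    and eq: "\<And>B. B \<in> sets borel \<Longrightarrow> (\<integral>w. indicator B (X w) * residual w * h w \<partial>P) = 0"
    using assms by (auto simp: bounded_scores_def)
  have "(\<integral>w. indicator B (X w) * residual w * (b * h w) \<partial>P) = 0" if "B \<in> sets borel" for B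
    using eq[OF that] by (simp add: mult.left_commute)
  moreover have "\<bar>b * h w\<bar> \<le> \<bar>b\<bar> * c" if "w \<in> space P" for w
    using c[OF that] by (simp add: abs_mult mult_left_mono)
  ultimately show ?thesis
    unfolding bounded_scores_def by auto
qed

lemma bounded_scores_diff:
  assumes "h \<in> bounded_scores" "k \<in> bounded_scores"
  shows "(\<lambda>w. h w - k w) \<in> bounded_scores"
proof -
  obtain c where [measurable]: "h \<in> borel_measurable P" and c: "\<And>w. w \<in> space P \<Longrightarrow> \<bar>h w\<bar> \<le> c"
    and eq: "\<And>B. B \<in> sets borel \<Longrightarrow> (\<integral>w. indicator B (X w) * residual w * h w \<partial>P) = 0"
    using assms(1) by (auto simp: bounded_scores_def)
  obtain d where [measurable]: "k \<in> borel_measurable P" and d: "\<And>w. w \<in> space P \<Longrightarrow> \<bar>k w\<bar> \<le> d"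
    and eq': "\<And>B. B \<in> sets borel \<Longrightarrow> (\<integral>w. indicator B (X w) * residual w * k w \<partial>P) = 0"
    using assms(2) by (auto simp: bounded_scores_def)
  have "(\<integral>w. indicator B (X w) * residual w * (h w - k w) \<partial>P) = 0" if "B \<in> sets borel" for B
    unfolding right_diff_distrib[of "indicator B (X w) * residual w" for w]
    using eq[OF that] eq'[OF that] bounded_scores_integrable[OF _ that] assms by simp
  moreover have "\<bar>h w - k w\<bar> \<le> c + d" if "w \<in> space P" for w
    using c[OF that] d[OF that] by linarith
  ultimately show ?thesis
    unfolding bounded_scores_def by auto
qed

text \<open>The L^2 closure of \<open>bounded_scores\<close>, without centring. Its definition
  mentions no cohort, so contributions of different cohorts can be combined inside it.\<close>

definition "approximable \<psi> \<longleftrightarrow> square_integrable P \<psi> \<and>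
    (\<forall>e>0. \<exists>h\<in>bounded_scores. (\<integral>w. (\<psi> w - h w)\<^sup>2 \<partial>P) < e)"

lemma bounded_scores_square_integrable: "h \<in> bounded_scores \<Longrightarrow> square_integrable P h"
  by (auto simp: bounded_scores_def intro!: square_integrable_bounded)

lemma approximable_cmult:
  assumes \<psi>: "approximable \<psi>"
  shows "approximable (\<lambda>w. b * \<psi> w)"
  unfolding approximable_def
proof (intro conjI allI impI)
  show "square_integrable P (\<lambda>w. b * \<psi> w)"
    using \<psi> by (simp add: approximable_def square_integrable_cmult)
  fix e :: real assume "0 < e"
  \<comment> \<open>b^2 + 1 in place of b^2 admits b = 0.\<close>
  then have "0 < e / (b\<^sup>2 + 1)"
    using zero_le_power2[of b] by (intro divide_pos_pos) linarith+
  then obtain h where h: "h \<in> bounded_scores" "(\<integral>w. (\<psi> w - h w)\<^sup>2 \<partial>P) < e / (b\<^sup>2 + 1)"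
    using \<psi> by (auto simp: approximable_def)
  have "(\<integral>w. (b * \<psi> w - b * h w)\<^sup>2 \<partial>P) = b\<^sup>2 * (\<integral>w. (\<psi> w - h w)\<^sup>2 \<partial>P)"
    by (simp add: right_diff_distrib[symmetric] power_mult_distrib)
  also have "\<dots> \<le> (b\<^sup>2 + 1) * (\<integral>w. (\<psi> w - h w)\<^sup>2 \<partial>P)"
    by (intro mult_right_mono) auto
  also have "\<dots> < e"
    using h(2) zero_le_power2[of b] by (simp add: pos_less_divide_eq mult.commute)
  finally show "\<exists>k\<in>bounded_scores. (\<integral>w. (b * \<psi> w - k w)\<^sup>2 \<partial>P) < e"
    by (rule bexI[OF _ bounded_scores_cmult[OF h(1)]])
qed

lemma approximable_diff:
  assumes \<psi>: "approximable \<psi>" and \<xi>: "approximable \<xi>"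
  shows "approximable (\<lambda>w. \<psi> w - \<xi> w)"
  unfolding approximable_def
proof (intro conjI allI impI)
  have sq: "square_integrable P \<psi>" "square_integrable P \<xi>"
    using assms by (simp_all add: approximable_def)
  show "square_integrable P (\<lambda>w. \<psi> w - \<xi> w)"
    by (rule square_integrable_diff[OF sq])
  fix e :: real assume "0 < e"
  then have "0 < e / 4" by simp
  then obtain h k where h: "h \<in> bounded_scores" "(\<integral>w. (\<psi> w - h w)\<^sup>2 \<partial>P) < e / 4"
    and k: "k \<in> bounded_scores" "(\<integral>w. (\<xi> w - k w)\<^sup>2 \<partial>P) < e / 4"
    using \<psi> \<xi> unfolding approximable_def by meson
  have 1: "square_integrable P (\<lambda>w. \<psi> w - h w)"
    by (rule square_integrable_diff[OF sq(1) bounded_scores_square_integrable[OF h(1)]])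
  have 2: "square_integrable P (\<lambda>w. \<xi> w - k w)"
    by (rule square_integrable_diff[OF sq(2) bounded_scores_square_integrable[OF k(1)]])
  have "(\<integral>w. (\<psi> w - \<xi> w - (h w - k w))\<^sup>2 \<partial>P) \<le> (\<integral>w. 2 * (\<psi> w - h w)\<^sup>2 + 2 * (\<xi> w - k w)\<^sup>2 \<partial>P)"
  proof (rule integral_mono_AE')
    have "(\<psi> w - \<xi> w - (h w - k w))\<^sup>2 \<le> 2 * (\<psi> w - h w)\<^sup>2 + 2 * (\<xi> w - k w)\<^sup>2" for w
      using power2_diff_le[of "\<psi> w - h w" "\<xi> w - k w"] by (simp add: algebra_simps)
    then show "AE w in P. (\<psi> w - \<xi> w - (h w - k w))\<^sup>2 \<le> 2 * (\<psi> w - h w)\<^sup>2 + 2 * (\<xi> w - k w)\<^sup>2" by auto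
  qed (use 1 2 in \<open>auto simp: square_integrable_def\<close>)
  also have "\<dots> = 2 * (\<integral>w. (\<psi> w - h w)\<^sup>2 \<partial>P) + 2 * (\<integral>w. (\<xi> w - k w)\<^sup>2 \<partial>P)"
    using 1 2 by (simp add: square_integrable_def)
  also have "\<dots> < e" using h(2) k(2) by simp
  finally show "\<exists>l\<in>bounded_scores. (\<integral>w. (\<psi> w - \<xi> w - l w)\<^sup>2 \<partial>P) < e"
    by (rule bexI[OF _ bounded_scores_diff[OF h(1) k(1)]])
qed

text \<open>Subtracting the mean turns a bounded approximation into the score of a linear path: mean
  0 preserves total mass, and the moment constraint preserves the propensity. Centring does not
  increase the L^2 distance, since a variance is at most the second moment.\<close>

lemma approximable_tangent_space:
  assumes \<psi>: "approximable \<psi>" and \<theta>: "\<theta> = (\<integral>w. \<psi> w \<partial>P)"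
    and propensity: "AE w in P. \<pi> (X w) = cond_exp_given P X borel (\<lambda>w. of_bool (a w)) w"
    and model: "\<And>f. \<lbrakk>f \<in> borel_measurable P; \<And>w. w \<in> space P \<Longrightarrow> 0 < f w;
        prob_space (density P (\<lambda>w. ennreal (f w)));
        AE w in density P (\<lambda>w. ennreal (f w)). \<pi> (X w) =
          cond_exp_given (density P (\<lambda>w. ennreal (f w))) X borel (\<lambda>w. of_bool (a w)) w\<rbrakk> \<Longrightarrow>
        density P (\<lambda>w. ennreal (f w)) \<in> \<M>"
  shows "(\<lambda>w. \<psi> w - \<theta>) \<in> tangent_space \<M> P"
proof (rule tangent_spaceI)
  have sq: "square_integrable P \<psi>" using \<psi> by (simp add: approximable_def)
  have one: "square_integrable P (\<lambda>w. k)" for k :: real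
    by (rule square_integrable_bounded[where c="\<bar>k\<bar>"]) auto
  show "square_integrable P (\<lambda>w. \<psi> w - \<theta>)"
    by (rule square_integrable_diff[OF sq one])
  fix e :: real assume "0 < e"
  then obtain k where k: "k \<in> bounded_scores" "(\<integral>w. (\<psi> w - k w)\<^sup>2 \<partial>P) < e"
    using \<psi> by (auto simp: approximable_def)
  obtain c where [measurable]: "k \<in> borel_measurable P" and c: "\<And>w. w \<in> space P \<Longrightarrow> \<bar>k w\<bar> \<le> c"
    and eq: "\<And>B. B \<in> sets borel \<Longrightarrow> (\<integral>w. indicator B (X w) * residual w * k w \<partial>P) = 0"
    using k(1) by (auto simp: bounded_scores_def)
  define \<kappa> where "\<kappa> = (\<integral>w. k w \<partial>P)"
  \<comment> \<open>The shift keeps the moment constraint because constants satisfy it: this is the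
    propensity condition under \<open>P\<close>.\<close>
  define h where "h w = k w - \<kappa>" for w
  have [measurable]: "h \<in> borel_measurable P" unfolding h_def[abs_def] by measurable
  have int_k: "integrable P k"
    by (intro square_integrable_imp_integrable' bounded_scores_square_integrable k)
  have h_mean: "(\<integral>w. h w \<partial>P) = 0"
    using int_k by (simp add: h_def \<kappa>_def prob_space)
  have int_h: "integrable P h"
    unfolding h_def[abs_def] using int_k by simp
  have hB: "(\<integral>w. indicator B (X w) * residual w * h w \<partial>P) = 0"
    "integrable P (\<lambda>w. indicator B (X w) * residual w * h w)"
    "integrable P (\<lambda>w. indicator B (X w) * residual w)"
    if [measurable]: "B \<in> sets borel" for B
  proof -
    show 1: "integrable P (\<lambda>w. indicator B (X w) * residual w)"
    proof (rule integrable_const_bound[where B=1], rule AE_I2)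
      show "norm (indicator B (X w) * residual w) \<le> 1" for w
        using residual_le[of w] by (cases "X w \<in> B") simp_all
    qed measurable
    have split: "(\<lambda>w. indicator B (X w) * residual w * h w) =
        (\<lambda>w. indicator B (X w) * residual w * k w - \<kappa> * (indicator B (X w) * residual w))"
      by (auto simp: h_def algebra_simps)
    show "integrable P (\<lambda>w. indicator B (X w) * residual w * h w)"
      unfolding split using 1 bounded_scores_integrable[OF k(1) that] by simp
    have "(\<integral>w. indicator B (X w) * residual w \<partial>P) = 0"
      using propensity that unfolding AE_propensity_iff by blast
    then show "(\<integral>w. indicator B (X w) * residual w * h w \<partial>P) = 0"
      unfolding split using 1 bounded_scores_integrable[OF k(1) that] eq[OF that] by simp
  qed
  have "h \<in> scores \<M> P"
  proof (rule bounded_score)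
    show "\<bar>h w\<bar> \<le> c + \<bar>\<kappa>\<bar>" if "w \<in> space P" for w
      using c[OF that] by (auto simp: h_def)
    fix t assume th: "\<And>w. w \<in> space P \<Longrightarrow> \<bar>t * h w\<bar> \<le> 1 / 2"
    let ?f = "\<lambda>w. 1 + t * h w"
    let ?Q = "density P (\<lambda>w. ennreal (?f w))"
    have bounds: "1 / 2 \<le> ?f w \<and> ?f w \<le> 2" if "w \<in> space P" for w
      using th[OF that] by (auto simp: abs_le_iff)
    have f_pos: "0 < ?f w" if "w \<in> space P" for w
      using bounds[OF that] by auto
    show "?Q \<in> \<M>"
    proof (rule model)
      show Q: "prob_space ?Q"
      proof
        have "emeasure ?Q (space ?Q) = (\<integral>\<^sup>+w. ennreal (?f w) \<partial>P)"
          by (simp add: emeasure_density cong: nn_integral_cong)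
        also have "\<dots> = ennreal (\<integral>w. ?f w \<partial>P)"
          using int_h f_pos by (intro nn_integral_eq_integral) (auto intro!: AE_I2 less_imp_le)
        also have "(\<integral>w. ?f w \<partial>P) = 1"
          using int_h h_mean by (simp add: prob_space)
        finally show "emeasure ?Q (space ?Q) = 1" by simp
      qed
      interpret Q: prob_space ?Q by fact
      interpret Q: known_propensity ?Q X a \<pi>
        using \<pi>_bounds by unfold_locales auto
      show "AE w in ?Q. \<pi> (X w) = cond_exp_given ?Q X borel (\<lambda>w. of_bool (a w)) w"
        unfolding Q.AE_propensity_iff
      proof
        \<comment> \<open>The moment under the tilt is the moment under \<open>P\<close> plus t
          times the constraint on h, and both vanish.\<close>
        fix B :: "'x set" assume B [measurable]: "B \<in> sets borel"
        have "(\<integral>w. indicator B (X w) * residual w \<partial>?Q) = (\<integral>w. ?f w * (indicator B (X w) * residual w) \<partial>P)"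
          by (rule integral_bounded_density[of _ 2]) (use bounds in auto)
        also have "\<dots> = (\<integral>w. indicator B (X w) * residual w + t * (indicator B (X w) * residual w * h w) \<partial>P)"
          by (rule Bochner_Integration.integral_cong) (auto simp: algebra_simps)
        also have "\<dots> = 0"
          using hB[OF B] propensity B unfolding AE_propensity_iff by simp
        finally show "(\<integral>w. indicator B (X w) * residual w \<partial>?Q) = 0" .
      qed
    qed (use f_pos in auto)
  qed simp
  moreover have "(\<integral>w. (\<psi> w - \<theta> - h w)\<^sup>2 \<partial>P) < e"
  proof -
    let ?d = "\<lambda>w. \<psi> w - k w"
    have d: "square_integrable P ?d"
      by (rule square_integrable_diff[OF sq bounded_scores_square_integrable[OF k(1)]])
    have mean: "(\<integral>w. ?d w \<partial>P) = \<theta> - \<kappa>"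
      using square_integrable_imp_integrable'[OF sq] int_k by (simp add: \<theta> \<kappa>_def)
    \<comment> \<open>\<theta> - \<kappa> is the mean of \<psi> - k, so centring both functions
      leaves exactly the variance of their difference.\<close>
    have "(\<integral>w. (\<psi> w - \<theta> - h w)\<^sup>2 \<partial>P) = variance ?d"
      unfolding mean by (rule Bochner_Integration.integral_cong) (auto simp: h_def algebra_simps)
    also have "\<dots> = (\<integral>w. (?d w)\<^sup>2 \<partial>P) - (expectation ?d)\<^sup>2"
      using d square_integrable_imp_integrable'[OF d] by (intro variance_eq) (auto simp: square_integrable_def)
    also have "\<dots> < e" using k(2) by (smt (verit) zero_le_power2)
    finally show ?thesis .
  qed
  ultimately show "\<exists>h\<in>scores \<M> P. (\<integral>w. (\<psi> w - \<theta> - h w)\<^sup>2 \<partial>P) < e" by blast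
qed

end

context cohort
begin

text \<open>
  Truncating \<open>Y\<close> destroys the orthogonality of \<open>Y - m V\<close>, so \<open>m\<close> is replaced by a regression of the
  truncated outcome; by Pythagoras this only decreases the distance to \<open>Y - m V\<close>.
\<close>

lemma bounded_approximation:
  assumes m: "is_regression P (\<lambda>x. qa x) V Y m" and e: "0 < e"
  shows "\<exists>h\<in>borel_measurable P. (\<exists>c. \<forall>x\<in>space P. \<bar>h x\<bar> \<le> c) \<and>
    (\<forall>D\<in>sets borel. (\<integral>x. indicator D (V x) * (of_bool (a x) - r (V x)) * h x \<partial>P) = 0) \<and>
    (\<integral>x. (score_part m x - h x)\<^sup>2 \<partial>P) < e"
proof -
  have [measurable]: "m \<in> borel_measurable borel"
    using m by (simp add: is_regression_def)
  note m_qa = square_integrable_regression_qa[OF m] and m_q = square_integrable_regression_q[OF m]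
  \<comment> \<open>A version bounded at every point is needed, since the approximation itself must
    be bounded.\<close>
  have "\<exists>k. is_regression P (\<lambda>x. qa x) V (\<lambda>x. clip (real n) (Y x)) k \<and> (\<forall>v. \<bar>k v\<bar> \<le> real n)" for n
  proof -
    obtain k where k: "is_regression P (\<lambda>x. qa x) V (\<lambda>x. clip (real n) (Y x)) k"
      using regression_exists by blast
    have "is_regression P (\<lambda>x. qa x) V (\<lambda>x. clip (real n) (Y x)) (\<lambda>v. clip (real n) (k v))"
      by (rule regression_clip[OF _ _ _ qa_pos _ k])
        (auto simp: abs_clip_le clip_square_le intro!: integrable_const_bound[where B="(real n)\<^sup>2"] AE_I2)
    then show ?thesis using abs_clip_le[of "real n"] by (intro exI conjI) auto
  qed
  then obtain k where k: "\<And>n. is_regression P (\<lambda>x. qa x) V (\<lambda>x. clip (real n) (Y x)) (k n)"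
    and k_le: "\<And>n v. \<bar>k n v\<bar> \<le> real n"
    by metis
  have [measurable]: "k n \<in> borel_measurable borel" for n
    using k by (simp add: is_regression_def)
  have clip_sq: "integrable P (\<lambda>x. of_bool (qa x) * (clip (real n) (Y x))\<^sup>2)" for n
    by (rule integrable_const_bound[where B="(real n)\<^sup>2"])
      (auto simp: clip_square_le intro!: AE_I2)
  have k_orth: "(\<integral>x. of_bool (qa x) * ((clip (real n) (Y x) - k n (V x)) * g (V x)) \<partial>P) = 0"
    if "g \<in> borel_measurable borel" "square_integrable P (\<lambda>x. of_bool (qa x) * g (V x))" for n g
    by (rule regression_orthogonal[OF _ _ _ qa_pos clip_sq k that]) auto
  \<comment> \<open>The two occurrences of \<open>m\<close> are treated differently: the leading one
    may be any bounded function of V, so \<open>m\<close> is clipped there, while the residual needs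
    the regression \<open>k n\<close> of the clipped outcome to stay orthogonal.\<close>
  define h where "h n x = of_bool (q x) * (clip (real n) (m (V x)) + of_bool (a x) / r (V x) * (clip (real n) (Y x) - k n (V x)))" for n x
  have [measurable]: "h n \<in> borel_measurable P" for n
    unfolding h_def[abs_def] by measurable
  have resid_le: "\<bar>1 / r (V x) * (clip (real n) (Y x) - k n (V x))\<bar> \<le> 1 / \<eta> * (2 * real n)" for n x
  proof -
    have "\<bar>clip (real n) (Y x) - k n (V x)\<bar> \<le> 2 * real n"
      using abs_clip_le[of "real n" "Y x"] k_le[of n "V x"] by linarith
    then show ?thesis
      unfolding abs_mult using inverse_r(1)[of "V x"] \<eta> by (intro mult_mono) auto
  qed
  have h_bound: "\<bar>h n x\<bar> \<le> real n + 1 / \<eta> * (2 * real n)" for n x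
  proof -
    have "0 \<le> 1 / \<eta> * (2 * real n)" using \<eta> by simp
    with resid_le[of x n] abs_clip_le[of "real n" "m (V x)"] show ?thesis
      by (cases "q x"; cases "a x") (auto simp: h_def intro: order_trans[OF abs_triangle_ineq add_mono])
  qed
  have h_eq: "(\<integral>x. indicator D (V x) * (of_bool (a x) - r (V x)) * h n x \<partial>P) = 0"
    if [measurable]: "D \<in> sets borel" for D n
  proof -
    \<comment> \<open>Multiplying \<open>h n\<close> by a - r gives -q (1 - a / r) r clip(m), which
      vanishes by balance, and q a (1 - r) / r times the clipped residual, which vanishes by
      orthogonality.\<close>
    let ?g = "\<lambda>v. indicator D v * clip (real n) (m v) * r v"
    let ?g' = "\<lambda>v. indicator D v * ((1 - r v) / r v)"
    have g: "square_integrable P (\<lambda>x. of_bool (q x) * ?g (V x))"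
    proof (rule square_integrable_bounded[where c="real n"])
      fix x
      have "\<bar>?g (V x)\<bar> \<le> 1 * real n * 1"
        unfolding abs_mult using r_pos[of "V x"] by (intro mult_mono) (auto simp: abs_clip_le split: split_indicator)
      then show "\<bar>of_bool (q x) * ?g (V x)\<bar> \<le> real n" by auto
    qed measurable
    have g': "square_integrable P (\<lambda>x. of_bool (qa x) * ?g' (V x))"
    proof (rule square_integrable_bounded[where c="1 / \<eta>"])
      fix x
      have "0 \<le> (1 - r (V x)) / r (V x)" using r r_pos by (intro divide_nonneg_nonneg) auto
      moreover have "(1 - r (V x)) / r (V x) \<le> 1 / \<eta>"
        using inverse_r(2)[of "V x"] r_pos[of "V x"] by (simp add: diff_divide_distrib)
      ultimately show "\<bar>of_bool (qa x) * ?g' (V x)\<bar> \<le> 1 / \<eta>"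
        using \<eta> by (auto split: split_indicator)
    qed measurable
    have "(\<integral>x. indicator D (V x) * (of_bool (a x) - r (V x)) * h n x \<partial>P) =
        (\<integral>x. - (of_bool (q x) * ((1 - of_bool (a x) / r (V x)) * ?g (V x))) +
          of_bool (qa x) * ((clip (real n) (Y x) - k n (V x)) * ?g' (V x)) \<partial>P)"
      by (rule Bochner_Integration.integral_cong)
        (use r_pos in \<open>auto simp: h_def field_simps split: split_indicator\<close>)
    also have "\<dots> = - (\<integral>x. of_bool (q x) * ((1 - of_bool (a x) / r (V x)) * ?g (V x)) \<partial>P) +
        (\<integral>x. of_bool (qa x) * ((clip (real n) (Y x) - k n (V x)) * ?g' (V x)) \<partial>P)"
    proof (subst Bochner_Integration.integral_add)
      show "integrable P (\<lambda>x. - (of_bool (q x) * ((1 - of_bool (a x) / r (V x)) * ?g (V x))))"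
        by (intro Bochner_Integration.integrable_minus square_integrable_imp_integrable' balanced_remainder(2)[OF _ g]) measurable
      have "square_integrable P (\<lambda>x. of_bool (qa x) * (clip (real n) (Y x) - k n (V x)))"
      proof (rule square_integrable_bounded[where c="2 * real n"])
        show "\<bar>of_bool (qa x) * (clip (real n) (Y x) - k n (V x))\<bar> \<le> 2 * real n" for x
          using abs_clip_le[of "real n" "Y x"] k_le[of n "V x"] by (auto simp: abs_le_iff)
      qed measurable
      from square_integrable_mult[OF this g']
      show "integrable P (\<lambda>x. of_bool (qa x) * ((clip (real n) (Y x) - k n (V x)) * ?g' (V x)))"
        by (rule back_subst[where P="integrable P"]) auto
    qed simp
    also have "\<dots> = 0"
      using balanced_remainder(1)[OF _ g] k_orth[OF _ g'] by simp
    finally show ?thesis .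
  qed
  define A where "A n = (\<integral>x. (of_bool (q x) * m (V x) - clip (real n) (of_bool (q x) * m (V x)))\<^sup>2 \<partial>P)" for n
  define B where "B n = (\<integral>x. (of_bool (qa x) * Y x - clip (real n) (of_bool (qa x) * Y x))\<^sup>2 \<partial>P)" for n
  have dist: "(\<integral>x. (score_part m x - h n x)\<^sup>2 \<partial>P) \<le> 2 * A n + 2 * (1 / \<eta>)\<^sup>2 * B n" for n
  proof -
    let ?u = "\<lambda>x. of_bool (q x) * (m (V x) - clip (real n) (m (V x)))"
    let ?D = "\<lambda>x. of_bool (qa x) * (Y x - clip (real n) (Y x))"
    let ?d = "\<lambda>x. of_bool (qa x) * (m (V x) - k n (V x))"
    have clip_sq': "square_integrable P (\<lambda>x. g x - clip (real n) (g x))" if "square_integrable P g" for g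
      by (rule square_integrableI[where g="\<lambda>x. (g x)\<^sup>2"])
        (use that in \<open>auto simp: square_integrable_def abs_le_square_iff[symmetric] abs_diff_clip_le\<close>)
    have u: "square_integrable P ?u" using clip_sq'[OF m_q] by (simp add: mult_clip)
    have D: "square_integrable P ?D" using clip_sq'[OF square_integrable_qaY] by (simp only: mult_clip of_nat_0_le_iff)
    have k_sq: "square_integrable P (\<lambda>x. of_bool (qa x) * k n (V x))"
      by (rule square_integrable_bounded[where c="real n"]) (use k_le in auto)
    have d: "square_integrable P ?d"
      using square_integrable_diff[OF m_qa k_sq] by (simp add: right_diff_distrib)
    have Dd: "square_integrable P (\<lambda>x. ?D x - ?d x)"
      by (rule square_integrable_diff[OF D d])
    \<comment> \<open>\<open>?D - ?d\<close> is the difference of the residuals Y - m and clip(Y) -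
      k on annotated units, each orthogonal to functions of V, hence to \<open>?d\<close>.\<close>
    have orth: "(\<integral>x. (?D x - ?d x) * ?d x \<partial>P) = 0"
    proof -
      have Ym: "square_integrable P (\<lambda>x. of_bool (qa x) * (Y x - m (V x)))"
        by (rule square_integrable_residual(1)[OF _ m_qa]) simp
      have Ck: "square_integrable P (\<lambda>x. of_bool (qa x) * (clip (real n) (Y x) - k n (V x)))"
        by (rule back_subst[where P="square_integrable P", OF square_integrable_diff[OF square_integrable_add[OF Ym d] D]])
          (auto simp: algebra_simps)
      have i: "integrable P (\<lambda>x. of_bool (qa x) * ((Y x - m (V x)) * (m (V x) - k n (V x))))"
        "integrable P (\<lambda>x. of_bool (qa x) * ((clip (real n) (Y x) - k n (V x)) * (m (V x) - k n (V x))))"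
        by (rule back_subst[where P="integrable P", OF square_integrable_mult[OF Ym d]]; force)
           (rule back_subst[where P="integrable P", OF square_integrable_mult[OF Ck d]]; force)
      have "(\<integral>x. (?D x - ?d x) * ?d x \<partial>P) =
          (\<integral>x. of_bool (qa x) * ((Y x - m (V x)) * (m (V x) - k n (V x))) -
            of_bool (qa x) * ((clip (real n) (Y x) - k n (V x)) * (m (V x) - k n (V x))) \<partial>P)"
        by (rule Bochner_Integration.integral_cong) (auto simp: algebra_simps)
      also have "\<dots> = (\<integral>x. of_bool (qa x) * ((Y x - m (V x)) * (m (V x) - k n (V x))) \<partial>P) -
            (\<integral>x. of_bool (qa x) * ((clip (real n) (Y x) - k n (V x)) * (m (V x) - k n (V x))) \<partial>P)"
        by (rule Bochner_Integration.integral_diff[OF i])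
      also have "\<dots> = 0"
        using regression_orthogonal_qa[OF m, of "\<lambda>v. m v - k n v"] k_orth[of "\<lambda>v. m v - k n v"] d by simp
      finally show ?thesis .
    qed
    have "(\<integral>x. (?D x - ?d x)\<^sup>2 \<partial>P) \<le> (\<integral>x. (?D x)\<^sup>2 \<partial>P)"
    proof -
      have "(\<integral>x. (?D x)\<^sup>2 \<partial>P) = (\<integral>x. (?D x - ?d x)\<^sup>2 + (2 * ((?D x - ?d x) * ?d x) + (?d x)\<^sup>2) \<partial>P)"
        by (rule Bochner_Integration.integral_cong) (auto simp: power2_eq_square algebra_simps)
      also have "\<dots> = (\<integral>x. (?D x - ?d x)\<^sup>2 \<partial>P) + (2 * (\<integral>x. (?D x - ?d x) * ?d x \<partial>P) + (\<integral>x. (?d x)\<^sup>2 \<partial>P))"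
        using square_integrable_power2[OF Dd] square_integrable_power2[OF d] square_integrable_mult[OF Dd d]
        by (simp only: Bochner_Integration.integral_add Bochner_Integration.integrable_add
            Bochner_Integration.integrable_mult_right Bochner_Integration.integral_mult_right_zero)
      finally show ?thesis unfolding orth by simp
    qed
    also have "\<dots> = B n" unfolding B_def by (simp only: mult_clip of_nat_0_le_iff)
    finally have DB: "(\<integral>x. (?D x - ?d x)\<^sup>2 \<partial>P) \<le> B n" .
    have "(\<integral>x. (score_part m x - h n x)\<^sup>2 \<partial>P) \<le> (\<integral>x. 2 * (?u x)\<^sup>2 + 2 * ((1 / \<eta>)\<^sup>2 * (?D x - ?d x)\<^sup>2) \<partial>P)"
    proof (rule integral_mono_AE')
      have "(score_part m x - h n x)\<^sup>2 \<le> 2 * (?u x)\<^sup>2 + 2 * ((1 / \<eta>)\<^sup>2 * (?D x - ?d x)\<^sup>2)" for x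
      proof -
        have eq: "score_part m x - h n x = ?u x + 1 / r (V x) * (?D x - ?d x)"
          by (cases "q x"; cases "a x") (auto simp: score_part_def h_def diff_divide_distrib add_divide_distrib)
        have "(score_part m x - h n x)\<^sup>2 \<le> 2 * (?u x)\<^sup>2 + 2 * (1 / r (V x) * (?D x - ?d x))\<^sup>2"
          unfolding eq by (rule power2_add_le)
        also have "(1 / r (V x) * (?D x - ?d x))\<^sup>2 \<le> (1 / \<eta>)\<^sup>2 * (?D x - ?d x)\<^sup>2"
          unfolding power_mult_distrib
          by (intro mult_right_mono power_mono inverse_r(2)) (use r_pos in auto)
        finally show ?thesis by simp
      qed
      then show "AE x in P. (score_part m x - h n x)\<^sup>2 \<le> 2 * (?u x)\<^sup>2 + 2 * ((1 / \<eta>)\<^sup>2 * (?D x - ?d x)\<^sup>2)"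
        by auto
    qed (use square_integrable_power2[OF u] square_integrable_power2[OF Dd] in auto)
    also have "\<dots> = 2 * (\<integral>x. (?u x)\<^sup>2 \<partial>P) + 2 * ((1 / \<eta>)\<^sup>2 * (\<integral>x. (?D x - ?d x)\<^sup>2 \<partial>P))"
      using square_integrable_power2[OF u] square_integrable_power2[OF Dd]
      by (simp only: Bochner_Integration.integral_add
            Bochner_Integration.integrable_mult_right Bochner_Integration.integral_mult_right_zero)
    also have "(\<integral>x. (?u x)\<^sup>2 \<partial>P) = A n" unfolding A_def by (simp only: mult_clip of_nat_0_le_iff)
    also have "2 * A n + 2 * ((1 / \<eta>)\<^sup>2 * (\<integral>x. (?D x - ?d x)\<^sup>2 \<partial>P)) \<le> 2 * A n + 2 * (1 / \<eta>)\<^sup>2 * B n"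
      using mult_left_mono[OF DB, of "2 * (1 / \<eta>)\<^sup>2"] by simp
    finally show ?thesis .
  qed
  have "(\<lambda>n. 2 * A n + 2 * (1 / \<eta>)\<^sup>2 * B n) \<longlonglongrightarrow> 2 * 0 + 2 * (1 / \<eta>)\<^sup>2 * 0"
    unfolding A_def B_def
    by (intro tendsto_intros clip_tendsto_square_integrable m_q square_integrable_qaY)
  then have "\<forall>\<^sub>F n in sequentially. 2 * A n + 2 * (1 / \<eta>)\<^sup>2 * B n < e"
    using e by (intro order_tendstoD(2)) auto
  then obtain n where "2 * A n + 2 * (1 / \<eta>)\<^sup>2 * B n < e"
    by (auto simp: eventually_sequentially)
  with dist[of n] have "(\<integral>x. (score_part m x - h n x)\<^sup>2 \<partial>P) < e" by simp
  with h_bound[of n] h_eq[of _ n] show ?thesis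
    by (intro bexI[of _ "h n"]) auto
qed

end

section \<open>Central limit theorem under sample splitting\<close>

lemma real_distribution_normal_law: "real_distribution (normal_law m v)" if "0 \<le> v"
proof -
  have "prob_space (normal_law m v)"
    using that by (auto simp: normal_law_def intro: prob_space_return prob_space_normal_density)
  then show ?thesis
    by (simp add: real_distribution_def real_distribution_axioms_def normal_law_def)
qed

section \<open>Moments and characteristic functions of sums\<close>

context prob_space
begin

lemma second_moment_sum_indep:
  fixes X :: "'i \<Rightarrow> 'a \<Rightarrow> real"
  assumes "finite I" "indep_vars (\<lambda>_. borel) X I"
    and "\<And>i. i \<in> I \<Longrightarrow> square_integrable M (X i)" "\<And>i. i \<in> I \<Longrightarrow> expectation (X i) = 0"
  shows "square_integrable M (\<lambda>\<omega>. \<Sum>i\<in>I. X i \<omega>) \<and>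
    expectation (\<lambda>\<omega>. (\<Sum>i\<in>I. X i \<omega>)\<^sup>2) = (\<Sum>i\<in>I. expectation (\<lambda>\<omega>. (X i \<omega>)\<^sup>2))"
  using assms
proof (induction I rule: finite_induct)
  case empty
  show ?case by (simp add: square_integrable_def)
next
  case (insert j I)
  let ?S = "\<lambda>\<omega>. \<Sum>i\<in>I. X i \<omega>"
  have "indep_vars (\<lambda>_. borel) X I"
    by (rule indep_vars_subset[OF insert.prems(1)]) auto
  then have IH: "square_integrable M ?S" "expectation (\<lambda>\<omega>. (?S \<omega>)\<^sup>2) = (\<Sum>i\<in>I. expectation (\<lambda>\<omega>. (X i \<omega>)\<^sup>2))"
    using insert.IH insert.prems by auto
  have j: "square_integrable M (X j)" "expectation (X j) = 0"
    using insert.prems by auto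
  have "indep_var borel (X j) borel ?S"
    by (rule indep_vars_sum[OF insert.hyps insert.prems(1)])
  then have "expectation (\<lambda>\<omega>. X j \<omega> * ?S \<omega>) = expectation (X j) * expectation ?S"
    by (intro indep_var_lebesgue_integral square_integrable_imp_integrable' j IH)
  then have cross: "expectation (\<lambda>\<omega>. X j \<omega> * ?S \<omega>) = 0"
    using j by simp
  have "expectation (\<lambda>\<omega>. (X j \<omega> + ?S \<omega>)\<^sup>2) = expectation (\<lambda>\<omega>. (X j \<omega>)\<^sup>2 + (?S \<omega>)\<^sup>2 + 2 * (X j \<omega> * ?S \<omega>))"
    by (simp add: power2_sum mult.assoc)
  also have "\<dots> = expectation (\<lambda>\<omega>. (X j \<omega>)\<^sup>2) + expectation (\<lambda>\<omega>. (?S \<omega>)\<^sup>2)"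
    using square_integrable_power2[OF j(1)] square_integrable_power2[OF IH(1)] square_integrable_mult[OF j(1) IH(1)] cross
    by (simp only: Bochner_Integration.integral_add Bochner_Integration.integrable_add
        Bochner_Integration.integrable_mult_right Bochner_Integration.integral_mult_right_zero)
  finally show ?case
    using insert.hyps IH square_integrable_add[OF j(1) IH(1)] by simp
qed

text \<open>From |exp(i x) - 1| \<le> |x| and Cauchy-Schwarz. It does the work of Slutsky's theorem:
  a remainder negligible in L^2 does not change the limit of characteristic functions.\<close>

lemma char_diff_le:
  assumes [measurable]: "Z \<in> borel_measurable M" "L \<in> borel_measurable M"
    and sq: "square_integrable M (\<lambda>\<omega>. Z \<omega> - L \<omega>)"
  shows "cmod (char (distr M borel Z) t - char (distr M borel L) t) \<le> \<bar>t\<bar> * sqrt (\<integral>\<omega>. (Z \<omega> - L \<omega>)\<^sup>2 \<partial>M)"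
proof -
  have int: "integrable M (\<lambda>\<omega>. iexp (t * Z \<omega>))" "integrable M (\<lambda>\<omega>. iexp (t * L \<omega>))"
    by (auto intro!: integrable_const_bound[where B=1])
  have d: "integrable M (\<lambda>\<omega>. Z \<omega> - L \<omega>)"
    by (rule square_integrable_imp_integrable'[OF sq])
  have "char (distr M borel Z) t - char (distr M borel L) t = (\<integral>\<omega>. iexp (t * Z \<omega>) - iexp (t * L \<omega>) \<partial>M)"
    unfolding char_def using int by (simp add: integral_distr)
  also have "cmod \<dots> \<le> (\<integral>\<omega>. cmod (iexp (t * Z \<omega>) - iexp (t * L \<omega>)) \<partial>M)"
    by (rule integral_norm_bound)
  also have "\<dots> \<le> (\<integral>\<omega>. \<bar>t\<bar> * \<bar>Z \<omega> - L \<omega>\<bar> \<partial>M)"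
  proof (rule integral_mono)
    fix \<omega>
    have "iexp (t * Z \<omega>) - iexp (t * L \<omega>) = iexp (t * L \<omega>) * (iexp (t * (Z \<omega> - L \<omega>)) - 1)"
      by (simp add: right_diff_distrib exp_add[symmetric])
    then have "cmod (iexp (t * Z \<omega>) - iexp (t * L \<omega>)) = cmod (iexp (t * (Z \<omega> - L \<omega>)) - 1)"
      by (simp add: norm_mult)
    also have "\<dots> \<le> \<bar>t * (Z \<omega> - L \<omega>)\<bar>"
      using iexp_approx1[of "t * (Z \<omega> - L \<omega>)" 0] by simp
    finally show "cmod (iexp (t * Z \<omega>) - iexp (t * L \<omega>)) \<le> \<bar>t\<bar> * \<bar>Z \<omega> - L \<omega>\<bar>"
      by (simp add: abs_mult)
  qed (use int d in auto)
  also have "\<dots> = \<bar>t\<bar> * (\<integral>\<omega>. \<bar>Z \<omega> - L \<omega>\<bar> \<partial>M)" by simp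
  also have "\<dots> \<le> \<bar>t\<bar> * sqrt (\<integral>\<omega>. (Z \<omega> - L \<omega>)\<^sup>2 \<partial>M)"
  proof (intro mult_left_mono real_le_rsqrt)
    have "square_integrable M (\<lambda>\<omega>. \<bar>Z \<omega> - L \<omega>\<bar>)" "square_integrable M (\<lambda>\<omega>. 1)"
      using sq by (auto simp: square_integrable_def)
    from Cauchy_Schwarz_integral[OF this]
    show "(\<integral>\<omega>. \<bar>Z \<omega> - L \<omega>\<bar> \<partial>M)\<^sup>2 \<le> (\<integral>\<omega>. (Z \<omega> - L \<omega>)\<^sup>2 \<partial>M)"
      by (simp add: prob_space)
  qed simp
  finally show ?thesis .
qed

context
  fixes S :: "'s measure" and W :: "nat \<Rightarrow> 'a \<Rightarrow> 's" and P :: "'s measure"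
  assumes indep: "indep_vars (\<lambda>_. S) W UNIV" and law: "\<And>i. distr M S (W i) = P"
begin

private lemma W: "W i \<in> measurable M S"
  using indep by (simp add: indep_vars_def)

private lemma sets_P: "sets P = sets S"
  unfolding law[of 0, symmetric] by simp

private lemma measurable_P: "measurable P N = measurable S N"
  by (rule measurable_cong_sets[OF sets_P refl])

private lemma prob_P: "prob_space P"
  using prob_space_distr[OF W[of 0]] law[of 0] by simp

private lemma integral_W: "f \<in> borel_measurable S \<Longrightarrow> (\<integral>\<omega>. f (W i \<omega>) \<partial>M) = (\<integral>w. f w \<partial>P)"
  for f :: "'s \<Rightarrow> real"
  unfolding law[of i, symmetric] using W by (intro integral_distr[symmetric]) auto

private lemma square_integrable_W:
  assumes [measurable]: "f \<in> borel_measurable S"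
  shows "square_integrable M (\<lambda>\<omega>. f (W i \<omega>)) \<longleftrightarrow> square_integrable P f"
  unfolding law[of i, symmetric] square_integrable_def
  using W by (simp add: integrable_distr_eq measurable_compose[OF W])

text \<open>As an inequality of nonnegative integrals it is trivial unless \<open>k\<close> is
  square integrable; in that case \<open>mean\<close> applies and independence removes the cross
  terms.\<close>

lemma second_moment_iid_sum:
  assumes fin: "finite I" and k [measurable]: "k \<in> borel_measurable S"
    and mean: "square_integrable P k \<Longrightarrow> (\<integral>w. k w \<partial>P) = 0"
  shows "(\<integral>\<^sup>+\<omega>. ennreal ((\<Sum>i\<in>I. k (W i \<omega>))\<^sup>2) \<partial>M) \<le> of_nat (card I) * (\<integral>\<^sup>+w. ennreal ((k w)\<^sup>2) \<partial>P)"
proof -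
  note [measurable] = W
  have kP [measurable]: "k \<in> borel_measurable P"
    using k by (simp only: measurable_P)
  show ?thesis
  proof (cases "(\<integral>\<^sup>+w. ennreal ((k w)\<^sup>2) \<partial>P) = \<infinity>")
    case True
    then show ?thesis
      using fin by (cases "I = {}") (auto simp: ennreal_mult_top)
  next
    case False
    then have sq: "square_integrable P k"
      unfolding square_integrable_def by (auto intro!: integrableI_bounded simp: top.not_eq_extremum)
    have X: "indep_vars (\<lambda>_. borel) (\<lambda>i \<omega>. k (W i \<omega>)) I"
      by (rule indep_vars_compose2[OF indep_vars_subset[OF indep subset_UNIV], where Y="\<lambda>_ w. k w" and N="\<lambda>_. borel"]) auto
    have sum: "square_integrable M (\<lambda>\<omega>. \<Sum>i\<in>I. k (W i \<omega>))"
      "expectation (\<lambda>\<omega>. (\<Sum>i\<in>I. k (W i \<omega>))\<^sup>2) = (\<Sum>i\<in>I. expectation (\<lambda>\<omega>. (k (W i \<omega>))\<^sup>2))"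
      using second_moment_sum_indep[OF fin X] sq mean[OF sq] by (auto simp: square_integrable_W integral_W[OF k])
    have "(\<integral>\<^sup>+\<omega>. ennreal ((\<Sum>i\<in>I. k (W i \<omega>))\<^sup>2) \<partial>M) = ennreal (expectation (\<lambda>\<omega>. (\<Sum>i\<in>I. k (W i \<omega>))\<^sup>2))"
      by (rule nn_integral_eq_integral[OF square_integrable_power2[OF sum(1)]]) auto
    also have "\<dots> = ennreal (real (card I) * (\<integral>w. (k w)\<^sup>2 \<partial>P))"
      unfolding sum(2) using integral_W[of "\<lambda>w. (k w)\<^sup>2"] by simp
    also have "\<dots> = of_nat (card I) * (\<integral>\<^sup>+w. ennreal ((k w)\<^sup>2) \<partial>P)"
      using square_integrable_power2[OF sq]
      by (subst nn_integral_eq_integral) (auto simp: ennreal_mult ennreal_of_nat_eq_real_of_nat)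
    finally show ?thesis by simp
  qed
qed

text \<open>
  Given the data in \<open>I'\<close> the summands are independent and centred, so the cross terms vanish. The
  bound \<open>b\<close> is separate from \<open>g\<^sup>2\<close> because square integrability of \<open>g d\<close> alone need not make
  \<open>g d\<close> centred.
\<close>

lemma second_moment_sample_split:
  fixes g :: "(nat \<Rightarrow> 's) \<Rightarrow> 's \<Rightarrow> real" and b :: "(nat \<Rightarrow> 's) \<Rightarrow> 's \<Rightarrow> ennreal"
  assumes fin: "finite I" "finite I'" and disj: "I \<inter> I' = {}"
    and g: "case_prod g \<in> borel_measurable ((\<Pi>\<^sub>M j\<in>I'. S) \<Otimes>\<^sub>M S)"
    and b: "case_prod b \<in> borel_measurable ((\<Pi>\<^sub>M j\<in>I'. S) \<Otimes>\<^sub>M S)"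
    and le: "\<And>d w. ennreal ((g d w)\<^sup>2) \<le> b d w"
    and mean: "\<And>d. d \<in> space (\<Pi>\<^sub>M j\<in>I'. S) \<Longrightarrow> (\<integral>\<^sup>+w. b d w \<partial>P) < \<infinity> \<Longrightarrow> (\<integral>w. g d w \<partial>P) = 0"
  shows "(\<integral>\<^sup>+\<omega>. ennreal ((\<Sum>i\<in>I. g (\<lambda>j\<in>I'. W j \<omega>) (W i \<omega>))\<^sup>2) \<partial>M) \<le>
    of_nat (card I) * (\<integral>\<^sup>+\<omega>. \<integral>\<^sup>+w. b (\<lambda>j\<in>I'. W j \<omega>) w \<partial>P \<partial>M)"
proof -
  interpret P: prob_space P by (rule prob_P)
  define D where "D \<omega> = (\<lambda>j\<in>I'. W j \<omega>)" for \<omega>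
  define E where "E \<omega> = (\<lambda>j\<in>I. W j \<omega>)" for \<omega>
  have D: "D \<in> measurable M (\<Pi>\<^sub>M j\<in>I'. S)"
    and E: "E \<in> measurable M (\<Pi>\<^sub>M j\<in>I. S)"
    unfolding D_def[abs_def] E_def[abs_def] by (intro measurable_restrict W)+
  \<comment> \<open>Samples over disjoint index sets are independent, so their joint law is a
    product and the training data can be held fixed while the evaluation sample is integrated
    out.\<close>
  have "indep_var (\<Pi>\<^sub>M j\<in>I'. S) D (\<Pi>\<^sub>M j\<in>I. S) E"
    unfolding D_def[abs_def] E_def[abs_def]
    by (rule indep_var_restrict[OF indep, of I' I]) (use disj in auto)
  then have joint: "distr M (\<Pi>\<^sub>M j\<in>I'. S) D \<Otimes>\<^sub>M distr M (\<Pi>\<^sub>M j\<in>I. S) E =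
      distr M ((\<Pi>\<^sub>M j\<in>I'. S) \<Otimes>\<^sub>M (\<Pi>\<^sub>M j\<in>I. S)) (\<lambda>\<omega>. (D \<omega>, E \<omega>))"
    unfolding indep_var_distribution_eq by (elim conjE)
  interpret DD: prob_space "distr M (\<Pi>\<^sub>M j\<in>I'. S) D" by (rule prob_space_distr[OF D])
  interpret EE: prob_space "distr M (\<Pi>\<^sub>M j\<in>I. S) E" by (rule prob_space_distr[OF E])
  have g_section: "g d \<in> borel_measurable S" if "d \<in> space (\<Pi>\<^sub>M j\<in>I'. S)" for d
  proof -
    have "(\<lambda>w. case_prod g (d, w)) \<in> borel_measurable S"
      by (rule measurable_compose[OF measurable_Pair1' g]) (rule that)
    then show ?thesis unfolding case_prod_conv .
  qed
  have inner: "(\<integral>\<^sup>+\<omega>. ennreal ((\<Sum>i\<in>I. g d (W i \<omega>))\<^sup>2) \<partial>M) \<le> of_nat (card I) * (\<integral>\<^sup>+w. b d w \<partial>P)"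
    if d: "d \<in> space (\<Pi>\<^sub>M j\<in>I'. S)" for d
  proof (cases "(\<integral>\<^sup>+w. b d w \<partial>P) < \<infinity>")
    case True
    have "(\<integral>\<^sup>+\<omega>. ennreal ((\<Sum>i\<in>I. g d (W i \<omega>))\<^sup>2) \<partial>M) \<le> of_nat (card I) * (\<integral>\<^sup>+w. ennreal ((g d w)\<^sup>2) \<partial>P)"
      by (rule second_moment_iid_sum[OF fin(1) g_section[OF d] mean[OF d True]])
    also have "\<dots> \<le> of_nat (card I) * (\<integral>\<^sup>+w. b d w \<partial>P)"
      by (intro mult_left_mono nn_integral_mono le) simp
    finally show ?thesis .
  next
    case False
    then show ?thesis
      using fin by (cases "I = {}") (auto simp: ennreal_mult_top less_top[symmetric])
  qed
  have G: "(\<lambda>d. \<integral>\<^sup>+w. b d w \<partial>P) \<in> borel_measurable (\<Pi>\<^sub>M j\<in>I'. S)"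
    by (rule P.borel_measurable_nn_integral)
      (use b in \<open>simp only: measurable_cong_sets[OF sets_pair_measure_cong[OF refl sets_P] refl]\<close>)
  have F: "(\<lambda>(d, e). ennreal ((\<Sum>i\<in>I. g d (e i))\<^sup>2)) \<in> borel_measurable ((\<Pi>\<^sub>M j\<in>I'. S) \<Otimes>\<^sub>M (\<Pi>\<^sub>M j\<in>I. S))"
  proof -
    have "(\<lambda>x. case_prod g (fst x, snd x i)) \<in> borel_measurable ((\<Pi>\<^sub>M j\<in>I'. S) \<Otimes>\<^sub>M (\<Pi>\<^sub>M j\<in>I. S))" if "i \<in> I" for i
      by (rule measurable_compose[OF measurable_Pair g])
        (rule measurable_fst, rule measurable_compose[OF measurable_snd measurable_component_singleton[OF that]])
    then have "(\<lambda>x. g (fst x) (snd x i)) \<in> borel_measurable ((\<Pi>\<^sub>M j\<in>I'. S) \<Otimes>\<^sub>M (\<Pi>\<^sub>M j\<in>I. S))" if "i \<in> I" for i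
      using that unfolding case_prod_conv .
    then show ?thesis
      unfolding split_def by (intro measurable_compose[OF _ measurable_ennreal] borel_measurable_power borel_measurable_sum)
  qed
  have "(\<integral>\<^sup>+\<omega>. ennreal ((\<Sum>i\<in>I. g (D \<omega>) (W i \<omega>))\<^sup>2) \<partial>M) =
      (\<integral>\<^sup>+\<omega>. (\<lambda>(d, e). ennreal ((\<Sum>i\<in>I. g d (e i))\<^sup>2)) (D \<omega>, E \<omega>) \<partial>M)"
    by (simp add: E_def)
  also have "\<dots> = (\<integral>\<^sup>+de. (\<lambda>(d, e). ennreal ((\<Sum>i\<in>I. g d (e i))\<^sup>2)) de
      \<partial>(distr M (\<Pi>\<^sub>M j\<in>I'. S) D \<Otimes>\<^sub>M distr M (\<Pi>\<^sub>M j\<in>I. S) E))"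
    unfolding joint by (rule nn_integral_distr[symmetric, OF measurable_Pair[OF D E]])
      (use F in \<open>simp only: measurable_distr_eq1\<close>)
  also have "\<dots> = (\<integral>\<^sup>+d. \<integral>\<^sup>+e. ennreal ((\<Sum>i\<in>I. g d (e i))\<^sup>2) \<partial>distr M (\<Pi>\<^sub>M j\<in>I. S) E \<partial>distr M (\<Pi>\<^sub>M j\<in>I'. S) D)"
    by (subst EE.nn_integral_fst[symmetric])
      (use F in \<open>simp_all only: split_def fst_conv snd_conv measurable_cong_sets[OF sets_pair_measure_cong[OF sets_distr sets_distr] refl]\<close>)
  also have "\<dots> = (\<integral>\<^sup>+d. \<integral>\<^sup>+\<omega>. ennreal ((\<Sum>i\<in>I. g d (W i \<omega>))\<^sup>2) \<partial>M \<partial>distr M (\<Pi>\<^sub>M j\<in>I'. S) D)"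
  proof (rule nn_integral_cong)
    fix d assume "d \<in> space (distr M (\<Pi>\<^sub>M j\<in>I'. S) D)"
    then have d: "d \<in> space (\<Pi>\<^sub>M j\<in>I'. S)" by simp
    show "(\<integral>\<^sup>+e. ennreal ((\<Sum>i\<in>I. g d (e i))\<^sup>2) \<partial>distr M (\<Pi>\<^sub>M j\<in>I. S) E) =
        (\<integral>\<^sup>+\<omega>. ennreal ((\<Sum>i\<in>I. g d (W i \<omega>))\<^sup>2) \<partial>M)"
    proof (subst nn_integral_distr[OF E])
      have "(\<lambda>e. (case (d, e) of (d, e) \<Rightarrow> ennreal ((\<Sum>i\<in>I. g d (e i))\<^sup>2))) \<in> borel_measurable (\<Pi>\<^sub>M j\<in>I. S)"
        by (rule measurable_compose[OF measurable_Pair1' F]) (rule d)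
      then show "(\<lambda>e. ennreal ((\<Sum>i\<in>I. g d (e i))\<^sup>2)) \<in> borel_measurable (distr M (\<Pi>\<^sub>M j\<in>I. S) E)"
        unfolding case_prod_conv measurable_distr_eq1 .
    qed (simp add: E_def cong: sum.cong)
  qed
  also have "\<dots> \<le> (\<integral>\<^sup>+d. of_nat (card I) * (\<integral>\<^sup>+w. b d w \<partial>P) \<partial>distr M (\<Pi>\<^sub>M j\<in>I'. S) D)"
    by (rule nn_integral_mono) (use inner in auto)
  also have "\<dots> = of_nat (card I) * (\<integral>\<^sup>+\<omega>. \<integral>\<^sup>+w. b (D \<omega>) w \<partial>P \<partial>M)"
    using G by (simp only: nn_integral_cmult nn_integral_distr[OF D] measurable_distr_eq1)
  finally show ?thesis by (simp add: D_def)
qed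

text \<open>The law of the sum depends on \<open>I\<close> only through its cardinality, so a limit
  theorem for initial segments serves for arbitrary index sets.\<close>

private lemma char_scaled_sum:
  assumes \<phi> [measurable]: "\<phi> \<in> borel_measurable S"
  shows "char (distr M borel (\<lambda>\<omega>. (\<Sum>i\<in>I. \<phi> (W i \<omega>)) / c)) t = char (distr P borel \<phi>) (t / c) ^ card I"
proof -
  note [measurable] = W
  have "indep_vars (\<lambda>_. borel) (\<lambda>i \<omega>. \<phi> (W i \<omega>) / c) I"
    by (rule indep_vars_compose2[OF indep_vars_subset[OF indep subset_UNIV], where Y="\<lambda>_ w. \<phi> w / c" and N="\<lambda>_. borel"]) auto
  from char_distr_sum[OF this, of t]
  have "char (distr M borel (\<lambda>\<omega>. (\<Sum>i\<in>I. \<phi> (W i \<omega>)) / c)) t = (\<Prod>i\<in>I. char (distr M borel (\<lambda>\<omega>. \<phi> (W i \<omega>) / c)) t)"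
    by (simp add: sum_divide_distrib)
  moreover have "char (distr M borel (\<lambda>\<omega>. \<phi> (W i \<omega>) / c)) t = char (distr P borel \<phi>) (t / c)" for i
    unfolding char_def law[of i, symmetric] by (simp add: integral_distr)
  ultimately show ?thesis by simp
qed

text \<open>Standardising needs a positive variance. With variance 0, \<phi> vanishes almost
  everywhere and both sides are constantly 1, the characteristic function of the point mass at
  0.\<close>

private lemma char_sum_tendsto_normal_law:
  assumes \<phi>: "\<phi> \<in> borel_measurable S" and sq: "square_integrable P \<phi>" and mean: "(\<integral>w. \<phi> w \<partial>P) = 0"
  shows "(\<lambda>n. char (distr P borel \<phi>) (t / sqrt (real n)) ^ n) \<longlonglongrightarrow>
    char (normal_law 0 (\<integral>w. (\<phi> w)\<^sup>2 \<partial>P)) t"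
proof -
  have \<phi>P: "\<phi> \<in> borel_measurable P"
    using \<phi> by (simp only: measurable_P)
  show ?thesis
  proof (cases "(\<integral>w. (\<phi> w)\<^sup>2 \<partial>P) = 0")
    case True
    note [measurable] = \<phi>P
    interpret P: prob_space P by (rule prob_P)
    have "AE w in P. (\<phi> w)\<^sup>2 = 0"
      using True square_integrable_power2[OF sq] by (subst (asm) integral_nonneg_eq_0_iff_AE) auto
    then have ae: "AE w in P. iexp (s * \<phi> w) = 1" for s
      by eventually_elim simp
    have "(\<integral>w. iexp (s * \<phi> w) \<partial>P) = (\<integral>w. 1 \<partial>P)" for s
      by (rule integral_cong_AE[OF _ _ ae]) measurable
    then have "char (distr P borel \<phi>) s = (\<integral>w. 1 \<partial>P)" for s
      unfolding char_def by (subst integral_distr[OF \<phi>P]) auto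
    moreover have "char (normal_law 0 0) t = 1"
      by (simp add: normal_law_def char_def integral_return)
    ultimately show ?thesis using True by (simp add: P.prob_space)
  next
    case False
    note [measurable] = \<phi> W
    define \<sigma> where "\<sigma> = sqrt (\<integral>w. (\<phi> w)\<^sup>2 \<partial>P)"
    have "0 \<le> (\<integral>w. (\<phi> w)\<^sup>2 \<partial>P)" by simp
    with False have "0 < (\<integral>w. (\<phi> w)\<^sup>2 \<partial>P)" by linarith
    then have \<sigma>: "0 < \<sigma>" "\<sigma>\<^sup>2 = (\<integral>w. (\<phi> w)\<^sup>2 \<partial>P)" by (auto simp: \<sigma>_def)
    have "weak_conv_m (\<lambda>n. distr M borel (\<lambda>\<omega>. (\<Sum>i<n. \<phi> (W i \<omega>)) / sqrt (n * \<sigma>\<^sup>2))) std_normal_distribution"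
    proof (rule central_limit_theorem_zero_mean[OF _ _ \<sigma>(1), where \<mu>="distr P borel \<phi>"])
      show "indep_vars (\<lambda>i. borel) (\<lambda>i \<omega>. \<phi> (W i \<omega>)) UNIV"
        by (rule indep_vars_compose2[OF indep, where Y="\<lambda>_ w. \<phi> w" and N="\<lambda>_. borel"]) auto
      show m0: "expectation (\<lambda>\<omega>. \<phi> (W n \<omega>)) = 0" for n
        using mean by (simp add: integral_W)
      show "integrable M (\<lambda>\<omega>. (\<phi> (W n \<omega>))\<^sup>2)" for n
        using sq by (intro square_integrable_power2) (simp add: square_integrable_W)
      show "variance (\<lambda>\<omega>. \<phi> (W n \<omega>)) = \<sigma>\<^sup>2" for n
        unfolding m0 \<sigma>(2) using integral_W[of "\<lambda>w. (\<phi> w)\<^sup>2"] by simp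
      show "distr M borel (\<lambda>\<omega>. \<phi> (W n \<omega>)) = distr P borel \<phi>" for n
        unfolding law[of n, symmetric] by (subst distr_distr) (auto simp: comp_def)
    qed
    \<comment> \<open>Evaluating at \<sigma> t undoes the division by \<sigma> in the standardised
      sum.\<close>
    then have "(\<lambda>n. char (distr M borel (\<lambda>\<omega>. (\<Sum>i<n. \<phi> (W i \<omega>)) / sqrt (n * \<sigma>\<^sup>2))) (\<sigma> * t)) \<longlonglongrightarrow>
        char std_normal_distribution (\<sigma> * t)"
      by (intro levy_continuity1 real_distribution_distr) (auto simp: real_dist_normal_dist)
    moreover have "char (distr M borel (\<lambda>\<omega>. (\<Sum>i<n. \<phi> (W i \<omega>)) / sqrt (n * \<sigma>\<^sup>2))) (\<sigma> * t) =
        char (distr P borel \<phi>) (t / sqrt (real n)) ^ n" for n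
      using \<sigma>(1) by (subst char_scaled_sum[OF \<phi>]) (simp add: real_sqrt_mult)
    moreover have "char std_normal_distribution (\<sigma> * t) = char (normal_law 0 (\<integral>w. (\<phi> w)\<^sup>2 \<partial>P)) t"
    proof -
      interpret N: prob_space std_normal_distribution
        by (rule prob_space_normal_density) simp
      have "distributed std_normal_distribution lborel (\<lambda>x. x) (\<lambda>x. ennreal (std_normal_density x))"
        by (auto simp: distributed_def distr_id2)
      from N.normal_density_affine[OF this, of \<sigma> 0] \<sigma>
      have "distributed std_normal_distribution lborel (\<lambda>x. \<sigma> * x) (\<lambda>x. ennreal (normal_density 0 \<sigma> x))"
        by simp
      then have "distr std_normal_distribution lborel (\<lambda>x. \<sigma> * x) = density lborel (\<lambda>x. ennreal (normal_density 0 \<sigma> x))"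
        by (simp add: distributed_def)
      then have "normal_law 0 (\<integral>w. (\<phi> w)\<^sup>2 \<partial>P) = distr std_normal_distribution lborel (\<lambda>x. \<sigma> * x)"
        using False by (simp add: normal_law_def \<sigma>_def)
      then show ?thesis
        by (simp add: char_def integral_distr ac_simps)
    qed
    ultimately show ?thesis by simp
  qed
qed

text \<open>Levy continuity: the linear part converges along the cardinalities
  \<open>card (I n)\<close>, and the remainder is absorbed by \<open>char_diff_le\<close>.\<close>

lemma asymptotically_linear_weak_conv:
  assumes \<phi> [measurable]: "\<phi> \<in> borel_measurable S" and sq: "square_integrable P \<phi>" and mean: "(\<integral>w. \<phi> w \<partial>P) = 0"
    and card: "filterlim (\<lambda>n. card (I n)) at_top sequentially"
    and Z [measurable]: "\<And>n. Z n \<in> borel_measurable M"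
    and remainder: "(\<lambda>n. \<integral>\<^sup>+\<omega>. ennreal ((Z n \<omega> - (\<Sum>i\<in>I n. \<phi> (W i \<omega>)) / sqrt (real (card (I n))))\<^sup>2) \<partial>M) \<longlonglongrightarrow> 0"
  shows "weak_conv_m (\<lambda>n. distr M borel (Z n)) (normal_law 0 (\<integral>w. (\<phi> w)\<^sup>2 \<partial>P))"
proof (rule levy_continuity)
  show "real_distribution (distr M borel (Z n))" for n
    by (rule real_distribution_distr) simp
  show "real_distribution (normal_law 0 (\<integral>w. (\<phi> w)\<^sup>2 \<partial>P))"
    by (rule real_distribution_normal_law) simp
  fix t
  define L where "L n \<omega> = (\<Sum>i\<in>I n. \<phi> (W i \<omega>)) / sqrt (real (card (I n)))" for n \<omega>
  note [measurable] = W
  have [measurable]: "L n \<in> borel_measurable M" for n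
    unfolding L_def[abs_def] by measurable
  have "(\<lambda>n. char (distr P borel \<phi>) (t / sqrt (real (card (I n)))) ^ card (I n)) \<longlonglongrightarrow>
      char (normal_law 0 (\<integral>w. (\<phi> w)\<^sup>2 \<partial>P)) t"
    by (rule filterlim_compose[OF char_sum_tendsto_normal_law[OF \<phi> sq mean] card])
  then have L: "(\<lambda>n. char (distr M borel (L n)) t) \<longlonglongrightarrow> char (normal_law 0 (\<integral>w. (\<phi> w)\<^sup>2 \<partial>P)) t"
    unfolding L_def[abs_def] by (simp add: char_scaled_sum)
  define R where "R n = (\<integral>\<^sup>+\<omega>. ennreal ((Z n \<omega> - L n \<omega>)\<^sup>2) \<partial>M)" for n
  have R: "R \<longlonglongrightarrow> 0" using remainder by (simp add: R_def[abs_def] L_def)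
  have "(\<lambda>n. char (distr M borel (Z n)) t - char (distr M borel (L n)) t) \<longlonglongrightarrow> 0"
  proof (rule Lim_null_comparison)
    have "(\<lambda>n. enn2real (R n)) \<longlonglongrightarrow> enn2real 0"
      using R by (intro tendsto_enn2real) auto
    from tendsto_real_sqrt[OF this] show "(\<lambda>n. \<bar>t\<bar> * sqrt (enn2real (R n))) \<longlonglongrightarrow> 0"
      by (intro tendsto_mult_right_zero) simp
    \<comment> \<open>The remainder may have infinite second moment for some n; eventually it is
      below 1, hence finite, and the real-valued bound applies.\<close>
    have "\<forall>\<^sub>F n in sequentially. R n < 1"
      using R by (intro order_tendstoD(2)) auto
    then show "\<forall>\<^sub>F n in sequentially. norm (char (distr M borel (Z n)) t - char (distr M borel (L n)) t) \<le>
        \<bar>t\<bar> * sqrt (enn2real (R n))"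
    proof eventually_elim
      case (elim n)
      then have sq: "square_integrable M (\<lambda>\<omega>. Z n \<omega> - L n \<omega>)"
        unfolding square_integrable_def R_def
        by (auto intro!: integrableI_bounded intro: order_less_trans)
      have "enn2real (R n) = (\<integral>\<omega>. (Z n \<omega> - L n \<omega>)\<^sup>2 \<partial>M)"
        unfolding R_def by (subst nn_integral_eq_integral[OF square_integrable_power2[OF sq]]) auto
      with char_diff_le[OF _ _ sq, of t] show ?case by simp
    qed
  qed
  from tendsto_add[OF this L] show "(\<lambda>n. char (distr M borel (Z n)) t) \<longlonglongrightarrow> char (normal_law 0 (\<integral>w. (\<phi> w)\<^sup>2 \<partial>P)) t"
    by simp
qed

end

end

section \<open>Conditional independence\<close>

context prob_space
begin

text \<open>Conditioning on Z and replacing E[a | Z] by \<pi>(Z) gives E[D S a] = E[D \<pi>(Z)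
  E[S | Z]] = E[D \<pi>(Z) S], with D and S read as indicators.\<close>

lemma cond_indep_balanced:
  fixes Z :: "'a \<Rightarrow> 'z::topological_space"
  assumes [measurable]: "Z \<in> borel_measurable M" "X \<in> measurable M N" "Measurable.pred M a"
    and \<pi> [measurable]: "\<pi> \<in> borel_measurable borel" and \<pi>_bounds: "\<And>z. 0 \<le> \<pi> z" "\<And>z. \<pi> z \<le> 1"
    and indep: "cond_indep M X N a (count_space UNIV) Z borel"
    and propensity: "AE x in M. \<pi> (Z x) = cond_exp_given M Z borel (\<lambda>x. of_bool (a x)) x"
    and D [measurable]: "D \<in> sets borel" and S [measurable]: "S \<in> sets N"
  shows "(\<integral>x. indicator D (Z x) * (indicator S (X x) * of_bool (a x)) \<partial>M) =
    (\<integral>x. indicator D (Z x) * (indicator S (X x) * \<pi> (Z x)) \<partial>M)"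
proof -
  let ?F = "vimage_algebra (space M) Z borel"
  interpret F: finite_measure_subalgebra M ?F
    by (rule finite_measure_subalgebra_vimage) simp
  have FZ: "(\<lambda>x. g (Z x)) \<in> borel_measurable ?F" if "g \<in> borel_measurable borel" for g :: "'z \<Rightarrow> real"
    by (rule measurable_compose[OF measurable_vimage_algebra1 that]) auto
  have eq: "indicator {True} b = (of_bool b :: real)" for b
    by auto
  have "{True} \<in> sets (count_space UNIV)" by simp
  from indep[unfolded cond_indep_def, rule_format, OF S this]
  have "AE x in M. real_cond_exp M ?F (\<lambda>x. indicator S (X x) * of_bool (a x)) x =
      real_cond_exp M ?F (\<lambda>x. indicator S (X x)) x * real_cond_exp M ?F (\<lambda>x. of_bool (a x)) x"
    unfolding cond_exp_given_def eq .
  with propensity have ce: "AE x in M. indicator D (Z x) * real_cond_exp M ?F (\<lambda>x. indicator S (X x) * of_bool (a x)) x =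
      indicator D (Z x) * \<pi> (Z x) * real_cond_exp M ?F (\<lambda>x. indicator S (X x)) x"
    unfolding cond_exp_given_def by eventually_elim simp
  have "(\<integral>x. indicator D (Z x) * (indicator S (X x) * of_bool (a x)) \<partial>M) =
      (\<integral>x. indicator D (Z x) * real_cond_exp M ?F (\<lambda>x. indicator S (X x) * of_bool (a x)) x \<partial>M)"
    by (rule F.real_cond_exp_intg(2)[symmetric])
      (auto intro!: integrable_const_bound[where B=1] FZ split: split_indicator)
  also have "\<dots> = (\<integral>x. indicator D (Z x) * \<pi> (Z x) * real_cond_exp M ?F (\<lambda>x. indicator S (X x)) x \<partial>M)"
    by (rule integral_cong_AE[OF _ _ ce]) measurable
  also have "\<dots> = (\<integral>x. indicator D (Z x) * \<pi> (Z x) * indicator S (X x) \<partial>M)"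
    by (rule F.real_cond_exp_intg(2))
      (use \<pi>_bounds in \<open>auto intro!: integrable_const_bound[where B=1] FZ[of "\<lambda>z. indicator D z * \<pi> z"] split: split_indicator\<close>)
  finally show ?thesis by (simp add: ac_simps)
qed

text \<open>The contraction property of conditional independence. Independence of U and a given X
  makes \<pi>(X) the propensity given (X, U) too; the previous lemma, applied once more with this
  finer conditioning variable, brings in C.\<close>

lemma cond_indep_chain_balanced:
  fixes X :: "'a \<Rightarrow> 'x::second_countable_topology" and U :: "'a \<Rightarrow> 'u::second_countable_topology"
  assumes X [measurable]: "X \<in> borel_measurable M" and U [measurable]: "U \<in> borel_measurable M"
    and C [measurable]: "C \<in> measurable M N" and a [measurable]: "Measurable.pred M a"
    and \<pi> [measurable]: "\<pi> \<in> borel_measurable borel" and \<pi>_bounds: "\<And>z. 0 \<le> \<pi> z" "\<And>z. \<pi> z \<le> 1"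
    and C_indep: "cond_indep M C N a (count_space UNIV) (\<lambda>x. (X x, U x)) borel"
    and U_indep: "cond_indep M U borel a (count_space UNIV) X borel"
    and propensity: "AE x in M. \<pi> (X x) = cond_exp_given M X borel (\<lambda>x. of_bool (a x)) x"
    and D: "D \<in> sets borel" and S: "S \<in> sets N"
  shows "(\<integral>x. indicator D (X x, U x) * (indicator S (C x) * of_bool (a x)) \<partial>M) =
    (\<integral>x. indicator D (X x, U x) * (indicator S (C x) * \<pi> (X x)) \<partial>M)"
proof -
  let ?Z = "\<lambda>x. (X x, U x)"
  have Z [measurable]: "?Z \<in> borel_measurable M" by (rule borel_measurable_Pair[OF X U])
  have fst_borel [measurable]: "(\<lambda>z. \<pi> (fst z)) \<in> borel_measurable (borel :: ('x \<times> 'u) measure)"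
    by (rule measurable_compose[OF borel_measurable_continuous_onI[OF continuous_on_fst[OF continuous_on_id]] \<pi>])
  interpret Z: known_propensity M ?Z a "\<lambda>z. \<pi> (fst z)"
    using \<pi>_bounds by unfold_locales auto
  define N1 where "N1 = density M (\<lambda>x. ennreal (of_bool (a x)))"
  define N2 where "N2 = density M (\<lambda>x. ennreal (\<pi> (X x)))"
  have N_D: "emeasure (distr N1 borel ?Z) D = ennreal (\<integral>x. of_bool (a x) * indicator D (?Z x) \<partial>M)"
    "emeasure (distr N2 borel ?Z) D = ennreal (\<integral>x. \<pi> (X x) * indicator D (?Z x) \<partial>M)"
    if "D \<in> sets borel" for D
    unfolding N1_def N2_def using that \<pi>_bounds by (intro emeasure_distr_density; simp)+
  have "distr N1 borel ?Z = distr N2 borel ?Z"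
  \<comment> \<open>The identity is available for products of Borel sets; they form an
    intersection-stable generator because both spaces are second countable.\<close>
  proof (rule measure_eqI_generator_eq[where \<Omega>=UNIV and E="{A \<times> B |A B. A \<in> sets borel \<and> B \<in> sets borel}" and A="\<lambda>_. UNIV"])
    show "Int_stable {A \<times> B |A B. A \<in> sets (borel :: 'x measure) \<and> B \<in> sets (borel :: 'u measure)}"
      by (rule Int_stable_pair_measure_generator)
    have "sets (borel :: ('x \<times> 'u) measure) = sigma_sets UNIV {A \<times> B |A B. A \<in> sets borel \<and> B \<in> sets borel}"
      unfolding borel_prod[symmetric] sets_pair_measure by (simp add: conj_commute)
    then show "sets (distr N1 borel ?Z) = sigma_sets UNIV {A \<times> B |A B. A \<in> sets borel \<and> B \<in> sets borel}"
      "sets (distr N2 borel ?Z) = sigma_sets UNIV {A \<times> B |A B. A \<in> sets borel \<and> B \<in> sets borel}"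
      by simp_all
    fix R assume "R \<in> {A \<times> B |A B. A \<in> sets (borel :: 'x measure) \<and> B \<in> sets (borel :: 'u measure)}"
    then obtain A B where R: "R = A \<times> B" and A: "A \<in> sets borel" and B: "B \<in> sets borel"
      by auto
    then have R_borel: "R \<in> sets borel"
      unfolding borel_prod[symmetric] by simp
    have ind: "indicator R (?Z x) = indicator A (X x) * (indicator B (U x) :: real)" for x
      by (auto simp: R split: split_indicator)
    show "emeasure (distr N1 borel ?Z) R = emeasure (distr N2 borel ?Z) R"
      unfolding N_D[OF R_borel] ind
      using cond_indep_balanced[OF X U a \<pi> \<pi>_bounds U_indep propensity A B]
      by (simp add: ac_simps)
  next
    show "range (\<lambda>_. UNIV) \<subseteq> {A \<times> B |A B. A \<in> sets (borel :: 'x measure) \<and> B \<in> sets (borel :: 'u measure)}"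
      by (auto intro!: exI[of _ UNIV])
    show "emeasure (distr N1 borel ?Z) UNIV \<noteq> \<infinity>"
      using N_D(1)[of UNIV] by simp
  qed auto
  then have eqZ: "(\<integral>x. indicator D (?Z x) * of_bool (a x) \<partial>M) = (\<integral>x. indicator D (?Z x) * \<pi> (X x) \<partial>M)"
    if "D \<in> sets borel" for D
    using N_D[OF that] \<pi>_bounds by (simp add: integral_nonneg_AE mult.commute)
  have "AE x in M. \<pi> (fst (?Z x)) = cond_exp_given M ?Z borel (\<lambda>x. of_bool (a x)) x"
    unfolding Z.AE_propensity_iff
  proof
    fix D :: "('x \<times> 'u) set" assume D [measurable]: "D \<in> sets borel"
    have int: "integrable M (\<lambda>x. indicator D (?Z x) * of_bool (a x) :: real)"
      "integrable M (\<lambda>x. indicator D (?Z x) * \<pi> (X x))"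
      using \<pi>_bounds by (auto intro!: integrable_const_bound[where B=1] split: split_indicator)
    show "(\<integral>x. indicator D (?Z x) * (of_bool (a x) - \<pi> (fst (?Z x))) \<partial>M) = 0"
      using int eqZ[OF D] by (simp add: right_diff_distrib)
  qed
  from cond_indep_balanced[OF Z C a fst_borel _ _ C_indep this D S] \<pi>_bounds
  show ?thesis by simp
qed

end


section \<open>Panels\<close>

lemma
  assumes "t \<in> {1..T}"
  shows outcome_measurable: "(\<lambda>w. outcome w t) \<in> borel_measurable (panel_space T)"
    and treated_measurable: "Measurable.pred (panel_space T) (\<lambda>w. treated w t)"
    and annotated_measurable: "Measurable.pred (panel_space T) (\<lambda>w. annotated w t)"
    and covariate_measurable: "(\<lambda>w. covariate w t) \<in> borel_measurable (panel_space T)"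
    and unstructured_measurable: "(\<lambda>w. unstructured w t) \<in> borel_measurable (panel_space T)"
proof -
  have c: "(\<lambda>w. w t) \<in> measurable (panel_space T) obs_space"
    unfolding panel_space_def by (rule measurable_component_singleton[OF assms])
  note c' = c[unfolded obs_space_def]
  show "(\<lambda>w. outcome w t) \<in> borel_measurable (panel_space T)"
    unfolding outcome_def by (intro measurable_compose[OF c'] measurable_fst)
  have 1: "(\<lambda>w. snd (w t)) \<in> measurable (panel_space T) (count_space UNIV \<Otimes>\<^sub>M count_space UNIV \<Otimes>\<^sub>M borel \<Otimes>\<^sub>M borel)"
    by (rule measurable_compose[OF c' measurable_snd])
  then show "Measurable.pred (panel_space T) (\<lambda>w. treated w t)"
    unfolding treated_def by (rule measurable_compose[OF _ measurable_fst])
  have 2: "(\<lambda>w. snd (snd (w t))) \<in> measurable (panel_space T) (count_space UNIV \<Otimes>\<^sub>M borel \<Otimes>\<^sub>M borel)"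
    by (rule measurable_compose[OF 1 measurable_snd])
  then show "Measurable.pred (panel_space T) (\<lambda>w. annotated w t)"
    unfolding annotated_def by (rule measurable_compose[OF _ measurable_fst])
  have 3: "(\<lambda>w. snd (snd (snd (w t)))) \<in> measurable (panel_space T) (borel \<Otimes>\<^sub>M borel)"
    by (rule measurable_compose[OF 2 measurable_snd])
  then show "(\<lambda>w. covariate w t) \<in> borel_measurable (panel_space T)"
    unfolding covariate_def by (rule measurable_compose[OF _ measurable_fst])
  show "(\<lambda>w. unstructured w t) \<in> borel_measurable (panel_space T)"
    unfolding unstructured_def by (rule measurable_compose[OF 3 measurable_snd])
qed

lemma first_treated_measurable:
  assumes "g \<in> {1..T}"
  shows "Measurable.pred (panel_space T) (first_treated g)"
proof -
  have [measurable]: "Measurable.pred (panel_space T) (\<lambda>w. treated w t)" if "t \<in> insert g {1..<g}" for t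
    by (rule treated_measurable) (use that assms in auto)
  show ?thesis
    unfolding first_treated_def[abs_def] by measurable
qed

lemma never_treated_measurable: "Measurable.pred (panel_space T) (never_treated T)"
proof -
  have [measurable]: "Measurable.pred (panel_space T) (\<lambda>w. treated w t)" if "t \<in> {1..T}" for t
    by (rule treated_measurable[OF that])
  show ?thesis
    unfolding never_treated_def[abs_def] by measurable
qed

context
  fixes T :: nat
  assumes T: "2 \<le> T"
begin

private lemma period: "1 \<in> {1..T}" "2 \<in> {1..T}"
  using T by auto

lemma outcome_change_measurable: "outcome_change \<in> borel_measurable (panel_space T)"
  unfolding outcome_change_def[abs_def]
  by (intro borel_measurable_diff outcome_measurable period)

lemma annotated_both_measurable: "Measurable.pred (panel_space T) annotated_both"
  unfolding annotated_both_def[abs_def]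
  by (intro pred_intros_logic annotated_measurable period)

lemma covariates_measurable: "covariates \<in> borel_measurable (panel_space T)"
  unfolding covariates_def[abs_def]
  by (intro borel_measurable_Pair covariate_measurable period)

lemma unstructureds_measurable: "unstructureds \<in> borel_measurable (panel_space T)"
  unfolding unstructureds_def[abs_def]
  by (intro borel_measurable_Pair unstructured_measurable period)

lemma features_measurable: "features \<in> borel_measurable (panel_space T)"
  unfolding features_def[abs_def]
  by (intro borel_measurable_Pair covariates_measurable unstructureds_measurable)

end

text \<open>Only observables occur. The potential outcomes enter solely through balance, which here
  is an assumption about \<open>P\<close>.\<close>

locale panel_cohort = cohort P q annotated_both features outcome_change "\<lambda>v. \<pi> (fst v)" \<eta>
  for P :: "('k::finite, 'l::finite) panel measure" and q \<pi> \<eta> +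
  fixes T :: nat
  assumes T: "2 \<le> T" and sets_P: "sets P = sets (panel_space T)"
    and propensity: "is_propensity P \<pi>"
begin

lemma measurable_P: "measurable P N = measurable (panel_space T) N"
  by (rule measurable_cong_sets[OF sets_P refl])

sublocale known_propensity P covariates annotated_both \<pi>
proof
  show "covariates \<in> borel_measurable P"
    unfolding measurable_P by (rule covariates_measurable[OF T])
  show "\<pi> \<in> borel_measurable borel"
    using propensity by (simp add: is_propensity_def)
  show "0 \<le> \<pi> x" "\<pi> x \<le> 1" for x
    using r[of "(x, undefined)"] \<eta> by auto
qed simp

lemma features_eq: "fst (features w) = covariates w"
  by (simp add: features_def)

lemma aipw_eq: "aipw q p \<pi> m w = 1 / p * score_part m w"
  by (simp add: aipw_def score_part_def features_eq)

definition "p = \<P>(w in P. q w)"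

lemma p_pos: "0 < p"
  using q_pos by (simp add: p_def)

text \<open>The inverse propensity form of the estimand. Its right side does not mention
  \<open>m\<close>, so the value is the same for every version of the regression, in particular for
  the one picked by \<open>SOME\<close>.\<close>

lemma integral_q_regression:
  assumes m: "is_regression P (\<lambda>w. q w \<and> annotated_both w) features outcome_change m"
  shows "(\<integral>w. of_bool (q w) * m (features w) \<partial>P) =
    (\<integral>w. of_bool (q w \<and> annotated_both w) * (outcome_change w / \<pi> (covariates w)) \<partial>P)"
proof -
  have [measurable]: "m \<in> borel_measurable borel"
    using m by (simp add: is_regression_def)
  have "(\<integral>w. of_bool (q w) * m (features w) \<partial>P) = (\<integral>w. of_bool (qa w) * (m (features w) / \<pi> (fst (features w))) \<partial>P)"
    using balanced_integral[of "\<lambda>v. m v / \<pi> (fst v)"] r_pos by simp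
  also have "\<dots> = (\<integral>w. of_bool (qa w) * (outcome_change w * (1 / \<pi> (fst (features w)))) \<partial>P)"
  proof -
    have i1: "integrable P (\<lambda>w. of_bool (qa w) * (outcome_change w * (1 / \<pi> (fst (features w)))))"
      by (rule back_subst[where P="integrable P", OF square_integrable_mult[OF square_integrable_qaY square_integrable_qa_div_r]]) auto
    have i2: "integrable P (\<lambda>w. of_bool (qa w) * (m (features w) / \<pi> (fst (features w))))"
      by (rule back_subst[where P="integrable P", OF square_integrable_mult[OF square_integrable_regression_qa[OF m] square_integrable_qa_div_r]]) auto
    have "(\<integral>w. of_bool (qa w) * (outcome_change w * (1 / \<pi> (fst (features w)))) \<partial>P) -
        (\<integral>w. of_bool (qa w) * (m (features w) / \<pi> (fst (features w))) \<partial>P) =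
        (\<integral>w. of_bool (qa w) * ((outcome_change w - m (features w)) * (1 / \<pi> (fst (features w)))) \<partial>P)"
      unfolding Bochner_Integration.integral_diff[OF i1 i2, symmetric]
      by (rule Bochner_Integration.integral_cong) (auto simp: diff_divide_distrib)
    also have "\<dots> = 0"
      by (rule regression_orthogonal_qa[OF m _ square_integrable_qa_div_r]) simp
    finally show ?thesis by simp
  qed
  finally show ?thesis by (simp add: features_eq)
qed

lemma cohort_tangent_space:
  assumes \<psi>: "approximable \<psi>" and \<theta>: "\<theta> = (\<integral>w. \<psi> w \<partial>P)"
  shows "(\<lambda>w. \<psi> w - \<theta>) \<in> tangent_space (known_propensity_model T \<pi>) P"
proof (rule approximable_tangent_space[OF \<psi> \<theta>])
  show "AE w in P. \<pi> (covariates w) = cond_exp_given P covariates borel (\<lambda>w. of_bool (annotated_both w)) w"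
    using propensity by (simp add: is_propensity_def)
qed (use propensity sets_P in \<open>auto simp: known_propensity_model_def is_propensity_def\<close>)

lemma model_member: "P \<in> known_propensity_model T \<pi>"
  using propensity sets_P prob_space_axioms by (simp add: known_propensity_model_def)

text \<open>The change of the estimating function when \<open>m\<close> is replaced by
  \<open>k\<close>: the outcome cancels and only the centred weight is left.\<close>

definition "remainder m k w = of_bool (q w) / p * ((1 - of_bool (annotated_both w) / \<pi> (covariates w)) * (k (features w) - m (features w)))"

lemma aipw_diff: "aipw q p \<pi> k w - aipw q p \<pi> m w = remainder m k w"
  by (simp add: aipw_def remainder_def algebra_simps diff_divide_distrib)

lemma remainder_le: "(remainder m k w)\<^sup>2 \<le> (1 / (p * \<eta>))\<^sup>2 * (k (features w) - m (features w))\<^sup>2"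
proof -
  have "\<bar>1 - of_bool (annotated_both w) / \<pi> (fst (features w))\<bar> \<le> 1 / \<eta>"
    by (rule balanced_bound)
  then have "\<bar>remainder m k w\<bar> \<le> 1 / p * (1 / \<eta> * \<bar>k (features w) - m (features w)\<bar>)"
    unfolding remainder_def abs_mult using p_pos \<eta> by (intro mult_mono) (auto simp: features_eq)
  also have "\<dots> = \<bar>1 / (p * \<eta>) * (k (features w) - m (features w))\<bar>"
    using p_pos \<eta> by (simp add: abs_mult)
  finally show ?thesis
    unfolding power_mult_distrib[symmetric] by (rule abs_le_square_iff[THEN iffD1])
qed

lemma integral_remainder:
  assumes [measurable]: "m \<in> borel_measurable borel" "k \<in> borel_measurable borel"
    and fin: "(\<integral>\<^sup>+w. ennreal ((k (features w) - m (features w))\<^sup>2) \<partial>P) < \<infinity>"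
  shows "integrable P (remainder m k)" "(\<integral>w. remainder m k w \<partial>P) = 0"
proof -
  have "square_integrable P (\<lambda>w. k (features w) - m (features w))"
    using fin unfolding square_integrable_def by (auto intro!: integrableI_bounded)
  then have "square_integrable P (\<lambda>w. of_bool (q w) * (k (features w) - m (features w)))"
    by (rule square_integrable_bounded_mult[where c=1, rotated 2]) auto
  note rem = balanced_remainder[of "\<lambda>v. k v - m v", OF _ this]
  have eq: "remainder m k = (\<lambda>w. 1 / p * (of_bool (q w) * ((1 - of_bool (annotated_both w) / \<pi> (fst (features w))) * (k (features w) - m (features w)))))"
    by (auto simp: remainder_def features_eq fun_eq_iff)
  show "integrable P (remainder m k)" "(\<integral>w. remainder m k w \<partial>P) = 0"
    unfolding eq using rem(1) square_integrable_imp_integrable'[OF rem(2)] by simp_all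
qed

context
  fixes m
  assumes m: "is_regression P (\<lambda>w. q w \<and> annotated_both w) features outcome_change m"
begin

lemma m_measurable: "m \<in> borel_measurable borel"
  using m by (simp add: is_regression_def)

lemma square_integrable_aipw: "square_integrable P (aipw q p \<pi> m)"
  unfolding aipw_eq[abs_def]
  by (intro square_integrable_cmult square_integrable_score_part m_measurable square_integrable_regression_qa[OF m])

lemma integral_aipw: "(\<integral>w. aipw q p \<pi> m w \<partial>P) = (\<integral>w. m (features w) \<partial>given P q)"
proof -
  note [measurable] = m_measurable
  show ?thesis
    unfolding aipw_eq using integral_score_part[OF m] integral_given[OF q_measurable q_pos, of "\<lambda>w. m (features w)"]
    by (simp add: p_def)
qed

lemma approximable_aipw: "approximable (aipw q p \<pi> m)"
proof -
  have "approximable (score_part m)"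
    unfolding approximable_def
  proof (intro conjI allI impI)
    show "square_integrable P (score_part m)"
      by (intro square_integrable_score_part m_measurable square_integrable_regression_qa[OF m])
    fix e :: real assume "0 < e"
    from bounded_approximation[OF m this] obtain h where
      h: "h \<in> borel_measurable P" "\<exists>c. \<forall>w\<in>space P. \<bar>h w\<bar> \<le> c" "(\<integral>w. (score_part m w - h w)\<^sup>2 \<partial>P) < e"
      and h0: "\<And>D. D \<in> sets borel \<Longrightarrow>
        (\<integral>w. indicator D (features w) * (of_bool (annotated_both w) - \<pi> (fst (features w))) * h w \<partial>P) = 0"
      by blast
    have "(\<integral>w. indicator B (covariates w) * residual w * h w \<partial>P) = 0" if "B \<in> sets borel" for B
    proof -
      \<comment> \<open>The approximation satisfies the constraint given all features; the model
        asks for it given the covariates only, so cylinder sets suffice.\<close>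
      have "fst -` B \<inter> space borel \<in> sets (borel :: ('k, 'l) features measure)"
        by (rule measurable_sets[OF borel_measurable_continuous_onI[OF continuous_on_fst[OF continuous_on_id]] that])
      from h0[OF this] show ?thesis
        by (simp add: features_eq indicator_def)
    qed
    with h show "\<exists>h\<in>bounded_scores. (\<integral>w. (score_part m w - h w)\<^sup>2 \<partial>P) < e"
      unfolding bounded_scores_def by blast
  qed
  from approximable_cmult[OF this, of "1 / p"] show ?thesis
    unfolding aipw_eq[abs_def] .
qed

text \<open>\<open>pathwise_derivative\<close> accepts arbitrary versions under \<open>Q t\<close>,
  hence also the chosen ones. The constant \<theta> may be subtracted because scores have mean
  0.\<close>

lemma cohort_functional_derivative:
  assumes Q: "regular_submodel (known_propensity_model T \<pi>) P Q h"
  shows "((\<lambda>t. (cohort_functional q p (Q t) - cohort_functional q p P) / t) \<longlongrightarrow>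
      (\<integral>w. (aipw q p \<pi> m w - \<theta>) * h w \<partial>P)) (at_right 0)"
proof -
  let ?m = "\<lambda>N. SOME m. is_regression N (\<lambda>w. qa w) features outcome_change m"
  from Q obtain \<epsilon> K f where \<epsilon>: "0 < \<epsilon>" and K: "0 < K"
    and f: "\<forall>t\<in>{0<..<\<epsilon>}. Q t \<in> known_propensity_model T \<pi> \<and> f t \<in> borel_measurable P \<and>
        (\<forall>w\<in>space P. 1 / K \<le> f t w \<and> f t w \<le> K) \<and> Q t = density P (\<lambda>w. ennreal (f t w))"
    and dqm: "((\<lambda>t. \<integral>w. ((sqrt (f t w) - 1) / t - h w / 2)\<^sup>2 \<partial>P) \<longlongrightarrow> 0) (at_right 0)"
    and h: "square_integrable P h"
    unfolding regular_submodel_def by blast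
  have prob_Q: "prob_space (Q t)" if "t \<in> {0<..<\<epsilon>}" for t
    using f that unfolding known_propensity_model_def by blast
  have reg: "is_regression N (\<lambda>w. qa w) features outcome_change (?m N)" if "prob_space N" for N
    by (rule someI_ex[OF prob_space.regression_exists[OF that]])
  have f': "f t \<in> borel_measurable P" "Q t = density P (\<lambda>w. ennreal (f t w))"
    and bounds: "w \<in> space P \<Longrightarrow> 1 / K \<le> f t w \<and> f t w \<le> K"
    if "t \<in> {0<..<\<epsilon>}" for t w
    using f that by blast+
  note der = pathwise_derivative[OF \<epsilon> K f'(1) bounds h dqm f'(2) prob_Q m reg[OF prob_Q]]
  have h0: "(\<integral>w. h w \<partial>P) = 0"
    by (rule der(2))
  \<comment> \<open>Exchanges the version chosen under \<open>P\<close> for the given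
    \<open>m\<close>, through the formula free of \<open>m\<close>.\<close>
  have P: "(\<integral>w. of_bool (q w) * ?m P (features w) \<partial>P) = (\<integral>w. of_bool (q w) * m (features w) \<partial>P)"
    using integral_q_regression[OF m] integral_q_regression[OF reg[OF prob_space_axioms]] by simp
  have "(\<integral>w. (aipw q p \<pi> m w - \<theta>) * h w \<partial>P) = (\<integral>w. 1 / p * (h w * score_part m w) - \<theta> * h w \<partial>P)"
    by (rule Bochner_Integration.integral_cong) (auto simp: aipw_eq algebra_simps)
  also have "\<dots> = 1 / p * (\<integral>w. h w * score_part m w \<partial>P)"
  proof -
    have "integrable P (\<lambda>w. h w * score_part m w)"
      by (intro square_integrable_mult[OF h] square_integrable_score_part m_measurable square_integrable_regression_qa[OF m])
    then show ?thesis
      using square_integrable_imp_integrable'[OF h] h0 by simp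
  qed
  finally have eq: "(\<integral>w. (aipw q p \<pi> m w - \<theta>) * h w \<partial>P) = 1 / p * (\<integral>w. h w * score_part m w \<partial>P)" .
  have quot: "(cohort_functional q p (Q t) - cohort_functional q p P) / t =
      1 / p * (((\<integral>w. of_bool (q w) * ?m (Q t) (features w) \<partial>Q t) - (\<integral>w. of_bool (q w) * m (features w) \<partial>P)) / t)" for t
    unfolding cohort_functional_def P by (simp add: diff_divide_distrib mult.commute)
  show ?thesis
    unfolding eq quot by (intro tendsto_mult_left der(1))
qed

lemma efficient_influence_function_cohort:
  assumes "\<theta> = (\<integral>w. m (features w) \<partial>given P q)"
  shows "efficient_influence_function (known_propensity_model T \<pi>) P (cohort_functional q p)
    (\<lambda>w. aipw q p \<pi> m w - \<theta>)"
  unfolding efficient_influence_function_def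
  using model_member cohort_tangent_space[OF approximable_aipw] cohort_functional_derivative
  by (simp add: assms integral_aipw)

end

end

text \<open>A single unit. \<open>Ms\<close> stands for its ground truth change, tied to the data by
  \<open>observed\<close> and the two independence assumptions, so nothing here refers to potential
  outcomes.\<close>

locale annotated_sample = prob_space \<Omega> for \<Omega> :: "'w measure" +
  fixes W :: "'w \<Rightarrow> ('k::finite, 'l::finite) panel" and Ms :: "'w \<Rightarrow> real"
    and P :: "('k, 'l) panel measure" and T :: nat and \<pi> \<eta>
  assumes T: "2 \<le> T" and W: "W \<in> measurable \<Omega> (panel_space T)"
    and law: "distr \<Omega> (panel_space T) W = P"
    and Ms [measurable]: "Ms \<in> borel_measurable \<Omega>"
    and observed: "AE \<omega> in \<Omega>. annotated_both (W \<omega>) \<longrightarrow> outcome_change (W \<omega>) = Ms \<omega>"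
    and cohort_indep: "cond_indep \<Omega>
          (\<lambda>\<omega>. (never_treated T (W \<omega>), first_treated 2 (W \<omega>))) (count_space UNIV)
          (\<lambda>\<omega>. annotated_both (W \<omega>)) (count_space UNIV)
          (\<lambda>\<omega>. (covariates (W \<omega>), unstructureds (W \<omega>), Ms \<omega>)) borel"
    and annotation_indep: "cond_indep \<Omega>
          (\<lambda>\<omega>. (unstructureds (W \<omega>), Ms \<omega>)) borel
          (\<lambda>\<omega>. annotated_both (W \<omega>)) (count_space UNIV)
          (\<lambda>\<omega>. covariates (W \<omega>)) borel"
    and \<eta>: "0 < \<eta>" and propensity: "is_propensity P \<pi>" and \<pi>_bounds: "\<And>x. \<pi> x \<in> {\<eta>..1}"
begin

lemma sets_P: "sets P = sets (panel_space T)" and space_P: "space P = space (panel_space T)"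
  unfolding law[symmetric] by simp_all

lemma measurable_P: "measurable P N = measurable (panel_space T) N"
  by (rule measurable_cong_sets[OF sets_P refl])

lemma prob_P: "prob_space P"
  unfolding law[symmetric] by (rule prob_space_distr[OF W])

lemma integral_W: "f \<in> borel_measurable (panel_space T) \<Longrightarrow> (\<integral>w. f w \<partial>P) = (\<integral>\<omega>. f (W \<omega>) \<partial>\<Omega>)"
  for f :: "('k, 'l) panel \<Rightarrow> real"
  unfolding law[symmetric] by (rule integral_distr[OF W])

lemma W_measurable [measurable]:
  "Measurable.pred \<Omega> (\<lambda>\<omega>. first_treated 2 (W \<omega>))"
  "Measurable.pred \<Omega> (\<lambda>\<omega>. never_treated T (W \<omega>))"
  "Measurable.pred \<Omega> (\<lambda>\<omega>. annotated_both (W \<omega>))"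
  "(\<lambda>\<omega>. covariates (W \<omega>)) \<in> borel_measurable \<Omega>"
  "(\<lambda>\<omega>. unstructureds (W \<omega>)) \<in> borel_measurable \<Omega>"
  "(\<lambda>\<omega>. features (W \<omega>)) \<in> borel_measurable \<Omega>"
  "(\<lambda>\<omega>. outcome_change (W \<omega>)) \<in> borel_measurable \<Omega>"
  using T by (auto intro!: measurable_compose[OF W] first_treated_measurable never_treated_measurable
      annotated_both_measurable covariates_measurable unstructureds_measurable features_measurable
      outcome_change_measurable)

lemma \<pi>_measurable [measurable]: "\<pi> \<in> borel_measurable borel"
  using propensity by (simp add: is_propensity_def)

lemma \<pi>_le: "\<eta> \<le> \<pi> x" "\<pi> x \<le> 1" "0 \<le> \<pi> x" "0 < \<pi> x"
  using \<pi>_bounds[of x] \<eta> by auto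

text \<open>The two conditional expectations live on different spaces, but their moment
  characterisations are integrals of functions of W and transfer through the image measure.\<close>

lemma AE_propensity:
  "AE \<omega> in \<Omega>. \<pi> (covariates (W \<omega>)) =
    cond_exp_given \<Omega> (\<lambda>\<omega>. covariates (W \<omega>)) borel (\<lambda>\<omega>. of_bool (annotated_both (W \<omega>))) \<omega>"
proof -
  interpret P: prob_space P by (rule prob_P)
  interpret P: known_propensity P covariates annotated_both \<pi>
    using \<pi>_le T by unfold_locales
      (simp_all add: measurable_P covariates_measurable annotated_both_measurable)
  interpret \<Omega>: known_propensity \<Omega> "\<lambda>\<omega>. covariates (W \<omega>)" "\<lambda>\<omega>. annotated_both (W \<omega>)" \<pi>
    using \<pi>_le by unfold_locales auto
  show ?thesis
    unfolding \<Omega>.AE_propensity_iff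
  proof
    fix B :: "((real ^ 'k) \<times> (real ^ 'k)) set" assume [measurable]: "B \<in> sets borel"
    note [measurable] = covariates_measurable[OF T] annotated_both_measurable[OF T]
    have "(\<integral>\<omega>. indicator B (covariates (W \<omega>)) * \<Omega>.residual \<omega> \<partial>\<Omega>) = (\<integral>w. indicator B (covariates w) * P.residual w \<partial>P)"
      by (rule integral_W[symmetric]) measurable
    also have "\<dots> = 0"
      using propensity P.AE_propensity_iff \<open>B \<in> sets borel\<close> unfolding is_propensity_def by blast
    finally show "(\<integral>\<omega>. indicator B (covariates (W \<omega>)) * \<Omega>.residual \<omega> \<partial>\<Omega>) = 0" .
  qed
qed

context
  fixes q :: "('k, 'l) panel \<Rightarrow> bool" and S :: "(bool \<times> bool) set"
  assumes q: "\<And>w. q w \<longleftrightarrow> (never_treated T w, first_treated 2 w) \<in> S"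
    and q_pos: "\<P>(w in P. q w) > 0"
    and second_moment: "integrable \<Omega> (\<lambda>\<omega>. of_bool (q (W \<omega>)) * (Ms \<omega>)\<^sup>2)"
begin

lemma cohorts_measurable:
  "(\<lambda>w. (never_treated T w, first_treated 2 w)) \<in> measurable (panel_space T) (count_space UNIV)"
proof -
  have "(\<lambda>w. (never_treated T w, first_treated 2 w)) \<in>
      measurable (panel_space T) (count_space UNIV \<Otimes>\<^sub>M count_space UNIV)"
    using T by (intro measurable_Pair never_treated_measurable first_treated_measurable) auto
  then show ?thesis
    by (simp add: pair_measure_countable)
qed

lemma q_measurable: "Measurable.pred (panel_space T) q"
  unfolding q[abs_def] by (rule measurable_compose[OF cohorts_measurable]) simp

text \<open>\<open>q\<close> is read off the pair of cohort indicators through the set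
  \<open>S\<close>, so the joint independence of that pair serves both cohorts at once.\<close>

lemma cohort_balanced:
  assumes D: "D \<in> sets borel"
  shows "(\<integral>\<omega>. of_bool (q (W \<omega>) \<and> annotated_both (W \<omega>)) * indicator D (covariates (W \<omega>), unstructureds (W \<omega>), Ms \<omega>) \<partial>\<Omega>) =
    (\<integral>\<omega>. of_bool (q (W \<omega>)) * \<pi> (covariates (W \<omega>)) * indicator D (covariates (W \<omega>), unstructureds (W \<omega>), Ms \<omega>) \<partial>\<Omega>)"
proof -
  have C: "(\<lambda>\<omega>. (never_treated T (W \<omega>), first_treated 2 (W \<omega>))) \<in> measurable \<Omega> (count_space UNIV)"
    by (rule measurable_compose[OF W cohorts_measurable])
  have U: "(\<lambda>\<omega>. (unstructureds (W \<omega>), Ms \<omega>)) \<in> borel_measurable \<Omega>"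
    by (intro borel_measurable_Pair W_measurable Ms)
  have eq: "of_bool (q (W \<omega>)) = (indicator S (never_treated T (W \<omega>), first_treated 2 (W \<omega>)) :: real)" for \<omega>
    by (simp add: q indicator_def)
  have "S \<in> sets (count_space UNIV)" by simp
  from cond_indep_chain_balanced[OF W_measurable(4) U C W_measurable(3) \<pi>_measurable \<pi>_le(3,2)
      cohort_indep annotation_indep AE_propensity D this]
  show ?thesis
    unfolding of_bool_conj eq by (simp add: ac_simps)
qed

text \<open>Balance holds given features and \<open>Ms\<close> together; sets that do not constrain
  \<open>Ms\<close> yield balance given the features. The second moment is inherited because outcome
  change and \<open>Ms\<close> agree on annotated units.\<close>

lemma panel_cohort: "panel_cohort P q \<pi> \<eta> T"
proof -
  interpret P: prob_space P by (rule prob_P)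
  note [measurable] = features_measurable[OF T] covariates_measurable[OF T]
    annotated_both_measurable[OF T] outcome_change_measurable[OF T] q_measurable
  have [measurable]: "(\<lambda>v :: ('k, 'l) features. \<pi> (fst v)) \<in> borel_measurable borel"
    by (rule measurable_compose[OF borel_measurable_continuous_onI[OF continuous_on_fst[OF continuous_on_id]] \<pi>_measurable])
  have fst_features: "fst (features w) = covariates w" for w :: "('k, 'l) panel"
    by (simp add: features_def)
  have Y2: "integrable P (\<lambda>w. of_bool (q w \<and> annotated_both w) * (outcome_change w)\<^sup>2)"
    unfolding law[symmetric]
  proof (subst integrable_distr_eq[OF W])
    have [measurable]: "Measurable.pred \<Omega> (\<lambda>\<omega>. q (W \<omega>))"
      by (rule measurable_compose[OF W q_measurable])
    show "integrable \<Omega> (\<lambda>\<omega>. of_bool (q (W \<omega>) \<and> annotated_both (W \<omega>)) * (outcome_change (W \<omega>))\<^sup>2)"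
    proof (rule Bochner_Integration.integrable_bound[OF second_moment])
      show "AE \<omega> in \<Omega>. norm (of_bool (q (W \<omega>) \<and> annotated_both (W \<omega>)) * (outcome_change (W \<omega>))\<^sup>2) \<le>
          norm (of_bool (q (W \<omega>)) * (Ms \<omega>)\<^sup>2)"
        using observed by eventually_elim auto
    qed measurable
  qed measurable
  have balanced: "(\<integral>w. of_bool (q w \<and> annotated_both w) * indicator D (features w) \<partial>P) =
      (\<integral>w. of_bool (q w) * \<pi> (fst (features w)) * indicator D (features w) \<partial>P)"
    if [measurable]: "D \<in> sets borel" for D
  proof -
    \<comment> \<open>The cylinder over D, leaving the \<open>Ms\<close> coordinate free.\<close>
    define D' where "D' = (\<lambda>z :: ((real ^ 'k) \<times> (real ^ 'k)) \<times> ((real ^ 'l) \<times> (real ^ 'l)) \<times> real. (fst z, fst (snd z))) -` D \<inter> space borel"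
    have D': "D' \<in> sets borel"
      unfolding D'_def
      by (rule measurable_sets[OF borel_measurable_continuous_onI that]) (intro continuous_intros)
    have ind: "indicator D' (covariates w, unstructureds w, m) = (indicator D (features w) :: real)" for w m
      by (simp add: D'_def features_def indicator_def)
    have 1: "(\<lambda>w. of_bool (q w \<and> annotated_both w) * indicator D (features w) :: real) \<in> borel_measurable (panel_space T)"
      by measurable
    have 2: "(\<lambda>w. of_bool (q w) * \<pi> (covariates w) * indicator D (features w) :: real) \<in> borel_measurable (panel_space T)"
      by measurable
    show ?thesis
      unfolding fst_features integral_W[OF 1] integral_W[OF 2]
      using cohort_balanced[OF D'] unfolding ind .
  qed
  show ?thesis
  proof unfold_locales
    show "Measurable.pred P q" "Measurable.pred P annotated_both" "features \<in> borel_measurable P"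
      "outcome_change \<in> borel_measurable P"
      unfolding measurable_P by measurable
  qed (use \<eta> \<pi>_le q_pos Y2 balanced T sets_P propensity in auto)
qed

lemma prob_cohort: "prob {\<omega> \<in> space \<Omega>. q (W \<omega>)} = \<P>(w in P. q w)"
proof -
  have "\<P>(w in P. q w) = prob (W -` {w \<in> space P. q w} \<inter> space \<Omega>)"
    unfolding law[symmetric] using q_measurable by (intro measure_distr[OF W]) simp
  also have "W -` {w \<in> space P. q w} \<inter> space \<Omega> = {\<omega> \<in> space \<Omega>. q (W \<omega>)}"
    using measurable_space[OF W] by (auto simp: space_P)
  finally show ?thesis by simp
qed

text \<open>\<open>cohort\<close> is instantiated again, now on \<Omega> with \<open>Ms\<close>
  included in the conditioning variable: Ms / \<pi>(X) is then a function of that variable, and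
  reweighting applies to it directly.\<close>

lemma integral_ground_truth:
  "(\<integral>\<omega>. of_bool (q (W \<omega>)) * Ms \<omega> \<partial>\<Omega>) =
    (\<integral>w. of_bool (q w \<and> annotated_both w) * (outcome_change w / \<pi> (covariates w)) \<partial>P)"
proof -
  note [measurable] = features_measurable[OF T] covariates_measurable[OF T]
    annotated_both_measurable[OF T] outcome_change_measurable[OF T] q_measurable
  have [measurable]: "Measurable.pred \<Omega> (\<lambda>\<omega>. q (W \<omega>))"
    by (rule measurable_compose[OF W q_measurable])
  have fst_borel [measurable]: "(\<lambda>v :: ((real ^ 'k) \<times> (real ^ 'k)) \<times> ((real ^ 'l) \<times> (real ^ 'l)) \<times> real. \<pi> (fst v)) \<in> borel_measurable borel"
    by (rule measurable_compose[OF borel_measurable_continuous_onI[OF continuous_on_fst[OF continuous_on_id]] \<pi>_measurable])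
  have snd_borel [measurable]: "(\<lambda>v :: ((real ^ 'k) \<times> (real ^ 'k)) \<times> ((real ^ 'l) \<times> (real ^ 'l)) \<times> real. snd (snd v)) \<in> borel_measurable borel"
    by (intro borel_measurable_continuous_onI continuous_intros)
  let ?Z = "\<lambda>\<omega>. (covariates (W \<omega>), unstructureds (W \<omega>), Ms \<omega>)"
  interpret Z: cohort \<Omega> "\<lambda>\<omega>. q (W \<omega>)" "\<lambda>\<omega>. annotated_both (W \<omega>)" ?Z Ms "\<lambda>v. \<pi> (fst v)" \<eta>
  proof unfold_locales
    show "?Z \<in> borel_measurable \<Omega>"
      by (intro borel_measurable_Pair W_measurable Ms)
    show "prob {\<omega> \<in> space \<Omega>. q (W \<omega>)} > 0"
      using q_pos by (simp add: prob_cohort)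
    show "integrable \<Omega> (\<lambda>\<omega>. of_bool (q (W \<omega>) \<and> annotated_both (W \<omega>)) * (Ms \<omega>)\<^sup>2)"
      by (rule Bochner_Integration.integrable_bound[OF second_moment]) auto
    show "(\<integral>\<omega>. of_bool (q (W \<omega>) \<and> annotated_both (W \<omega>)) * indicator D (?Z \<omega>) \<partial>\<Omega>) =
        (\<integral>\<omega>. of_bool (q (W \<omega>)) * \<pi> (fst (?Z \<omega>)) * indicator D (?Z \<omega>) \<partial>\<Omega>)"
      if "D \<in> sets borel" for D
      using cohort_balanced[OF that] by simp
  qed (use \<eta> \<pi>_le in auto)
  have "(\<integral>\<omega>. of_bool (q (W \<omega>)) * Ms \<omega> \<partial>\<Omega>) =
      (\<integral>\<omega>. of_bool (q (W \<omega>) \<and> annotated_both (W \<omega>)) * (Ms \<omega> / \<pi> (covariates (W \<omega>))) \<partial>\<Omega>)"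
    using Z.balanced_integral[of "\<lambda>v. snd (snd v) / \<pi> (fst v)"] \<pi>_le(4) by (simp add: less_imp_neq[symmetric])
  also have "\<dots> = (\<integral>\<omega>. of_bool (q (W \<omega>) \<and> annotated_both (W \<omega>)) * (outcome_change (W \<omega>) / \<pi> (covariates (W \<omega>))) \<partial>\<Omega>)"
  proof (rule integral_cong_AE)
    show "AE \<omega> in \<Omega>. of_bool (q (W \<omega>) \<and> annotated_both (W \<omega>)) * (Ms \<omega> / \<pi> (covariates (W \<omega>))) =
        of_bool (q (W \<omega>) \<and> annotated_both (W \<omega>)) * (outcome_change (W \<omega>) / \<pi> (covariates (W \<omega>)))"
      using observed by eventually_elim auto
  qed measurable
  also have "\<dots> = (\<integral>w. of_bool (q w \<and> annotated_both w) * (outcome_change w / \<pi> (covariates w)) \<partial>P)"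
    by (rule integral_W[symmetric]) measurable
  finally show ?thesis .
qed

lemma integral_regression_ground_truth:
  assumes m: "is_regression P (\<lambda>w. q w \<and> annotated_both w) features outcome_change m"
  shows "(\<integral>w. m (features w) \<partial>given P q) = (\<integral>\<omega>. Ms \<omega> \<partial>given \<Omega> (\<lambda>\<omega>. q (W \<omega>)))"
proof -
  interpret P: panel_cohort P q \<pi> \<eta> T by (rule panel_cohort)
  have [measurable]: "Measurable.pred \<Omega> (\<lambda>\<omega>. q (W \<omega>))"
    by (rule measurable_compose[OF W q_measurable])
  have [measurable]: "m \<in> borel_measurable borel"
    using m by (simp add: is_regression_def)
  have "(\<integral>w. m (features w) \<partial>given P q) = (\<integral>w. of_bool (q w) * m (features w) \<partial>P) / \<P>(w in P. q w)"
    by (rule P.integral_given[OF P.q_measurable P.q_pos]) measurable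
  also have "\<dots> = (\<integral>\<omega>. of_bool (q (W \<omega>)) * Ms \<omega> \<partial>\<Omega>) / prob {\<omega> \<in> space \<Omega>. q (W \<omega>)}"
    unfolding P.integral_q_regression[OF m] integral_ground_truth prob_cohort ..
  also have "\<dots> = (\<integral>\<omega>. Ms \<omega> \<partial>given \<Omega> (\<lambda>\<omega>. q (W \<omega>)))"
    by (rule integral_given[symmetric]) (use q_pos prob_cohort in auto)
  finally show ?thesis .
qed

end

end

context prob_space
begin

text \<open>\<open>g\<close> is the effect of the estimation error on one summand. Normalising by
  the square root of the sample size cancels the factor \<open>card (I n)\<close> in the second
  moment, so the remainder is bounded by the integrated \<open>b\<close> alone.\<close>

lemma sample_split_weak_conv:
  fixes S :: "'s measure" and W :: "nat \<Rightarrow> 'a \<Rightarrow> 's" and P :: "'s measure"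
    and g :: "nat \<Rightarrow> (nat \<Rightarrow> 's) \<Rightarrow> 's \<Rightarrow> real" and b :: "nat \<Rightarrow> (nat \<Rightarrow> 's) \<Rightarrow> 's \<Rightarrow> ennreal"
  assumes indep: "indep_vars (\<lambda>_. S) W UNIV" and law: "\<And>i. distr M S (W i) = P"
    and \<phi> [measurable]: "\<phi> \<in> borel_measurable S" and sq: "square_integrable P \<phi>" and mean: "(\<integral>w. \<phi> w \<partial>P) = 0"
    and split: "\<And>n. finite (I n)" "\<And>n. finite (I' n)" "\<And>n. I n \<inter> I' n = {}"
    and card: "filterlim (\<lambda>n. card (I n)) at_top sequentially"
    and g: "\<And>n. case_prod (g n) \<in> borel_measurable ((\<Pi>\<^sub>M j\<in>I' n. S) \<Otimes>\<^sub>M S)"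
    and b: "\<And>n. case_prod (b n) \<in> borel_measurable ((\<Pi>\<^sub>M j\<in>I' n. S) \<Otimes>\<^sub>M S)"
    and le: "\<And>n d w. ennreal ((g n d w)\<^sup>2) \<le> b n d w"
    and g_mean: "\<And>n d. d \<in> space (\<Pi>\<^sub>M j\<in>I' n. S) \<Longrightarrow> (\<integral>\<^sup>+w. b n d w \<partial>P) < \<infinity> \<Longrightarrow> (\<integral>w. g n d w \<partial>P) = 0"
    and lim: "(\<lambda>n. \<integral>\<^sup>+\<omega>. \<integral>\<^sup>+w. b n (\<lambda>j\<in>I' n. W j \<omega>) w \<partial>P \<partial>M) \<longlonglongrightarrow> 0"
    and Z: "\<And>n \<omega>. Z n \<omega> = (\<Sum>i\<in>I n. \<phi> (W i \<omega>) + g n (\<lambda>j\<in>I' n. W j \<omega>) (W i \<omega>)) / sqrt (real (card (I n)))"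
  shows "weak_conv_m (\<lambda>n. distr M borel (Z n)) (normal_law 0 (\<integral>w. (\<phi> w)\<^sup>2 \<partial>P))"
proof (rule asymptotically_linear_weak_conv[OF indep law \<phi> sq mean card])
  have W [measurable]: "W i \<in> measurable M S" for i
    using indep by (simp add: indep_vars_def)
  have D: "(\<lambda>\<omega>. \<lambda>j\<in>I' n. W j \<omega>) \<in> measurable M (\<Pi>\<^sub>M j\<in>I' n. S)" for n
    by (intro measurable_restrict W)
  have gW [measurable]: "(\<lambda>\<omega>. g n (\<lambda>j\<in>I' n. W j \<omega>) (W i \<omega>)) \<in> borel_measurable M" for n i
    using measurable_compose[OF measurable_Pair[OF D W] g[of n]] unfolding case_prod_conv .
  show "Z n \<in> borel_measurable M" for n
    unfolding Z[abs_def] by measurable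
  let ?R = "\<lambda>n. \<integral>\<^sup>+\<omega>. ennreal ((Z n \<omega> - (\<Sum>i\<in>I n. \<phi> (W i \<omega>)) / sqrt (real (card (I n))))\<^sup>2) \<partial>M"
  let ?B = "\<lambda>n. \<integral>\<^sup>+\<omega>. \<integral>\<^sup>+w. b n (\<lambda>j\<in>I' n. W j \<omega>) w \<partial>P \<partial>M"
  have "?R n \<le> ?B n" for n
  proof -
    let ?c = "real (card (I n))"
    have "?R n = (\<integral>\<^sup>+\<omega>. ennreal (1 / ?c) * ennreal ((\<Sum>i\<in>I n. g n (\<lambda>j\<in>I' n. W j \<omega>) (W i \<omega>))\<^sup>2) \<partial>M)"
    proof (rule nn_integral_cong)
      fix \<omega>
      have "Z n \<omega> - (\<Sum>i\<in>I n. \<phi> (W i \<omega>)) / sqrt ?c = (\<Sum>i\<in>I n. g n (\<lambda>j\<in>I' n. W j \<omega>) (W i \<omega>)) / sqrt ?c"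
        by (simp add: Z sum.distrib add_divide_distrib)
      then show "ennreal ((Z n \<omega> - (\<Sum>i\<in>I n. \<phi> (W i \<omega>)) / sqrt ?c)\<^sup>2) =
          ennreal (1 / ?c) * ennreal ((\<Sum>i\<in>I n. g n (\<lambda>j\<in>I' n. W j \<omega>) (W i \<omega>))\<^sup>2)"
        by (simp add: power_divide ennreal_mult[symmetric])
    qed
    also have "\<dots> = ennreal (1 / ?c) * (\<integral>\<^sup>+\<omega>. ennreal ((\<Sum>i\<in>I n. g n (\<lambda>j\<in>I' n. W j \<omega>) (W i \<omega>))\<^sup>2) \<partial>M)"
      by (rule nn_integral_cmult) measurable
    also have "\<dots> \<le> ennreal (1 / ?c) * (of_nat (card (I n)) * ?B n)"
      by (intro mult_left_mono second_moment_sample_split[OF indep law split g b le g_mean]) auto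
    also have "\<dots> = ennreal (1 / ?c * ?c) * ?B n"
      by (simp only: ennreal_mult of_nat_0_le_iff zero_le_divide_1_iff ennreal_of_nat_eq_real_of_nat mult.assoc)
    \<comment> \<open>Not an equality: for an empty \<open>I n\<close> the product 1 / c times c is
      0.\<close>
    also have "\<dots> \<le> 1 * ?B n"
      by (intro mult_right_mono) (auto simp: divide_simps)
    finally show ?thesis by simp
  qed
  then show "?R \<longlonglongrightarrow> 0"
    by (intro tendsto_sandwich[OF _ _ tendsto_const lim]) auto
qed

end

lemma aipw_measurable:
  fixes q :: "('k::finite, 'l::finite) panel \<Rightarrow> bool"
  assumes T: "2 \<le> T" and q: "Measurable.pred (panel_space T) q" and \<pi>: "\<pi> \<in> borel_measurable borel"
    and k: "case_prod k \<in> borel_measurable (N \<Otimes>\<^sub>M borel)"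
    and d: "d \<in> measurable \<Omega> N" and W: "W \<in> measurable \<Omega> (panel_space T)"
  shows "(\<lambda>\<omega>. aipw q p \<pi> (k (d \<omega>)) (W \<omega>)) \<in> borel_measurable \<Omega>"
proof -
  have "(\<lambda>\<omega>. case_prod k (d \<omega>, features (W \<omega>))) \<in> borel_measurable \<Omega>"
    by (intro measurable_compose[OF measurable_Pair k] d measurable_compose[OF W features_measurable[OF T]])
  then have [measurable]: "(\<lambda>\<omega>. k (d \<omega>) (features (W \<omega>))) \<in> borel_measurable \<Omega>"
    unfolding case_prod_conv .
  note [measurable] = measurable_compose[OF W q] \<pi> measurable_compose[OF W annotated_both_measurable[OF T]]
    measurable_compose[OF W covariates_measurable[OF T]] measurable_compose[OF W outcome_change_measurable[OF T]]
  show ?thesis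
    unfolding aipw_def by measurable
qed

theorem proposition6:
  fixes \<Omega> :: "'w measure"
    and T :: nat
    and P :: "('k::finite, 'l::finite) panel measure"
    and W :: "nat \<Rightarrow> 'w \<Rightarrow> ('k, 'l) panel"
    and Y :: "nat \<Rightarrow> 'w \<Rightarrow> nat \<Rightarrow> nat \<Rightarrow> real"
    and \<pi> :: "(real ^ 'k) \<times> (real ^ 'k) \<Rightarrow> real"
    and \<mu>G \<mu>C :: "('k, 'l) features \<Rightarrow> real"
    and I I' :: "nat \<Rightarrow> nat set"
    and \<mu>hatG \<mu>hatC :: "nat \<Rightarrow> (nat \<Rightarrow> ('k, 'l) panel) \<Rightarrow> ('k, 'l) features \<Rightarrow> real"
    and \<eta> \<theta> pG pC \<theta>G \<theta>C :: real
    and \<phi>G \<phi>C \<phi> :: "('k, 'l) panel \<Rightarrow> real"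
    and Mstar :: "nat \<Rightarrow> 'w \<Rightarrow> real"
    and \<theta>hatG \<theta>hatC \<theta>hat :: "nat \<Rightarrow> 'w \<Rightarrow> real"
  defines "Mstar \<equiv> \<lambda>i \<omega>. ground_truth_change T (W i \<omega>) (Y i \<omega>)"
    and "pG \<equiv> \<P>(w in P. first_treated 2 w)"
    and "pC \<equiv> \<P>(w in P. never_treated T w)"
    and "\<theta>G \<equiv> (\<integral>w. \<mu>G (features w) \<partial>given P (first_treated 2))"
    and "\<theta>C \<equiv> (\<integral>w. \<mu>C (features w) \<partial>given P (never_treated T))"
    and "\<phi>G \<equiv> \<lambda>w. aipw (first_treated 2) pG \<pi> \<mu>G w - \<theta>G"
    and "\<phi>C \<equiv> \<lambda>w. aipw (never_treated T) pC \<pi> \<mu>C w - \<theta>C"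
    and "\<phi> \<equiv> \<lambda>w. \<phi>G w - \<phi>C w"
    and "\<theta>hatG \<equiv> \<lambda>n \<omega>. 1 / real (card (I n)) *
          (\<Sum>i\<in>I n. aipw (first_treated 2) pG \<pi> (\<mu>hatG n (\<lambda>j\<in>I' n. W j \<omega>)) (W i \<omega>))"
    and "\<theta>hatC \<equiv> \<lambda>n \<omega>. 1 / real (card (I n)) *
          (\<Sum>i\<in>I n. aipw (never_treated T) pC \<pi> (\<mu>hatC n (\<lambda>j\<in>I' n. W j \<omega>)) (W i \<omega>))"
    and "\<theta>hat \<equiv> \<lambda>n \<omega>. \<theta>hatG n \<omega> - \<theta>hatC n \<omega>"
  assumes prob: "prob_space \<Omega>"
    and T: "2 \<le> T"
    \<comment> \<open>i.i.d. units with law \<open>P\<close>, and their potential outcomes\<close>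
    and indep: "prob_space.indep_vars \<Omega> (\<lambda>_. panel_space T) W UNIV"
    and law: "\<And>i. distr \<Omega> (panel_space T) (W i) = P"
    and Y_measurable: "\<And>i g t. g \<in> insert 0 {2..T} \<Longrightarrow> t \<in> {1..T} \<Longrightarrow>
          (\<lambda>\<omega>. Y i \<omega> g t) \<in> borel_measurable \<Omega>"
    and pG_pos: "pG > 0" and pC_pos: "pC > 0"
    and untreated_at_1: "\<And>i. AE \<omega> in \<Omega>. \<not> treated (W i \<omega>) 1"
    and irreversible: "\<And>i. AE \<omega> in \<Omega>. \<forall>t\<in>{1..<T}.
          treated (W i \<omega>) t \<longrightarrow> treated (W i \<omega>) (t + 1)"
    and na_integrable:
      "\<And>i. integrable (given \<Omega> (\<lambda>\<omega>. first_treated 2 (W i \<omega>))) (\<lambda>\<omega>. Y i \<omega> 2 1)"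
      "\<And>i. integrable (given \<Omega> (\<lambda>\<omega>. first_treated 2 (W i \<omega>))) (\<lambda>\<omega>. Y i \<omega> 0 1)"
    and no_anticipation: "\<And>i.
          (\<integral>\<omega>. Y i \<omega> 2 1 \<partial>given \<Omega> (\<lambda>\<omega>. first_treated 2 (W i \<omega>))) =
          (\<integral>\<omega>. Y i \<omega> 0 1 \<partial>given \<Omega> (\<lambda>\<omega>. first_treated 2 (W i \<omega>)))"
    and pt_integrable:
      "\<And>i. integrable (given \<Omega> (\<lambda>\<omega>. first_treated 2 (W i \<omega>))) (\<lambda>\<omega>. Y i \<omega> 0 2 - Y i \<omega> 0 1)"
      "\<And>i. integrable (given \<Omega> (\<lambda>\<omega>. never_treated T (W i \<omega>))) (\<lambda>\<omega>. Y i \<omega> 0 2 - Y i \<omega> 0 1)"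
    and parallel_trends: "\<And>i.
          (\<integral>\<omega>. Y i \<omega> 0 2 - Y i \<omega> 0 1 \<partial>given \<Omega> (\<lambda>\<omega>. first_treated 2 (W i \<omega>))) =
          (\<integral>\<omega>. Y i \<omega> 0 2 - Y i \<omega> 0 1 \<partial>given \<Omega> (\<lambda>\<omega>. never_treated T (W i \<omega>)))"
    and \<theta>_integrable:
      "\<And>i. integrable (given \<Omega> (\<lambda>\<omega>. first_treated 2 (W i \<omega>))) (\<lambda>\<omega>. Y i \<omega> 2 2 - Y i \<omega> 0 2)"
    and \<theta>: "\<And>i. \<theta> = (\<integral>\<omega>. Y i \<omega> 2 2 - Y i \<omega> 0 2 \<partial>given \<Omega> (\<lambda>\<omega>. first_treated 2 (W i \<omega>)))"
    \<comment> \<open>finite second moments in the two cohorts, equivalent to a finite variance of \<open>\<phi>\<close>\<close>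
    and second_moment:
      "\<And>i. integrable \<Omega> (\<lambda>\<omega>. of_bool (first_treated 2 (W i \<omega>)) * (Mstar i \<omega>)\<^sup>2)"
      "\<And>i. integrable \<Omega> (\<lambda>\<omega>. of_bool (never_treated T (W i \<omega>)) * (Mstar i \<omega>)\<^sup>2)"
    and \<mu>G: "is_regression P (\<lambda>w. first_treated 2 w \<and> annotated_both w) features outcome_change \<mu>G"
    and \<mu>C: "is_regression P (\<lambda>w. never_treated T w \<and> annotated_both w) features outcome_change \<mu>C"
    \<comment> \<open>sample split, and estimators computed from the units in \<open>I'\<close>\<close>
    and split: "\<And>n. finite (I n)" "\<And>n. finite (I' n)" "\<And>n. I n \<inter> I' n = {}"
    and card_I: "filterlim (\<lambda>n. card (I n)) at_top sequentially"
    and card_I': "filterlim (\<lambda>n. card (I' n)) at_top sequentially"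
    and \<mu>hat_measurable:
      "\<And>n. case_prod (\<mu>hatG n) \<in> borel_measurable ((\<Pi>\<^sub>M j\<in>I' n. panel_space T) \<Otimes>\<^sub>M borel)"
      "\<And>n. case_prod (\<mu>hatC n) \<in> borel_measurable ((\<Pi>\<^sub>M j\<in>I' n. panel_space T) \<Otimes>\<^sub>M borel)"
    and cohort_indep: "\<And>i. cond_indep \<Omega>
          (\<lambda>\<omega>. (never_treated T (W i \<omega>), first_treated 2 (W i \<omega>))) (count_space UNIV)
          (\<lambda>\<omega>. annotated_both (W i \<omega>)) (count_space UNIV)
          (\<lambda>\<omega>. (covariates (W i \<omega>), unstructureds (W i \<omega>), Mstar i \<omega>)) borel"
    and observed: "\<And>i. AE \<omega> in \<Omega>. \<forall>t\<in>{1..T}.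
          outcome (W i \<omega>) t = of_bool (annotated (W i \<omega>) t) * ground_truth T (W i \<omega>) (Y i \<omega>) t"
    and annotation_indep: "\<And>i. cond_indep \<Omega>
          (\<lambda>\<omega>. (unstructureds (W i \<omega>), Mstar i \<omega>)) borel
          (\<lambda>\<omega>. annotated_both (W i \<omega>)) (count_space UNIV)
          (\<lambda>\<omega>. covariates (W i \<omega>)) borel"
    and \<eta>: "0 < \<eta>" "\<eta> < 1"
    and propensity: "is_propensity P \<pi>" "\<And>x. \<pi> x \<in> {\<eta>..1}"
    and consistent:
      "(\<lambda>n. \<integral>\<^sup>+\<omega>. (\<integral>\<^sup>+x. ennreal ((\<mu>hatG n (\<lambda>j\<in>I' n. W j \<omega>) x - \<mu>G x)\<^sup>2) \<partial>distr P borel features) \<partial>\<Omega>)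
        \<longlonglongrightarrow> 0"
      "(\<lambda>n. \<integral>\<^sup>+\<omega>. (\<integral>\<^sup>+x. ennreal ((\<mu>hatC n (\<lambda>j\<in>I' n. W j \<omega>) x - \<mu>C x)\<^sup>2) \<partial>distr P borel features) \<partial>\<Omega>)
        \<longlonglongrightarrow> 0"
  shows "(\<forall>i. \<theta> = (\<integral>\<omega>. Mstar i \<omega> \<partial>given \<Omega> (\<lambda>\<omega>. first_treated 2 (W i \<omega>))) -
                  (\<integral>\<omega>. Mstar i \<omega> \<partial>given \<Omega> (\<lambda>\<omega>. never_treated T (W i \<omega>)))) \<and>
    \<theta> = \<theta>G - \<theta>C \<and>
    weak_conv_m
          (\<lambda>n. distr \<Omega> borel (\<lambda>\<omega>. sqrt (real (card (I n))) * (\<theta>hat n \<omega> - \<theta>)))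
          (normal_law 0 (prob_space.variance P \<phi>)) \<and>
    efficient_influence_function (known_propensity_model T \<pi>) P
          (cohort_functional (first_treated 2) pG) \<phi>G \<and>
    efficient_influence_function (known_propensity_model T \<pi>) P
          (cohort_functional (never_treated T) pC) \<phi>C \<and>
    efficient_influence_function (known_propensity_model T \<pi>) P
          (\<lambda>Q. cohort_functional (first_treated 2) pG Q - cohort_functional (never_treated T) pC Q) \<phi>"
proof -
  interpret \<Omega>: prob_space \<Omega> by (rule prob)
  have W: "W i \<in> measurable \<Omega> (panel_space T)" for i
    using indep by (simp add: \<Omega>.indep_vars_def)
  have first_treated_W [measurable]: "Measurable.pred \<Omega> (\<lambda>\<omega>. first_treated g (W i \<omega>))" if "g \<in> {2..T}" for g i
    using that by (intro measurable_compose[OF W first_treated_measurable]) auto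
  have never_treated_W [measurable]: "Measurable.pred \<Omega> (\<lambda>\<omega>. never_treated T (W i \<omega>))" for i
    by (rule measurable_compose[OF W never_treated_measurable])
  have Ms [measurable]: "Mstar i \<in> borel_measurable \<Omega>" for i
  proof -
    have "(\<lambda>\<omega>. ground_truth T (W i \<omega>) (Y i \<omega>) t) \<in> borel_measurable \<Omega>" if "t \<in> {1..T}" for t
    proof -
      have [measurable]: "(\<lambda>\<omega>. Y i \<omega> g t) \<in> borel_measurable \<Omega>" if "g \<in> insert 0 {2..T}" for g
        by (rule Y_measurable[OF that \<open>t \<in> {1..T}\<close>])
      show ?thesis
        unfolding ground_truth_def by measurable
    qed
    then show ?thesis
      unfolding Mstar_def ground_truth_change_def using T by (intro borel_measurable_diff) auto
  qed
  have sample: "annotated_sample \<Omega> (W i) (Mstar i) P T \<pi> \<eta>" for i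
  proof unfold_locales
    \<comment> \<open>An unannotated outcome is recorded as 0, so the observed change is tied to the
      ground truth only when both periods are annotated.\<close>
    show "AE \<omega> in \<Omega>. annotated_both (W i \<omega>) \<longrightarrow> outcome_change (W i \<omega>) = Mstar i \<omega>"
      using observed[of i] T
    proof eventually_elim
      case (elim \<omega>)
      then have "outcome (W i \<omega>) 1 = of_bool (annotated (W i \<omega>) 1) * ground_truth T (W i \<omega>) (Y i \<omega>) 1"
        "outcome (W i \<omega>) 2 = of_bool (annotated (W i \<omega>) 2) * ground_truth T (W i \<omega>) (Y i \<omega>) 2"
        using T by auto
      with elim show ?case
        by (auto simp: annotated_both_def outcome_change_def Mstar_def ground_truth_change_def)
    qed
  qed (use T W law Ms cohort_indep annotation_indep \<eta> propensity in auto)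
  interpret S: annotated_sample \<Omega> "W 0" "Mstar 0" P T \<pi> \<eta> by (rule sample)
  have posG: "\<P>(w in P. first_treated 2 w) > 0" and posC: "\<P>(w in P. never_treated T w) > 0"
    using pG_pos pC_pos by (simp_all add: pG_def pC_def)
  have qG: "first_treated 2 w \<longleftrightarrow> (never_treated T w, first_treated 2 w) \<in> {c. snd c}"
    and qC: "never_treated T w \<longleftrightarrow> (never_treated T w, first_treated 2 w) \<in> {c. fst c}"
    for w :: "('k, 'l) panel"
    by simp_all
  interpret G: panel_cohort P "first_treated 2" \<pi> \<eta> T
    by (rule S.panel_cohort[OF qG posG second_moment(1)])
  interpret C: panel_cohort P "never_treated T" \<pi> \<eta> T
    by (rule S.panel_cohort[OF qC posC second_moment(2)])
  have pG: "pG = G.p" and pC: "pC = C.p"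
    by (simp_all add: pG_def pC_def G.p_def C.p_def)

  \<comment> \<open>Identification by difference-in-differences\<close>
  have identification: "\<theta> = (\<integral>\<omega>. Mstar i \<omega> \<partial>given \<Omega> (\<lambda>\<omega>. first_treated 2 (W i \<omega>))) -
      (\<integral>\<omega>. Mstar i \<omega> \<partial>given \<Omega> (\<lambda>\<omega>. never_treated T (W i \<omega>)))" for i
  proof -
    interpret Si: annotated_sample \<Omega> "W i" "Mstar i" P T \<pi> \<eta> by (rule sample)
    have Ym [measurable]: "(\<lambda>\<omega>. Y i \<omega> g t) \<in> borel_measurable \<Omega>" if "g \<in> {0, 2}" "t \<in> {1, 2}" for g t
      using that T by (intro Y_measurable) auto
    have Gm: "Measurable.pred \<Omega> (\<lambda>\<omega>. first_treated 2 (W i \<omega>))"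
      by (rule Si.W_measurable(1))
    have posG': "\<Omega>.prob {\<omega> \<in> space \<Omega>. first_treated 2 (W i \<omega>)} > 0"
      using Si.prob_cohort[OF qG posG second_moment(1)] posG by simp
    have posC': "\<Omega>.prob {\<omega> \<in> space \<Omega>. never_treated T (W i \<omega>)} > 0"
      using Si.prob_cohort[OF qC posC second_moment(2)] posC by simp
    let ?G = "given \<Omega> (\<lambda>\<omega>. first_treated 2 (W i \<omega>))" and ?C = "given \<Omega> (\<lambda>\<omega>. never_treated T (W i \<omega>))"
    have sets: "sets ?G = sets \<Omega>" "sets ?C = sets \<Omega>"
      by (simp_all add: given_def)
    \<comment> \<open>Only the summand g = 2 survives. The period 1 outcome is
      \<open>Y i \<omega> 2 1\<close> and not \<open>Y i \<omega> 0 1\<close>; this is the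
      discrepancy that no anticipation removes in mean.\<close>
    have MG: "Mstar i \<omega> = Y i \<omega> 2 2 - Y i \<omega> 2 1" if "first_treated 2 (W i \<omega>)" for \<omega>
    proof -
      have "first_treated g (W i \<omega>) \<longleftrightarrow> g = 2" if "g \<in> {2..T}" for g
        using \<open>first_treated 2 (W i \<omega>)\<close> that by (auto simp: first_treated_def)
      then have "(\<Sum>g=2..T. (Y i \<omega> g t - Y i \<omega> 0 t) * of_bool (first_treated g (W i \<omega>))) =
          (\<Sum>g=2..T. if g = 2 then Y i \<omega> 2 t - Y i \<omega> 0 t else 0)" for t
        by (intro sum.cong) auto
      then show ?thesis
        using T by (simp add: Mstar_def ground_truth_change_def ground_truth_def)
    qed
    have MC: "Mstar i \<omega> = Y i \<omega> 0 2 - Y i \<omega> 0 1" if "never_treated T (W i \<omega>)" for \<omega>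
    proof -
      have "(\<Sum>g=2..T. (Y i \<omega> g t - Y i \<omega> 0 t) * of_bool (first_treated g (W i \<omega>))) = 0" for t
        using that by (intro sum.neutral) (auto simp: first_treated_def never_treated_def)
      then show ?thesis
        by (simp add: Mstar_def ground_truth_change_def ground_truth_def)
    qed
    \<comment> \<open>The three summands are the treatment effect at time 2, the untreated trend and
      the anticipation effect.\<close>
    have "(\<integral>\<omega>. Mstar i \<omega> \<partial>?G) =
        (\<integral>\<omega>. (Y i \<omega> 2 2 - Y i \<omega> 0 2) + (Y i \<omega> 0 2 - Y i \<omega> 0 1) + (Y i \<omega> 0 1 - Y i \<omega> 2 1) \<partial>?G)"
    proof (rule integral_cong_AE)
      show "AE \<omega> in ?G. Mstar i \<omega> = (Y i \<omega> 2 2 - Y i \<omega> 0 2) + (Y i \<omega> 0 2 - Y i \<omega> 0 1) + (Y i \<omega> 0 1 - Y i \<omega> 2 1)"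
        unfolding \<Omega>.AE_given[OF Gm posG'] using MG by auto
    qed (simp_all add: measurable_cong_sets[OF sets(1) refl])
    also have "\<dots> = (\<integral>\<omega>. Y i \<omega> 2 2 - Y i \<omega> 0 2 \<partial>?G) + (\<integral>\<omega>. Y i \<omega> 0 2 - Y i \<omega> 0 1 \<partial>?G) +
        ((\<integral>\<omega>. Y i \<omega> 0 1 \<partial>?G) - (\<integral>\<omega>. Y i \<omega> 2 1 \<partial>?G))"
      using \<theta>_integrable[of i] pt_integrable(1)[of i] na_integrable[of i]
      by (simp only: Bochner_Integration.integral_add Bochner_Integration.integrable_add
          Bochner_Integration.integral_diff[OF na_integrable(2,1)] Bochner_Integration.integrable_diff)
    also have "\<dots> = \<theta> + (\<integral>\<omega>. Y i \<omega> 0 2 - Y i \<omega> 0 1 \<partial>?C)"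
      using \<theta>[of i] no_anticipation[of i] parallel_trends[of i] by simp
    also have "(\<integral>\<omega>. Y i \<omega> 0 2 - Y i \<omega> 0 1 \<partial>?C) = (\<integral>\<omega>. Mstar i \<omega> \<partial>?C)"
    proof (rule integral_cong_AE)
      show "AE \<omega> in ?C. Y i \<omega> 0 2 - Y i \<omega> 0 1 = Mstar i \<omega>"
        unfolding \<Omega>.AE_given[OF never_treated_W posC'] using MC by auto
    qed (simp_all add: measurable_cong_sets[OF sets(2) refl])
    finally show ?thesis by simp
  qed

  \<comment> \<open>\<theta>G depends on the common law only, so unit 0 may represent all
    units.\<close>
  have \<theta>G: "\<theta>G = (\<integral>\<omega>. Mstar 0 \<omega> \<partial>given \<Omega> (\<lambda>\<omega>. first_treated 2 (W 0 \<omega>)))"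
    unfolding \<theta>G_def by (rule S.integral_regression_ground_truth[OF qG posG second_moment(1) \<mu>G])
  have \<theta>C: "\<theta>C = (\<integral>\<omega>. Mstar 0 \<omega> \<partial>given \<Omega> (\<lambda>\<omega>. never_treated T (W 0 \<omega>)))"
    unfolding \<theta>C_def by (rule S.integral_regression_ground_truth[OF qC posC second_moment(2) \<mu>C])
  have \<theta>_eq: "\<theta> = \<theta>G - \<theta>C"
    unfolding \<theta>G \<theta>C by (rule identification)

  \<comment> \<open>Efficient influence functions\<close>
  have eifG: "efficient_influence_function (known_propensity_model T \<pi>) P (cohort_functional (first_treated 2) pG) \<phi>G"
    unfolding \<phi>G_def pG by (rule G.efficient_influence_function_cohort[OF \<mu>G meta_eq_to_obj_eq[OF \<theta>G_def]])
  have eifC: "efficient_influence_function (known_propensity_model T \<pi>) P (cohort_functional (never_treated T) pC) \<phi>C"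
    unfolding \<phi>C_def pC by (rule C.efficient_influence_function_cohort[OF \<mu>C meta_eq_to_obj_eq[OF \<theta>C_def]])
  have sqG: "square_integrable P (aipw (first_treated 2) pG \<pi> \<mu>G)"
    and sqC: "square_integrable P (aipw (never_treated T) pC \<pi> \<mu>C)"
    unfolding pG pC by (rule G.square_integrable_aipw[OF \<mu>G] C.square_integrable_aipw[OF \<mu>C])+
  have meanG: "(\<integral>w. aipw (first_treated 2) pG \<pi> \<mu>G w \<partial>P) = \<theta>G"
    and meanC: "(\<integral>w. aipw (never_treated T) pC \<pi> \<mu>C w \<partial>P) = \<theta>C"
    unfolding pG pC \<theta>G_def \<theta>C_def by (rule G.integral_aipw[OF \<mu>G] C.integral_aipw[OF \<mu>C])+
  have \<phi>_eq: "\<phi> = (\<lambda>w. (aipw (first_treated 2) pG \<pi> \<mu>G w - aipw (never_treated T) pC \<pi> \<mu>C w) - (\<theta>G - \<theta>C))"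
    by (auto simp: \<phi>_def \<phi>G_def \<phi>C_def)
  have const: "square_integrable P (\<lambda>w. c)" for c :: real
    by (rule G.square_integrable_bounded[where c="\<bar>c\<bar>"]) auto
  have sq\<phi>G: "square_integrable P \<phi>G" and sq\<phi>C: "square_integrable P \<phi>C" and sq\<phi>: "square_integrable P \<phi>"
    unfolding \<phi>_def \<phi>G_def \<phi>C_def by (intro square_integrable_diff sqG sqC const)+
  have mean_diff: "\<theta>G - \<theta>C = (\<integral>w. aipw (first_treated 2) pG \<pi> \<mu>G w - aipw (never_treated T) pC \<pi> \<mu>C w \<partial>P)"
    using G.square_integrable_imp_integrable'[OF sqG] G.square_integrable_imp_integrable'[OF sqC]
    by (simp add: meanG meanC)
  have eif: "efficient_influence_function (known_propensity_model T \<pi>) P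
      (\<lambda>Q. cohort_functional (first_treated 2) pG Q - cohort_functional (never_treated T) pC Q) \<phi>"
    unfolding efficient_influence_function_def
  proof (intro conjI allI impI)
    show "P \<in> known_propensity_model T \<pi>"
      using eifG by (simp add: efficient_influence_function_def)
    \<comment> \<open>Both cohorts use the same covariates, annotation and \<pi>, so their notions
      of approximability are literally the same and the difference stays in the closure.\<close>
    have "G.approximable (\<lambda>w. aipw (first_treated 2) pG \<pi> \<mu>G w - aipw (never_treated T) pC \<pi> \<mu>C w)"
      unfolding pG pC
      by (rule G.approximable_diff[OF G.approximable_aipw[OF \<mu>G] C.approximable_aipw[OF \<mu>C]])
    then show "\<phi> \<in> tangent_space (known_propensity_model T \<pi>) P"
      unfolding \<phi>_eq by (rule G.cohort_tangent_space[OF _ mean_diff])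
    fix Q h assume Q: "regular_submodel (known_propensity_model T \<pi>) P Q h"
    then have h: "square_integrable P h"
      by (simp add: regular_submodel_def)
    have "((\<lambda>t. (cohort_functional (first_treated 2) pG (Q t) - cohort_functional (first_treated 2) pG P) / t -
        (cohort_functional (never_treated T) pC (Q t) - cohort_functional (never_treated T) pC P) / t) \<longlongrightarrow>
        (\<integral>w. \<phi>G w * h w \<partial>P) - (\<integral>w. \<phi>C w * h w \<partial>P)) (at_right 0)"
      using eifG eifC Q by (intro tendsto_diff) (auto simp: efficient_influence_function_def)
    also have "(\<integral>w. \<phi>G w * h w \<partial>P) - (\<integral>w. \<phi>C w * h w \<partial>P) = (\<integral>w. \<phi> w * h w \<partial>P)"
      unfolding \<phi>_def left_diff_distrib
      by (rule Bochner_Integration.integral_diff[symmetric] square_integrable_mult sq\<phi>G sq\<phi>C h)+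
    finally show "((\<lambda>t. (cohort_functional (first_treated 2) pG (Q t) - cohort_functional (never_treated T) pC (Q t) -
        (cohort_functional (first_treated 2) pG P - cohort_functional (never_treated T) pC P)) / t) \<longlongrightarrow>
        (\<integral>w. \<phi> w * h w \<partial>P)) (at_right 0)"
      by (rule back_subst[where P="\<lambda>f. (f \<longlongrightarrow> _) _"]) (auto simp: diff_divide_distrib)
  qed

  \<comment> \<open>Normal limit of the estimator\<close>
  have \<phi>_mean: "(\<integral>w. \<phi> w \<partial>P) = 0"
    using G.square_integrable_imp_integrable'[OF sqG] G.square_integrable_imp_integrable'[OF sqC]
    unfolding \<phi>_eq by (simp add: meanG meanC G.prob_space)
  have qGm: "Measurable.pred (panel_space T) (first_treated 2 :: ('k, 'l) panel \<Rightarrow> bool)"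
    and qCm: "Measurable.pred (panel_space T) (never_treated T :: ('k, 'l) panel \<Rightarrow> bool)"
    using T by (auto intro: first_treated_measurable never_treated_measurable)
  note \<mu>_meas = G.m_measurable[OF \<mu>G] C.m_measurable[OF \<mu>C]
  have fixed_meas: "(\<lambda>w. aipw q p \<pi> m w) \<in> borel_measurable (panel_space T)"
    if "Measurable.pred (panel_space T) q" "m \<in> borel_measurable borel" for q p and m :: "('k, 'l) features \<Rightarrow> real"
    \<comment> \<open>A fixed regression is treated as an estimated one with trivial training
      data.\<close>
    by (rule aipw_measurable[OF T that(1) S.\<pi>_measurable, where N="count_space UNIV" and k="\<lambda>_. m" and d="\<lambda>_. ()"])
      (auto intro: measurable_compose[OF measurable_snd that(2)] simp: split_def)
  have \<phi>_meas: "\<phi> \<in> borel_measurable (panel_space T)"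
    unfolding \<phi>_eq by (intro borel_measurable_diff borel_measurable_const fixed_meas qGm qCm \<mu>_meas)
  let ?D = "\<lambda>n \<omega>. \<lambda>j\<in>I' n. W j \<omega>"
  let ?N = "\<lambda>n. \<Pi>\<^sub>M j\<in>I' n. panel_space T"
  define g where "g n d w =
      (aipw (first_treated 2) pG \<pi> (\<mu>hatG n d) w - aipw (first_treated 2) pG \<pi> \<mu>G w) -
      (aipw (never_treated T) pC \<pi> (\<mu>hatC n d) w - aipw (never_treated T) pC \<pi> \<mu>C w)" for n d w
  \<comment> \<open>The factor 2 comes from (x - y)^2 \<le> 2 x^2 + 2 y^2, the rest from
    \<open>remainder_le\<close>.\<close>
  define KG where "KG = 2 * (1 / (pG * \<eta>))\<^sup>2"
  define KC where "KC = 2 * (1 / (pC * \<eta>))\<^sup>2"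
  have K_pos: "0 < KG" "0 < KC"
    using pG_pos pC_pos \<eta> by (simp_all add: KG_def KC_def)
  define eG where "eG n d w = ennreal ((\<mu>hatG n d (features w) - \<mu>G (features w))\<^sup>2)" for n d w
  define eC where "eC n d w = ennreal ((\<mu>hatC n d (features w) - \<mu>C (features w))\<^sup>2)" for n d w
  \<comment> \<open>The errors are measured over the whole feature law, as in the consistency
    assumption. Finite mean of \<open>b\<close> makes both of them square integrable, which is what
    centring requires.\<close>
  define b where "b n d w = ennreal KG * eG n d w + ennreal KC * eC n d w" for n d w
  have e_meas: "(\<lambda>x. ennreal ((k (fst x) (features (snd x)) - m (features (snd x)))\<^sup>2)) \<in> borel_measurable (N \<Otimes>\<^sub>M panel_space T)"
    if k: "case_prod k \<in> borel_measurable (N \<Otimes>\<^sub>M borel)" and m: "m \<in> borel_measurable borel"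
    for N :: "(nat \<Rightarrow> ('k, 'l) panel) measure" and k and m :: "('k, 'l) features \<Rightarrow> real"
  proof -
    note feat = measurable_compose[OF measurable_snd features_measurable[OF T]]
    have "(\<lambda>x. case_prod k (fst x, features (snd x))) \<in> borel_measurable (N \<Otimes>\<^sub>M panel_space T)"
      by (rule measurable_compose[OF measurable_Pair[OF measurable_fst feat] k])
    then show ?thesis
      unfolding case_prod_conv
      by (intro measurable_compose[OF _ measurable_ennreal] borel_measurable_power borel_measurable_diff
          measurable_compose[OF feat m])
  qed
  have eG_meas: "case_prod (eG n) \<in> borel_measurable (?N n \<Otimes>\<^sub>M panel_space T)"
    and eC_meas: "case_prod (eC n) \<in> borel_measurable (?N n \<Otimes>\<^sub>M panel_space T)" for n
    unfolding eG_def[abs_def] eC_def[abs_def] split_def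
    by (intro e_meas \<mu>hat_measurable \<mu>_meas)+
  have section_meas: "k d \<in> borel_measurable N2"
    if k: "case_prod k \<in> borel_measurable (N1 \<Otimes>\<^sub>M N2)" and d: "d \<in> space N1"
    for k :: "(nat \<Rightarrow> ('k, 'l) panel) \<Rightarrow> 'c \<Rightarrow> 'd::topological_space" and d N1 N2
  proof -
    have "(\<lambda>w. case_prod k (d, w)) \<in> borel_measurable N2"
      by (rule measurable_compose[OF measurable_Pair1' k]) (rule d)
    then show ?thesis unfolding case_prod_conv .
  qed
  have D: "?D n \<in> measurable \<Omega> (?N n)" for n
    by (intro measurable_restrict W)
  have "weak_conv_m (\<lambda>n. distr \<Omega> borel (\<lambda>\<omega>. sqrt (real (card (I n))) * (\<theta>hat n \<omega> - \<theta>)))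
      (normal_law 0 (\<integral>w. (\<phi> w)\<^sup>2 \<partial>P))"
  proof (rule \<Omega>.sample_split_weak_conv[OF indep law \<phi>_meas sq\<phi> \<phi>_mean split card_I])
    show "case_prod (g n) \<in> borel_measurable (?N n \<Otimes>\<^sub>M panel_space T)" for n
      unfolding g_def[abs_def] split_def
      by (rule borel_measurable_diff[OF
          borel_measurable_diff[OF aipw_measurable[OF T qGm S.\<pi>_measurable \<mu>hat_measurable(1) measurable_fst measurable_snd]
            measurable_compose[OF measurable_snd fixed_meas[OF qGm \<mu>_meas(1)]]]
          borel_measurable_diff[OF aipw_measurable[OF T qCm S.\<pi>_measurable \<mu>hat_measurable(2) measurable_fst measurable_snd]
            measurable_compose[OF measurable_snd fixed_meas[OF qCm \<mu>_meas(2)]]]])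
    show "case_prod (b n) \<in> borel_measurable (?N n \<Otimes>\<^sub>M panel_space T)" for n
      using eG_meas[of n] eC_meas[of n] unfolding b_def[abs_def] split_def
      by (intro borel_measurable_add borel_measurable_times_ennreal borel_measurable_const)
    show "ennreal ((g n d w)\<^sup>2) \<le> b n d w" for n d w
    proof -
      let ?x = "aipw (first_treated 2) pG \<pi> (\<mu>hatG n d) w - aipw (first_treated 2) pG \<pi> \<mu>G w"
      let ?y = "aipw (never_treated T) pC \<pi> (\<mu>hatC n d) w - aipw (never_treated T) pC \<pi> \<mu>C w"
      have "(g n d w)\<^sup>2 \<le> 2 * ?x\<^sup>2 + 2 * ?y\<^sup>2"
        unfolding g_def by (rule power2_diff_le)
      also have "\<dots> \<le> KG * (\<mu>hatG n d (features w) - \<mu>G (features w))\<^sup>2 + KC * (\<mu>hatC n d (features w) - \<mu>C (features w))\<^sup>2"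
        using G.remainder_le[of \<mu>G "\<mu>hatG n d" w] C.remainder_le[of \<mu>C "\<mu>hatC n d" w]
        unfolding pG pC KG_def KC_def G.aipw_diff C.aipw_diff by linarith
      finally show ?thesis
        using K_pos by (simp add: b_def eG_def eC_def ennreal_mult[symmetric] ennreal_plus[symmetric] del: ennreal_plus)
    qed
    show "(\<integral>w. g n d w \<partial>P) = 0" if d: "d \<in> space (?N n)" and fin: "(\<integral>\<^sup>+w. b n d w \<partial>P) < \<infinity>" for n d
    proof -
      note hat = section_meas[OF \<mu>hat_measurable(1) d] section_meas[OF \<mu>hat_measurable(2) d]
      have e: "eG n d \<in> borel_measurable P" "eC n d \<in> borel_measurable P"
        unfolding S.measurable_P by (intro section_meas[OF eG_meas d] section_meas[OF eC_meas d])+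
      have "(\<integral>\<^sup>+w. b n d w \<partial>P) = ennreal KG * (\<integral>\<^sup>+w. eG n d w \<partial>P) + ennreal KC * (\<integral>\<^sup>+w. eC n d w \<partial>P)"
        unfolding b_def using e by (simp add: nn_integral_add nn_integral_cmult)
      \<comment> \<open>Positivity of the two constants lets finiteness of the sum pass to each
        error.\<close>
      with fin K_pos have "(\<integral>\<^sup>+w. eG n d w \<partial>P) < \<infinity>" "(\<integral>\<^sup>+w. eC n d w \<partial>P) < \<infinity>"
        by (auto simp: ennreal_mult_less_top)
      then show ?thesis
        using G.integral_remainder[OF \<mu>_meas(1) hat(1)] C.integral_remainder[OF \<mu>_meas(2) hat(2)]
        unfolding g_def pG pC G.aipw_diff C.aipw_diff eG_def eC_def by simp
    qed
    show "(\<lambda>n. \<integral>\<^sup>+\<omega>. \<integral>\<^sup>+w. b n (?D n \<omega>) w \<partial>P \<partial>\<Omega>) \<longlonglongrightarrow> 0"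
    proof -
      have eq: "(\<integral>\<^sup>+\<omega>. \<integral>\<^sup>+w. b n (?D n \<omega>) w \<partial>P \<partial>\<Omega>) =
          ennreal KG * (\<integral>\<^sup>+\<omega>. \<integral>\<^sup>+x. ennreal ((\<mu>hatG n (?D n \<omega>) x - \<mu>G x)\<^sup>2) \<partial>distr P borel features \<partial>\<Omega>) +
          ennreal KC * (\<integral>\<^sup>+\<omega>. \<integral>\<^sup>+x. ennreal ((\<mu>hatC n (?D n \<omega>) x - \<mu>C x)\<^sup>2) \<partial>distr P borel features \<partial>\<Omega>)" for n
      proof -
        have inner_meas: "(\<lambda>\<omega>. \<integral>\<^sup>+w. e (?D n \<omega>) w \<partial>P) \<in> borel_measurable \<Omega>"
          if "case_prod e \<in> borel_measurable (?N n \<Otimes>\<^sub>M panel_space T)" for e :: "_ \<Rightarrow> _ \<Rightarrow> ennreal"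
        proof (rule measurable_compose[OF D G.borel_measurable_nn_integral])
          show "case_prod e \<in> borel_measurable (?N n \<Otimes>\<^sub>M P)"
            using that by (simp only: measurable_cong_sets[OF sets_pair_measure_cong[OF refl S.sets_P] refl])
        qed
        have "(\<integral>\<^sup>+\<omega>. \<integral>\<^sup>+w. b n (?D n \<omega>) w \<partial>P \<partial>\<Omega>) =
            (\<integral>\<^sup>+\<omega>. ennreal KG * (\<integral>\<^sup>+w. eG n (?D n \<omega>) w \<partial>P) + ennreal KC * (\<integral>\<^sup>+w. eC n (?D n \<omega>) w \<partial>P) \<partial>\<Omega>)"
        proof (rule nn_integral_cong)
          fix \<omega> assume "\<omega> \<in> space \<Omega>"
          then have d: "?D n \<omega> \<in> space (?N n)" by (rule measurable_space[OF D])
          have "eG n (?D n \<omega>) \<in> borel_measurable P" "eC n (?D n \<omega>) \<in> borel_measurable P"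
            unfolding S.measurable_P by (intro section_meas[OF eG_meas d] section_meas[OF eC_meas d])+
          then show "(\<integral>\<^sup>+w. b n (?D n \<omega>) w \<partial>P) =
              ennreal KG * (\<integral>\<^sup>+w. eG n (?D n \<omega>) w \<partial>P) + ennreal KC * (\<integral>\<^sup>+w. eC n (?D n \<omega>) w \<partial>P)"
            unfolding b_def by (simp add: nn_integral_add nn_integral_cmult)
        qed
        also have "\<dots> = ennreal KG * (\<integral>\<^sup>+\<omega>. \<integral>\<^sup>+w. eG n (?D n \<omega>) w \<partial>P \<partial>\<Omega>) +
            ennreal KC * (\<integral>\<^sup>+\<omega>. \<integral>\<^sup>+w. eC n (?D n \<omega>) w \<partial>P \<partial>\<Omega>)"
          using inner_meas[OF eG_meas] inner_meas[OF eC_meas]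
          by (simp add: nn_integral_add nn_integral_cmult)
        also have "(\<integral>\<^sup>+\<omega>. \<integral>\<^sup>+w. eG n (?D n \<omega>) w \<partial>P \<partial>\<Omega>) =
            (\<integral>\<^sup>+\<omega>. \<integral>\<^sup>+x. ennreal ((\<mu>hatG n (?D n \<omega>) x - \<mu>G x)\<^sup>2) \<partial>distr P borel features \<partial>\<Omega>)"
        proof (rule nn_integral_cong)
          fix \<omega> assume \<omega>: "\<omega> \<in> space \<Omega>"
          note [measurable] = \<mu>_meas section_meas[OF \<mu>hat_measurable(1) measurable_space[OF D \<omega>]]
          show "(\<integral>\<^sup>+w. eG n (?D n \<omega>) w \<partial>P) =
              (\<integral>\<^sup>+x. ennreal ((\<mu>hatG n (?D n \<omega>) x - \<mu>G x)\<^sup>2) \<partial>distr P borel features)"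
            unfolding eG_def by (rule nn_integral_distr[symmetric]) measurable
        qed
        also have "(\<integral>\<^sup>+\<omega>. \<integral>\<^sup>+w. eC n (?D n \<omega>) w \<partial>P \<partial>\<Omega>) =
            (\<integral>\<^sup>+\<omega>. \<integral>\<^sup>+x. ennreal ((\<mu>hatC n (?D n \<omega>) x - \<mu>C x)\<^sup>2) \<partial>distr P borel features \<partial>\<Omega>)"
        proof (rule nn_integral_cong)
          fix \<omega> assume \<omega>: "\<omega> \<in> space \<Omega>"
          note [measurable] = \<mu>_meas section_meas[OF \<mu>hat_measurable(2) measurable_space[OF D \<omega>]]
          show "(\<integral>\<^sup>+w. eC n (?D n \<omega>) w \<partial>P) =
              (\<integral>\<^sup>+x. ennreal ((\<mu>hatC n (?D n \<omega>) x - \<mu>C x)\<^sup>2) \<partial>distr P borel features)"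
            unfolding eC_def by (rule nn_integral_distr[symmetric]) measurable
        qed
        finally show ?thesis .
      qed
      have "(\<lambda>n. ennreal KG * (\<integral>\<^sup>+\<omega>. \<integral>\<^sup>+x. ennreal ((\<mu>hatG n (?D n \<omega>) x - \<mu>G x)\<^sup>2) \<partial>distr P borel features \<partial>\<Omega>) +
          ennreal KC * (\<integral>\<^sup>+\<omega>. \<integral>\<^sup>+x. ennreal ((\<mu>hatC n (?D n \<omega>) x - \<mu>C x)\<^sup>2) \<partial>distr P borel features \<partial>\<Omega>))
          \<longlonglongrightarrow> ennreal KG * 0 + ennreal KC * 0"
        by (intro tendsto_add ennreal_tendsto_cmult consistent) auto
      then show ?thesis unfolding eq by simp
    qed
    show "sqrt (real (card (I n))) * (\<theta>hat n \<omega> - \<theta>) =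
        (\<Sum>i\<in>I n. \<phi> (W i \<omega>) + g n (?D n \<omega>) (W i \<omega>)) / sqrt (real (card (I n)))" for n \<omega>
    \<comment> \<open>For an empty sample both sides are 0, by sqrt 0 = 0 and the convention for
      division by 0.\<close>
    proof (cases "card (I n) = 0")
      case True
      then show ?thesis by simp
    next
      case False
      let ?c = "real (card (I n))"
      let ?a = "\<Sum>i\<in>I n. aipw (first_treated 2) pG \<pi> (\<mu>hatG n (?D n \<omega>)) (W i \<omega>)"
      let ?a' = "\<Sum>i\<in>I n. aipw (never_treated T) pC \<pi> (\<mu>hatC n (?D n \<omega>)) (W i \<omega>)"
      have c: "0 < ?c" using False by simp
      have "(\<Sum>i\<in>I n. \<phi> (W i \<omega>) + g n (?D n \<omega>) (W i \<omega>)) =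
          (\<Sum>i\<in>I n. aipw (first_treated 2) pG \<pi> (\<mu>hatG n (?D n \<omega>)) (W i \<omega>) -
            aipw (never_treated T) pC \<pi> (\<mu>hatC n (?D n \<omega>)) (W i \<omega>) - \<theta>)"
        by (rule sum.cong) (auto simp: \<phi>_eq g_def \<theta>_eq)
      also have "\<dots> = ?a - ?a' - ?c * \<theta>"
        by (simp add: sum_subtractf)
      also have "\<dots> = ?c * (\<theta>hat n \<omega> - \<theta>)"
        using c by (simp add: \<theta>hat_def \<theta>hatG_def \<theta>hatC_def field_simps)
      finally have "(\<Sum>i\<in>I n. \<phi> (W i \<omega>) + g n (?D n \<omega>) (W i \<omega>)) / sqrt ?c = ?c / sqrt ?c * (\<theta>hat n \<omega> - \<theta>)"
        by simp
      then show ?thesis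
        unfolding real_div_sqrt[OF less_imp_le[OF c]] by (rule sym)
    qed
  qed
  then have "weak_conv_m (\<lambda>n. distr \<Omega> borel (\<lambda>\<omega>. sqrt (real (card (I n))) * (\<theta>hat n \<omega> - \<theta>)))
      (normal_law 0 (G.variance \<phi>))"
    by (simp add: \<phi>_mean)
  then show ?thesis
    by (intro conjI allI identification \<theta>_eq eifG eifC eif)
qed

end
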